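(* Let $N\ge5$ and let $\Omega$ be a bounded open subset of $\mathbb{R}^N$ of class $C^2$. Then there exists a function $F\in L^2(\Omega)$ such that the corresponding weak solution $u$ of the boundary value problem $-\Delta u=F(x)$, $u\in H_0^1(\Omega)$, is pointwise maximally singular in the whole of $\overline\Omega$, i.e. $(\operatorname{sd}u)(a)=N-4$ for all $a\in\overline\Omega$.
   Context: For a Lebesgue measurable function $u:\Omega\to\overline{\mathbb{R}}$ on an open set $\Omega\subseteq\mathbb{R}^N$, the singular set $\operatorname{Sing}u$ is the set of points $a\in\Omega$ for which there exist positive constants $C=C(a)$, $\gamma=\gamma(a)$, $r=r(a)$ such that $u(x)\ge C|x-a|^{-\gamma}$ for a.e. $x\in B_r(a)$, where $B_r(a)$ is the open ball of radius $r$ centred at $a$. For $a\in\overline\Omega$, the singular dimension of $u$ at $a$ is $$(\operatorname{sd}u)(a):=\lim_{r\to0}\dim_H\bigl(\operatorname{Sing}(u|_{B_r(a)\cap\Omega})\bigr),$$ where $\dim_H$ is the Hausdorff dimension (with $\dim_H\emptyset=0$). *)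

theory Defs
  imports "HOL-Analysis.Analysis"
begin

section \<open>Hausdorff dimension\<close>

text \<open>
  The \<open>s\<close>-th power of the diameter of a bounded set, with the convention that for \<open>s = 0\<close> a
  nonempty set has weight \<open>1\<close>, also if its diameter is \<open>0\<close> (note \<open>0 powr 0 = 0\<close> in HOL).
\<close>

definition diam_power :: "real \<Rightarrow> 'a::metric_space set \<Rightarrow> ennreal" where
  "diam_power s U = (if U = {} then 0 else if s = 0 then 1 else ennreal (diameter U powr s))"

text \<open>Boundedness is required of the covering sets since \<open>diameter\<close> is \<open>0\<close> on unbounded sets.\<close>

definition hausdorff_premeasure :: "real \<Rightarrow> real \<Rightarrow> 'a::metric_space set \<Rightarrow> ennreal" where
  "hausdorff_premeasure s \<delta> A =
     (INF U \<in> {U :: nat \<Rightarrow> 'a set. A \<subseteq> (\<Union>i. U i) \<and> (\<forall>i. bounded (U i) \<and> diameter (U i) \<le> \<delta>)}.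
        \<Sum>i. diam_power s (U i))"

definition hausdorff_measure :: "real \<Rightarrow> 'a::metric_space set \<Rightarrow> ennreal" where
  "hausdorff_measure s A = (SUP \<delta> \<in> {0<..}. hausdorff_premeasure s \<delta> A)"

definition hausdorff_dim :: "'a::metric_space set \<Rightarrow> ereal" where
  "hausdorff_dim A = (INF s \<in> {s. 0 \<le> s \<and> hausdorff_measure s A = 0}. ereal s)"


section \<open>Singular set and singular dimension\<close>

text \<open>
  The first argument is the domain of the function: \<open>sing_set (ball a r \<inter> \<Omega>) u\<close> is the singular
  set of the restriction of \<open>u\<close> to \<open>ball a r \<inter> \<Omega>\<close>, so the balls on which the lower bound is
  required have to lie in that smaller set.
\<close>

definition sing_set :: "'a::euclidean_space set \<Rightarrow> ('a \<Rightarrow> ereal) \<Rightarrow> 'a set" where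
  "sing_set \<Omega> u = {a \<in> \<Omega>. \<exists>C \<gamma> r. 0 < C \<and> 0 < \<gamma> \<and> 0 < r \<and> ball a r \<subseteq> \<Omega> \<and>
     (AE x in lebesgue. x \<in> ball a r \<longrightarrow> ereal (C * norm (x - a) powr (- \<gamma>)) \<le> u x)}"

definition sing_dim :: "'a::euclidean_space set \<Rightarrow> ('a \<Rightarrow> ereal) \<Rightarrow> 'a \<Rightarrow> ereal" where
  "sing_dim \<Omega> u a = Lim (at_right 0) (\<lambda>r. hausdorff_dim (sing_set (ball a r \<inter> \<Omega>) u))"

text \<open>The limit defining the singular dimension always exists, by monotonicity.\<close>

lemma hausdorff_premeasure_mono:
  "A \<subseteq> B \<Longrightarrow> hausdorff_premeasure s \<delta> A \<le> hausdorff_premeasure s \<delta> B"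
  unfolding hausdorff_premeasure_def by (rule INF_superset_mono) auto

lemma hausdorff_measure_mono:
  "A \<subseteq> B \<Longrightarrow> hausdorff_measure s A \<le> hausdorff_measure s B"
  unfolding hausdorff_measure_def by (rule SUP_mono) (auto intro: hausdorff_premeasure_mono)

lemma hausdorff_dim_mono:
  assumes "A \<subseteq> B"
  shows "hausdorff_dim A \<le> hausdorff_dim B"
proof -
  have "hausdorff_measure s A = 0" if "hausdorff_measure s B = 0" for s
    using hausdorff_measure_mono[OF assms, of s] that by simp
  then show ?thesis
    unfolding hausdorff_dim_def by (intro INF_superset_mono) auto
qed

lemma sing_set_mono: "V \<subseteq> W \<Longrightarrow> sing_set V u \<subseteq> sing_set W u"
  unfolding sing_set_def by blast

lemma tendsto_sing_dim:
  "((\<lambda>r. hausdorff_dim (sing_set (ball a r \<inter> \<Omega>) u)) \<longlongrightarrow> sing_dim \<Omega> u a) (at_right 0)"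
proof -
  let ?f = "\<lambda>r. hausdorff_dim (sing_set (ball a r \<inter> \<Omega>) u)"
  have mono: "?f r \<le> ?f r'" if "r \<le> r'" for r r'
    using that by (intro hausdorff_dim_mono sing_set_mono) auto
  have "(?f \<longlongrightarrow> (INF r \<in> {0<..}. ?f r)) (at_right 0)"
  proof (rule order_tendstoI)
    fix y assume y: "y < (INF r \<in> {0<..}. ?f r)"
    have "y < ?f r" if "0 < r" for r
      using y that by (meson INF_lower greaterThan_iff less_le_trans)
    then show "\<forall>\<^sub>F r in at_right 0. y < ?f r"
      by (auto simp: eventually_at_right_field intro: exI[of _ 1])
  next
    fix y assume "(INF r \<in> {0<..}. ?f r) < y"
    then obtain r0 where "0 < r0" "?f r0 < y" by (auto simp: INF_less_iff)
    then show "\<forall>\<^sub>F r in at_right 0. ?f r < y"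
      unfolding eventually_at_right_field
      by (meson le_less_trans less_imp_le mono)
  qed
  then show ?thesis
    unfolding sing_dim_def using tendsto_Lim trivial_limit_at_right_real by metis
qed


section \<open>Functions of class \<open>C\<^sup>k\<close> and sets with \<open>C\<^sup>2\<close> boundary\<close>

fun Ck_on :: "nat \<Rightarrow> 'a::real_normed_vector set \<Rightarrow> ('a \<Rightarrow> 'b::real_normed_vector) \<Rightarrow> bool" where
  "Ck_on 0 S f \<longleftrightarrow> continuous_on S f"
| "Ck_on (Suc k) S f \<longleftrightarrow>
     (\<forall>x\<in>S. f differentiable (at x)) \<and> (\<forall>v. Ck_on k S (\<lambda>x. frechet_derivative f (at x) v))"

text \<open>
  Near each boundary point, after a rotation of the coordinate axes, \<open>\<Omega>\<close> is the region above the
  graph of a \<open>C\<^sup>2\<close> function: \<open>\<nu>\<close> is the direction of the last new axis, and \<open>g\<close> is only evaluated at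
  the projection \<open>x - (x \<bullet> \<nu>) \<nu>\<close> of \<open>x\<close> to the hyperplane orthogonal to \<open>\<nu>\<close>. A \<open>C\<^sup>2\<close> function on
  that hyperplane is the same as the restriction to it of a \<open>C\<^sup>2\<close> function on the whole space.
\<close>

definition class_C2 :: "'a::euclidean_space set \<Rightarrow> bool" where
  "class_C2 \<Omega> \<longleftrightarrow> (\<forall>p \<in> frontier \<Omega>. \<exists>r \<nu>. \<exists>g :: 'a \<Rightarrow> real.
     0 < r \<and> norm \<nu> = 1 \<and> Ck_on 2 UNIV g \<and>
     \<Omega> \<inter> ball p r = {x \<in> ball p r. g (x - (x \<bullet> \<nu>) *\<^sub>R \<nu>) < x \<bullet> \<nu>})"


section \<open>Sobolev spaces and weak solutions of \<open>- \<Delta>u = F\<close>, \<open>u \<in> H\<^sub>0\<^sup>1(\<Omega>)\<close>\<close>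

definition L2_on :: "'a::euclidean_space set \<Rightarrow> ('a \<Rightarrow> 'b::euclidean_space) \<Rightarrow> bool" where
  "L2_on \<Omega> f \<longleftrightarrow> f \<in> borel_measurable (lebesgue_on \<Omega>) \<and>
     integrable (lebesgue_on \<Omega>) (\<lambda>x. (norm (f x))\<^sup>2)"

definition test_function :: "'a::euclidean_space set \<Rightarrow> ('a \<Rightarrow> real) \<Rightarrow> bool" where
  "test_function \<Omega> \<phi> \<longleftrightarrow> (\<forall>k. Ck_on k UNIV \<phi>) \<and>
     compact (closure {x. \<phi> x \<noteq> 0}) \<and> closure {x. \<phi> x \<noteq> 0} \<subseteq> \<Omega>"

definition gradient :: "('a::euclidean_space \<Rightarrow> real) \<Rightarrow> 'a \<Rightarrow> 'a" where
  "gradient \<phi> x = (\<Sum>b\<in>Basis. frechet_derivative \<phi> (at x) b *\<^sub>R b)"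

text \<open>\<open>u \<in> H\<^sup>1(\<Omega>)\<close> with weak gradient \<open>Du\<close>, which is determined up to a null set.\<close>

definition H1_with_gradient :: "'a::euclidean_space set \<Rightarrow> ('a \<Rightarrow> real) \<Rightarrow> ('a \<Rightarrow> 'a) \<Rightarrow> bool" where
  "H1_with_gradient \<Omega> u Du \<longleftrightarrow> L2_on \<Omega> u \<and> L2_on \<Omega> Du \<and>
     (\<forall>\<phi>. test_function \<Omega> \<phi> \<longrightarrow>
        (LINT x|lebesgue_on \<Omega>. u x *\<^sub>R gradient \<phi> x) = - (LINT x|lebesgue_on \<Omega>. \<phi> x *\<^sub>R Du x))"

text \<open>\<open>u \<in> H\<^sub>0\<^sup>1(\<Omega>)\<close>, the closure of the test functions in \<open>H\<^sup>1(\<Omega>)\<close>, with weak gradient \<open>Du\<close>.\<close>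

definition H10_with_gradient :: "'a::euclidean_space set \<Rightarrow> ('a \<Rightarrow> real) \<Rightarrow> ('a \<Rightarrow> 'a) \<Rightarrow> bool" where
  "H10_with_gradient \<Omega> u Du \<longleftrightarrow> H1_with_gradient \<Omega> u Du \<and>
     (\<exists>\<phi> :: nat \<Rightarrow> 'a \<Rightarrow> real. (\<forall>n. test_function \<Omega> (\<phi> n)) \<and>
        (\<lambda>n. LINT x|lebesgue_on \<Omega>. (u x - \<phi> n x)\<^sup>2 + (norm (Du x - gradient (\<phi> n) x))\<^sup>2)
          \<longlonglongrightarrow> 0)"

definition weak_solution :: "'a::euclidean_space set \<Rightarrow> ('a \<Rightarrow> real) \<Rightarrow> ('a \<Rightarrow> real) \<Rightarrow> bool" where
  "weak_solution \<Omega> F u \<longleftrightarrow> (\<exists>Du. H10_with_gradient \<Omega> u Du \<and>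
     (\<forall>v Dv. H10_with_gradient \<Omega> v Dv \<longrightarrow>
        (LINT x|lebesgue_on \<Omega>. Du x \<bullet> Dv x) = (LINT x|lebesgue_on \<Omega>. F x * v x)))"

end

theory Submission
  imports Defs "HOL-Computational_Algebra.Polynomial"
begin

text \<open>
  Let \<open>N\<close> be the dimension. In every ball in \<open>\<Omega>\<close> and for every \<open>s < N - 4\<close> there is a Cantor set \<open>A\<close> of
  dimension \<open>s\<close>. With \<open>\<epsilon>\<^sub>J\<close> the scale of its \<open>J\<close>-th generation, let \<open>w\<close> be the sum over \<open>J\<close> of
  \<open>\<epsilon>\<^sub>J\<close> to the power \<open>-\<gamma>\<close> times a smooth cutoff of the \<open>\<epsilon>\<^sub>J\<close>-neighbourhood of \<open>A\<close>, so that \<open>w\<close> grows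
  at least like the power \<open>-\<gamma>\<close> of the distance to any point of \<open>A\<close>. Counting the pieces shows that the
  series converges absolutely in \<open>H\<^sup>2\<close> as long as \<open>2\<gamma> < N - 4 - s\<close>. A sum \<open>u\<close> of countably many such
  functions with small coefficients is an \<open>H\<^sup>2\<close>-convergent series of test functions, hence it is the
  weak solution for \<open>F = -\<Delta>u\<close>, unique by the Poincare inequality. Its singular set contains all the
  Cantor sets, which gives the lower bound.

  For the upper bound, the neighbourhoods of the Cantor sets carrying the summands are taken so thin
  that their limes superior is null for the \<open>(N - 4)\<close>-dimensional Hausdorff measure. At a point outside
  this set and outside the Cantor sets, all but finitely many summands vanish near the point, each
  at its own scale, and the coefficients are so small that the averages of \<open>u\<close> over balls around the point stay bounded,
  whereas they are unbounded at a singular point.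
\<close>

section \<open>Smooth functions\<close>

text \<open>The number N - 4 comes from one count. A generation of scale e has about e^(-s) pieces
  of volume e^N, and a cutoff of height e^(-\<gamma>) has second derivatives of order
  e^(-\<gamma>-2), so its squared H^2 norm is of order e^(N-4-s-2\<gamma>); this decays for some
  \<gamma> > 0 exactly when s < N - 4. The value N - 4 itself only appears as a supremum over Cantor
  sets. The obstacle is the upper bound. The Cantor sets have to be dense, so their neighbourhoods
  accumulate everywhere and could create singularities at points that lie on none of them. Instead
  of a capacity estimate valid for all of H^2, the freedom in this particular u is used: each
  coefficient is fixed after the width \<open>\<delta> k\<close> of the enlarged neighbourhood, and
  is so small that the integral of the k-th summand is at most 2^(-k) times the N-th power of that
  width. A ball reaching the k-th support from outside the enlargement is wider than that, so the
  summand contributes at most 2^(-k) times the N-th power of its radius. Singular sets do not see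
  null sets, so uniqueness almost everywhere settles the claim for every weak solution.\<close>

definition smooth :: "('a::real_normed_vector \<Rightarrow> real) \<Rightarrow> bool" where
  "smooth f \<longleftrightarrow> (\<forall>k. Ck_on k UNIV f)"

definition dir :: "('a::real_normed_vector \<Rightarrow> real) \<Rightarrow> 'a \<Rightarrow> 'a \<Rightarrow> real" where
  "dir f v x = frechet_derivative f (at x) v"

lemma dir_eqI: "(f has_derivative f') (at x) \<Longrightarrow> dir f v x = f' v"
  unfolding dir_def by (metis frechet_derivative_at)

lemma smooth_differentiable: "smooth f \<Longrightarrow> f differentiable (at x)"
  using Ck_on.simps(2)[of 0 UNIV f] unfolding smooth_def by blast

lemma smooth_dir: "smooth f \<Longrightarrow> smooth (dir f v)"
  using Ck_on.simps(2)[of _ UNIV f] unfolding smooth_def dir_def[abs_def] by blast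

lemma smooth_continuous: "smooth f \<Longrightarrow> continuous_on S f"
  using Ck_on.simps(1)[of UNIV f] continuous_on_subset unfolding smooth_def by blast

lemma smooth_has_derivative:
  "smooth f \<Longrightarrow> (f has_derivative (\<lambda>v. dir f v x)) (at x)"
  using smooth_differentiable[of f x] unfolding dir_def by (simp add: frechet_derivative_works eta_contract_eq)

text \<open>Unfolding \<open>Ck_on\<close> only ever passes to directional derivatives, so a class
  of differentiable functions that is stable under \<open>dir\<close> consists of smooth functions.
  The basic smoothness proofs below each exhibit such a class.\<close>

lemma smooth_coinduct:
  fixes f :: "'a::real_normed_vector \<Rightarrow> real"
  assumes "P f"
    and D: "\<And>f x. P f \<Longrightarrow> f differentiable (at x)" and P: "\<And>f v. P f \<Longrightarrow> P (dir f v)"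
  shows "smooth f"
proof -
  have "\<forall>f. P f \<longrightarrow> Ck_on k UNIV f" for k
  proof (induction k)
    case 0
    then show ?case
      by (auto intro!: continuous_at_imp_continuous_on differentiable_imp_continuous_within D)
  next
    case (Suc k)
    then show ?case using D P unfolding dir_def[abs_def] by auto
  qed
  then show ?thesis using assms(1) by (simp add: smooth_def)
qed

text \<open>The derivative of a product or of a composite is a sum of products, so neither operation
  alone gives a class stable under \<open>dir\<close>. Closing under all three operations at once
  does, by the sum, product and chain rules.\<close>

inductive smooth_closure :: "('a::real_normed_vector \<Rightarrow> real) \<Rightarrow> bool" where
  base: "smooth f \<Longrightarrow> smooth_closure f"
| add: "smooth_closure f \<Longrightarrow> smooth_closure g \<Longrightarrow> smooth_closure (\<lambda>x. f x + g x)"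
| mult: "smooth_closure f \<Longrightarrow> smooth_closure g \<Longrightarrow> smooth_closure (\<lambda>x. f x * g x)"
| comp: "smooth h \<Longrightarrow> smooth_closure f \<Longrightarrow> smooth_closure (\<lambda>x. (h::real \<Rightarrow> real) (f x))"

lemma differentiable_dir:
  "f differentiable (at x) \<Longrightarrow> (f has_derivative (\<lambda>v. dir f v x)) (at x)"
  unfolding dir_def by (simp add: frechet_derivative_works eta_contract_eq)

lemma dir_add: "f differentiable (at x) \<Longrightarrow> g differentiable (at x) \<Longrightarrow>
    dir (\<lambda>x. f x + g x) v x = dir f v x + dir g v x"
  by (rule dir_eqI) (auto intro!: derivative_eq_intros differentiable_dir)

lemma dir_mult: "f differentiable (at x) \<Longrightarrow> g differentiable (at x) \<Longrightarrow>
    dir (\<lambda>x. f x * g x) v x = f x * dir g v x + dir f v x * g x"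
  by (rule dir_eqI[where f' = "\<lambda>v. f x * dir g v x + dir f v x * g x"])
     (rule has_derivative_mult; auto intro: differentiable_dir)

lemma dir_comp:
  fixes h :: "real \<Rightarrow> real"
  assumes "h differentiable (at (f x))" "f differentiable (at x)"
  shows "dir (\<lambda>x. h (f x)) v x = dir h 1 (f x) * dir f v x"
proof -
  have "((\<lambda>x. h (f x)) has_derivative (\<lambda>v. dir h (dir f v x) (f x))) (at x)"
    using has_derivative_compose[OF differentiable_dir differentiable_dir, OF assms(2,1)] by simp
  then have "dir (\<lambda>x. h (f x)) v x = dir h (dir f v x) (f x)" by (rule dir_eqI)
  also have "\<dots> = dir h (dir f v x *\<^sub>R 1) (f x)" by simp
  also have "\<dots> = dir f v x *\<^sub>R dir h 1 (f x)"
    by (rule linear_scale) (rule has_derivative_linear[OF differentiable_dir[OF assms(1)]])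
  finally show ?thesis by simp
qed

lemma smooth_closure_smooth: "smooth_closure f \<Longrightarrow> smooth f"
proof (erule smooth_coinduct[where P = smooth_closure])
  fix f :: "'a \<Rightarrow> real"
  assume "smooth_closure f"
  then have *: "(\<forall>x. f differentiable (at x)) \<and> (\<forall>v. smooth_closure (dir f v))"
  proof induction
    case (base f)
    then show ?case
      using smooth_differentiable[OF base] smooth_closure.base[OF smooth_dir[OF base]] by blast
  next
    case (add f g)
    then have "dir (\<lambda>x. f x + g x) v = (\<lambda>x. dir f v x + dir g v x)" for v
      by (auto simp: dir_add)
    with add show ?case by (simp add: smooth_closure.add)
  next
    case (mult f g)
    then have "dir (\<lambda>x. f x * g x) v = (\<lambda>x. f x * dir g v x + dir f v x * g x)" for v
      by (auto simp: dir_mult)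
    with mult show ?case by (auto intro!: smooth_closure.add smooth_closure.mult)
  next
    case (comp h f)
    then have eq: "dir (\<lambda>x. h (f x)) v = (\<lambda>x. dir h 1 (f x) * dir f v x)" for v
      using smooth_differentiable[OF comp(1)] by (intro ext dir_comp) auto
    have "(\<lambda>x. h (f x)) differentiable (at x)" for x
      using comp smooth_differentiable[OF comp(1)] differentiable_compose by blast
    moreover have "smooth_closure (dir (\<lambda>x. h (f x)) v)" for v
      unfolding eq using comp smooth_dir[OF comp(1)]
      by (intro smooth_closure.mult smooth_closure.comp[of "dir h 1"]) auto
    ultimately show ?case by blast
  qed
  show "f differentiable (at x)" for x using * by blast
  show "smooth_closure (dir f v)" for v using * by blast
qed

lemma smooth_add: "smooth f \<Longrightarrow> smooth g \<Longrightarrow> smooth (\<lambda>x. f x + (g x :: real))"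
  by (rule smooth_closure_smooth[OF smooth_closure.add[OF smooth_closure.base smooth_closure.base]])

lemma smooth_mult: "smooth f \<Longrightarrow> smooth g \<Longrightarrow> smooth (\<lambda>x. f x * (g x :: real))"
  by (rule smooth_closure_smooth[OF smooth_closure.mult[OF smooth_closure.base smooth_closure.base]])

lemma smooth_comp: "smooth h \<Longrightarrow> smooth f \<Longrightarrow> smooth (\<lambda>x. (h :: real \<Rightarrow> real) (f x))"
  by (rule smooth_closure_smooth[OF smooth_closure.comp[OF _ smooth_closure.base]])

lemma smooth_const: "smooth (\<lambda>x. c :: real)"
proof (rule smooth_coinduct[where P = "\<lambda>f. \<exists>c. f = (\<lambda>x. c)"])
  have "dir (\<lambda>x :: 'a. c :: real) v = (\<lambda>x. 0)" for c v
    by (rule ext, rule dir_eqI[where f' = "\<lambda>_. 0"]) auto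
  then show "\<exists>c. f = (\<lambda>x. c) \<Longrightarrow> \<exists>c. dir f v = (\<lambda>x. c)" for f :: "'a \<Rightarrow> real" and v by auto
qed auto

lemma smooth_inner: "smooth (\<lambda>x :: 'a::real_inner. x \<bullet> b)"
proof (rule smooth_coinduct[where P = "\<lambda>f. (\<exists>c. f = (\<lambda>x. c)) \<or> f = (\<lambda>x. x \<bullet> b)"])
  have "dir (\<lambda>x :: 'a. c :: real) v = (\<lambda>x. 0)" for c v
    by (rule ext, rule dir_eqI[where f' = "\<lambda>_. 0"]) auto
  moreover have "dir (\<lambda>x :: 'a. x \<bullet> b) v = (\<lambda>x. v \<bullet> b)" for v
    by (rule ext, rule dir_eqI) (auto intro!: derivative_eq_intros)
  ultimately show "(\<exists>c. f = (\<lambda>x. c)) \<or> f = (\<lambda>x. x \<bullet> b) \<Longrightarrow>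
     (\<exists>c. dir f v = (\<lambda>x. c)) \<or> dir f v = (\<lambda>x. x \<bullet> b)" for f :: "'a \<Rightarrow> real" and v by auto
qed auto

lemma smooth_sum: "(\<And>i. i \<in> I \<Longrightarrow> smooth (f i)) \<Longrightarrow> smooth (\<lambda>x. \<Sum>i\<in>I. f i x :: real)"
proof (induction I rule: infinite_finite_induct)
  case (insert i I)
  then have "smooth (f i)" "smooth (\<lambda>x. \<Sum>i\<in>I. f i x)" by blast+
  from smooth_add[OF this] show ?case by (simp only: sum.insert[OF insert(1,2)])
qed (simp_all add: smooth_const)

lemma dir_sum: "(\<And>i. i \<in> I \<Longrightarrow> f i differentiable (at x)) \<Longrightarrow>
    dir (\<lambda>x. \<Sum>i\<in>I. f i x) v x = (\<Sum>i\<in>I. dir (f i) v x)"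
  by (rule dir_eqI[where f' = "\<lambda>v. \<Sum>i\<in>I. dir (f i) v x"])
     (auto intro!: has_derivative_sum differentiable_dir)

lemma dir_cmult: "f differentiable (at x) \<Longrightarrow> dir (\<lambda>x. c * f x) v x = c * dir f v x"
  by (rule dir_eqI[where f' = "\<lambda>v. c * dir f v x"])
     (auto intro!: has_derivative_mult_right differentiable_dir)

lemma dir_rescale:
  fixes f :: "'a::real_normed_vector \<Rightarrow> real"
  assumes "smooth f"
  shows "dir (\<lambda>x. f (s *\<^sub>R (x - p))) v = (\<lambda>x. s * dir f v (s *\<^sub>R (x - p)))"
    and "(\<lambda>x. f (s *\<^sub>R (x - p))) differentiable (at x)"
proof -
  have D: "((\<lambda>x. f (s *\<^sub>R (x - p))) has_derivative (\<lambda>v. dir f (s *\<^sub>R v) (s *\<^sub>R (x - p)))) (at x)" for x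
    by (rule has_derivative_compose[of _ _ _ _ f, OF _ smooth_has_derivative[OF assms]])
       (auto intro!: derivative_eq_intros)
  then show "(\<lambda>x. f (s *\<^sub>R (x - p))) differentiable (at x)"
    using differentiable_def by blast
  have "dir f (s *\<^sub>R v) y = s * dir f v y" for y
    using linear_scale[OF has_derivative_linear[OF smooth_has_derivative[OF assms]]] by simp
  then show "dir (\<lambda>x. f (s *\<^sub>R (x - p))) v = (\<lambda>x. s * dir f v (s *\<^sub>R (x - p)))"
    by (intro ext) (simp add: dir_eqI[OF D])
qed

lemma smooth_rescale:
  fixes f :: "'a::real_normed_vector \<Rightarrow> real"
  assumes "smooth f"
  shows "smooth (\<lambda>x. f (s *\<^sub>R (x - p)))"
\<comment> \<open>Each derivative produces another factor \<open>s\<close>, so the stable class has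
  to allow a scalar multiple.\<close>
proof (rule smooth_coinduct[where P = "\<lambda>h. \<exists>f c. smooth f \<and> h = (\<lambda>x. c * f (s *\<^sub>R (x - p)))"])
  show "\<exists>fa c. smooth fa \<and> (\<lambda>x. f (s *\<^sub>R (x - p))) = (\<lambda>x. c * fa (s *\<^sub>R (x - p)))"
    using assms by (intro exI[of _ f] exI[of _ 1]) auto
next
  fix h :: "'a \<Rightarrow> real"
  assume "\<exists>f c. smooth f \<and> h = (\<lambda>x. c * f (s *\<^sub>R (x - p)))"
  then obtain f c where f: "smooth f" and h: "h = (\<lambda>x. c * f (s *\<^sub>R (x - p)))" by blast
  show "h differentiable (at x)" for x
    unfolding h using dir_rescale(2)[OF f] by (intro derivative_intros) auto
  have "dir h v = (\<lambda>x. (c * s) * dir f v (s *\<^sub>R (x - p)))" for v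
    unfolding h by (rule ext) (simp add: dir_cmult dir_rescale[OF f])
  then show "\<exists>f c. smooth f \<and> dir h v = (\<lambda>x. c * f (s *\<^sub>R (x - p)))" for v
    using smooth_dir[OF f] by blast
qed

section \<open>A bump function built from exp (-1/t)\<close>

definition flat_exp :: "real poly \<Rightarrow> real \<Rightarrow> real" where
  "flat_exp p t = (if 0 < t then poly p (1 / t) * exp (- (1 / t)) else 0)"

lemma poly_exp_tendsto_0: "((\<lambda>y :: real. poly p y * exp (- y)) \<longlongrightarrow> 0) at_top"
proof -
  have "((\<lambda>y. \<Sum>i\<le>degree p. coeff p i * (y ^ i / exp y)) \<longlongrightarrow> (\<Sum>i\<le>degree p. coeff p i * 0)) at_top"
    by (intro tendsto_intros tendsto_power_div_exp_0)
  then show ?thesis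
    by (simp add: poly_altdef sum_distrib_right exp_minus divide_inverse mult.assoc)
qed

lemma flat_exp_tendsto_0: "(flat_exp p \<longlongrightarrow> 0) (at 0)"
proof (rule filterlim_split_at)
  have "\<forall>\<^sub>F t :: real in at_left 0. t < 0"
    unfolding eventually_at_filter by (intro always_eventually) auto
  then show "(flat_exp p \<longlongrightarrow> 0) (at_left 0)"
    by (intro tendsto_eventually) (auto elim!: eventually_mono simp: flat_exp_def)
  have "((\<lambda>t. poly p (inverse t) * exp (- (inverse t))) \<longlongrightarrow> 0) (at_right 0)"
    by (rule filterlim_compose[OF poly_exp_tendsto_0 filterlim_inverse_at_top_right])
  moreover have "\<forall>\<^sub>F t :: real in at_right 0. 0 < t"
    unfolding eventually_at_filter by (intro always_eventually) auto
  ultimately show "(flat_exp p \<longlongrightarrow> 0) (at_right 0)"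
    by (elim Lim_transform_eventually) (auto elim!: eventually_mono simp: flat_exp_def inverse_eq_divide)
qed

text \<open>For t > 0, differentiating p(1/t) exp (-1/t) gives (1/t)^2 (p - p')(1/t) exp (-1/t), and
  \<open>[:0, 0, 1:]\<close> is the square of the variable 1/t. At 0 the difference quotient is
  again a \<open>flat_exp\<close>, namely that of \<open>pCons 0 p\<close>, and tends to 0. The
  polynomial parameter thus makes the family stable under differentiation.\<close>

lemma flat_exp_DERIV:
  "(flat_exp p has_real_derivative flat_exp ([:0, 0, 1:] * (p - pderiv p)) t) (at t)"
proof -
  consider "t < 0" | "t = 0" | "0 < t" by linarith
  then show ?thesis
  proof cases
    case 1
    have "((\<lambda>t. 0) has_real_derivative 0) (at t)" by simp
    then have "(flat_exp p has_real_derivative 0) (at t)"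
      by (rule DERIV_cong_ev[THEN iffD1, rotated -1])
         (use 1 in \<open>auto simp: flat_exp_def eventually_nhds intro!: exI[of _ "{..<0}"]\<close>)
    then show ?thesis using 1 by (simp add: flat_exp_def)
  next
    case 2
    have "((\<lambda>t. flat_exp (pCons 0 p) t) \<longlongrightarrow> 0) (at 0)" by (rule flat_exp_tendsto_0)
    moreover have "flat_exp (pCons 0 p) = (\<lambda>t. flat_exp p t / t)"
      by (auto simp: flat_exp_def fun_eq_iff)
    ultimately have "(flat_exp p has_real_derivative 0) (at 0)"
      unfolding has_field_derivative_iff by (simp add: flat_exp_def)
    then show ?thesis using 2 by (simp add: flat_exp_def)
  next
    case 3
    have "((\<lambda>t. poly p (1 / t) * exp (- (1 / t))) has_real_derivative
        flat_exp ([:0, 0, 1:] * (p - pderiv p)) t) (at t)"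
      using 3
      by (auto intro!: derivative_eq_intros DERIV_chain'[of "\<lambda>t. 1 / t" _ t UNIV "poly p"] poly_DERIV
         simp: flat_exp_def field_simps power2_eq_square)
    then show ?thesis
      by (rule DERIV_cong_ev[THEN iffD1, rotated -1])
         (use 3 in \<open>auto simp: flat_exp_def eventually_nhds intro!: exI[of _ "{0<..}"]\<close>)
  qed
qed

lemma smooth_flat_exp: "smooth (flat_exp p)"
proof (rule smooth_coinduct[where P = "\<lambda>f. \<exists>p. f = flat_exp p"])
  fix f v assume "\<exists>p. f = flat_exp p"
  then obtain p where f: "f = flat_exp p" by blast
  show "f differentiable (at x)" for x
    unfolding f using flat_exp_DERIV real_differentiable_def by blast
  have "dir f v = flat_exp (smult v ([:0, 0, 1:] * (p - pderiv p)))"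
  proof
    fix x
    have "dir f v x = flat_exp ([:0, 0, 1:] * (p - pderiv p)) x * v"
      unfolding f by (rule dir_eqI) (use flat_exp_DERIV in \<open>simp add: has_field_derivative_def\<close>)
    then show "dir f v x = flat_exp (smult v ([:0, 0, 1:] * (p - pderiv p))) x"
      by (auto simp: flat_exp_def)
  qed
  then show "\<exists>p. dir f v = flat_exp p" by blast
qed auto

lemma flat_exp_1_pos: "0 < t \<Longrightarrow> 0 < flat_exp 1 t"
  and flat_exp_1_nonneg: "0 \<le> flat_exp 1 t"
  and flat_exp_1_mono: "s \<le> t \<Longrightarrow> flat_exp 1 s \<le> flat_exp 1 t"
  by (auto simp: flat_exp_def frac_le)

text \<open>Supported in norm at most 3 and normalised by its value at norm 2, since 5 = 9 - 2^2.
  Radius 2 accommodates a point within one scale of a Cantor point that is itself within one scale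
  of a node.\<close>

definition bump :: "'a::euclidean_space \<Rightarrow> real" where
  "bump x = flat_exp 1 (9 - x \<bullet> x) / flat_exp 1 5"

lemma smooth_bump: "smooth (bump :: 'a::euclidean_space \<Rightarrow> real)"
proof -
  have "bump = (\<lambda>x :: 'a. inverse (flat_exp 1 5) * flat_exp 1 (9 + (- 1) * (\<Sum>b\<in>Basis. (x \<bullet> b) * (x \<bullet> b))))"
    by (simp add: bump_def fun_eq_iff euclidean_inner[symmetric] divide_inverse mult.commute)
  moreover have "smooth \<dots>"
    by (rule smooth_mult[OF smooth_const smooth_comp[OF smooth_flat_exp smooth_add[OF smooth_const
            smooth_mult[OF smooth_const smooth_sum[OF smooth_mult[OF smooth_inner smooth_inner]]]]]])
  ultimately show ?thesis by metis
qed

lemma bump_nonneg: "0 \<le> bump x"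
  by (simp add: bump_def flat_exp_1_nonneg)

lemma bump_ge_1: "norm x \<le> 2 \<Longrightarrow> 1 \<le> bump x"
proof -
  assume "norm x \<le> 2"
  then have "x \<bullet> x \<le> 4" using power_mono[of "norm x" 2 2] by (simp add: power2_norm_eq_inner)
  then show ?thesis unfolding bump_def
    using flat_exp_1_mono[of 5 "9 - x \<bullet> x"] flat_exp_1_pos[of 5] by (simp add: le_divide_eq)
qed

lemma bump_eq_0: "3 \<le> norm x \<Longrightarrow> bump x = 0"
proof -
  assume "3 \<le> norm x"
  then have "9 \<le> x \<bullet> x" using power_mono[of 3 "norm x" 2] by (simp add: power2_norm_eq_inner)
  then show ?thesis by (simp add: bump_def flat_exp_def)
qed

section \<open>Test functions\<close>

text \<open>Any compact carrier may replace the closure of the nonvanishing set, so that sums,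
  products and derivatives can unite or inherit carriers.\<close>

lemma test_function_iff:
  "test_function \<Omega> f \<longleftrightarrow> smooth f \<and> (\<exists>K. compact K \<and> K \<subseteq> \<Omega> \<and> (\<forall>x. x \<notin> K \<longrightarrow> f x = 0))"
proof
  assume f: "test_function \<Omega> f"
  have "f x = 0" if "x \<notin> closure {x. f x \<noteq> 0}" for x
    using that closure_subset[of "{x. f x \<noteq> 0}"] by auto
  with f show "smooth f \<and> (\<exists>K. compact K \<and> K \<subseteq> \<Omega> \<and> (\<forall>x. x \<notin> K \<longrightarrow> f x = 0))"
    unfolding test_function_def smooth_def
    by blast
next
  assume *: "smooth f \<and> (\<exists>K. compact K \<and> K \<subseteq> \<Omega> \<and> (\<forall>x. x \<notin> K \<longrightarrow> f x = 0))"
  then obtain K where K: "compact K" "K \<subseteq> \<Omega>" "\<And>x. x \<notin> K \<Longrightarrow> f x = 0" by blast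
  then have "closure {x. f x \<noteq> 0} \<subseteq> K"
    by (intro closure_minimal) (auto simp: compact_imp_closed)
  moreover from this have "compact (closure {x. f x \<noteq> 0})"
    using K(1) compact_Int_closed[of K "closure {x. f x \<noteq> 0}"] by (simp add: Int_absorb1)
  ultimately show "test_function \<Omega> f"
    using K(2) * unfolding test_function_def smooth_def by simp
qed

lemma dir_eq_0_outside:
  fixes f :: "'a::real_normed_vector \<Rightarrow> real"
  assumes "closed K" "\<And>x. x \<notin> K \<Longrightarrow> f x = 0" "x \<notin> K"
  shows "dir f v x = 0"
proof -
  have "((\<lambda>x. 0) has_derivative (\<lambda>v. 0)) (at x)" by simp
  then have "(f has_derivative (\<lambda>v. 0)) (at x)"
    by (rule has_derivative_transform_within_open[of _ _ _ UNIV "- K"]) (use assms in auto)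
  then show ?thesis by (rule dir_eqI)
qed

lemma test_function_dir: "test_function \<Omega> f \<Longrightarrow> test_function \<Omega> (dir f v)"
  unfolding test_function_iff
  by (meson compact_imp_closed dir_eq_0_outside smooth_dir)

lemma test_function_smooth: "test_function \<Omega> f \<Longrightarrow> smooth f"
  by (simp add: test_function_iff)

lemma test_function_mult:
  "test_function \<Omega> f \<Longrightarrow> smooth g \<Longrightarrow> test_function \<Omega> (\<lambda>x. g x * f x)"
  unfolding test_function_iff by (auto intro: smooth_mult)

lemma test_function_0: "test_function \<Omega> (\<lambda>x. 0)"
  unfolding test_function_iff using smooth_const by blast

lemma test_function_add:
  "test_function \<Omega> f \<Longrightarrow> test_function \<Omega> g \<Longrightarrow> test_function \<Omega> (\<lambda>x. f x + g x)"
proof -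
  assume "test_function \<Omega> f" "test_function \<Omega> g"
  then obtain K L where "smooth f" "smooth g" "compact K" "K \<subseteq> \<Omega>" "\<forall>x. x \<notin> K \<longrightarrow> f x = 0"
     "compact L" "L \<subseteq> \<Omega>" "\<forall>x. x \<notin> L \<longrightarrow> g x = 0"
    unfolding test_function_iff by blast
  then show ?thesis
    unfolding test_function_iff by (intro conjI smooth_add exI[of _ "K \<union> L"]) auto
qed

lemma test_function_sum:
  "(\<And>i. i \<in> I \<Longrightarrow> test_function \<Omega> (f i)) \<Longrightarrow> test_function \<Omega> (\<lambda>x. \<Sum>i\<in>I. f i x)"
  by (induction I rule: infinite_finite_induct) (auto simp: test_function_0 intro!: test_function_add)

lemma gradient_eq: "gradient f x = (\<Sum>b\<in>Basis. dir f b x *\<^sub>R b)"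
  by (simp add: gradient_def dir_def)

lemma gradient_inner_Basis: "b \<in> Basis \<Longrightarrow> gradient f x \<bullet> b = dir f b x"
  by (simp add: gradient_eq inner_sum_left_Basis)

lemma gradient_add:
  "smooth f \<Longrightarrow> smooth g \<Longrightarrow> gradient (\<lambda>x. f x + g x) x = gradient f x + gradient g x"
  by (simp add: gradient_eq dir_add smooth_differentiable scaleR_left.add sum.distrib)

lemma gradient_cmult: "smooth f \<Longrightarrow> gradient (\<lambda>x. c * f x) x = c *\<^sub>R gradient f x"
  by (simp add: gradient_eq dir_cmult smooth_differentiable scaleR_sum_right)

lemma gradient_sum:
  "(\<And>i. i \<in> I \<Longrightarrow> smooth (f i)) \<Longrightarrow> gradient (\<lambda>x. \<Sum>i\<in>I. f i x) x = (\<Sum>i\<in>I. gradient (f i) x)"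
  by (simp add: gradient_eq dir_sum smooth_differentiable scaleR_sum_left) (rule sum.swap)

lemma smooth_borel: "smooth f \<Longrightarrow> f \<in> borel_measurable borel"
  by (intro borel_measurable_continuous_onI smooth_continuous)

lemma smooth_measurable:
  fixes f :: "'a::euclidean_space \<Rightarrow> real"
  assumes "smooth f" "\<Omega> \<in> sets lebesgue"
  shows "f \<in> borel_measurable (lebesgue_on \<Omega>)"
  using assms by (intro continuous_imp_measurable_on_sets_lebesgue smooth_continuous)

lemma gradient_measurable:
  fixes f :: "'a::euclidean_space \<Rightarrow> real"
  assumes "smooth f" "\<Omega> \<in> sets lebesgue"
  shows "gradient f \<in> borel_measurable (lebesgue_on \<Omega>)"
  unfolding gradient_eq[abs_def] using assms
  by (intro borel_measurable_sum borel_measurable_scaleR smooth_measurable smooth_dir) auto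

lemma compact_support_bounded:
  fixes f :: "'a::euclidean_space \<Rightarrow> real"
  assumes "smooth f" "compact K" "\<And>x. x \<notin> K \<Longrightarrow> f x = 0"
  obtains B where "0 < B" "\<And>x. \<bar>f x\<bar> \<le> B"
proof -
  have "bounded (f ` K)"
    using assms by (intro compact_imp_bounded compact_continuous_image smooth_continuous)
  then obtain B where "0 < B" "\<And>x. x \<in> K \<Longrightarrow> \<bar>f x\<bar> \<le> B"
    unfolding bounded_pos by (auto simp: image_iff)
  with assms(3) show thesis by (intro that[of B]) (metis abs_zero less_imp_le)+
qed

lemma compact_support_integrable:
  fixes f :: "'a::euclidean_space \<Rightarrow> real"
  assumes "smooth f" "compact K" "\<And>x. x \<notin> K \<Longrightarrow> f x = 0"
  shows "integrable lborel f"
proof -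
  have "integrable lborel (\<lambda>x. indicator K x *\<^sub>R f x)"
    using assms by (intro borel_integrable_compact smooth_continuous)
  moreover have "(\<lambda>x. indicator K x *\<^sub>R f x) = f"
    using assms(3) by (auto simp: indicator_def fun_eq_iff)
  ultimately show ?thesis by simp
qed

lemma smooth_difference_bound:
  fixes f :: "'a::real_normed_vector \<Rightarrow> real"
  assumes f: "smooth f" and B: "\<And>x. \<bar>dir f v x\<bar> \<le> B" and t: "0 < t"
  shows "\<bar>(f (x + t *\<^sub>R v) - f x) / t\<bar> \<le> B"
proof -
  have D: "((\<lambda>s. f (x + s *\<^sub>R v)) has_real_derivative dir f v (x + s *\<^sub>R v)) (at s)" for s
  proof -
    have "((\<lambda>s. f (x + s *\<^sub>R v)) has_derivative (\<lambda>h. dir f (h *\<^sub>R v) (x + s *\<^sub>R v))) (at s)"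
      by (rule has_derivative_compose[of _ _ _ _ f, OF _ smooth_has_derivative[OF f]])
         (auto intro!: derivative_eq_intros)
    moreover have "dir f (h *\<^sub>R v) y = dir f v y * h" for h y
      using linear_scale[OF has_derivative_linear[OF smooth_has_derivative[OF f]]] by simp
    ultimately show ?thesis by (simp add: has_field_derivative_def)
  qed
  obtain z where "f (x + t *\<^sub>R v) - f (x + 0 *\<^sub>R v) = (t - 0) * dir f v (x + z *\<^sub>R v)"
    using MVT2[OF t, of "\<lambda>s. f (x + s *\<^sub>R v)" "\<lambda>s. dir f v (x + s *\<^sub>R v)"] D by blast
  then show ?thesis using B[of "x + z *\<^sub>R v"] t by (simp add: field_simps)
qed

lemma smooth_difference_tendsto:
  fixes f :: "'a::real_normed_vector \<Rightarrow> real"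
  assumes f: "smooth f"
  shows "(\<lambda>n. (f (x + (1 / real (Suc n)) *\<^sub>R v) - f x) / (1 / real (Suc n))) \<longlonglongrightarrow> dir f v x"
proof -
  have "((\<lambda>s. f (x + s *\<^sub>R v)) has_derivative (\<lambda>h. dir f (h *\<^sub>R v) (x + 0 *\<^sub>R v))) (at 0)"
    by (rule has_derivative_compose[of _ _ _ _ f, OF _ smooth_has_derivative[OF f]])
       (auto intro!: derivative_eq_intros)
  moreover have "dir f (h *\<^sub>R v) y = dir f v y * h" for h y
    using linear_scale[OF has_derivative_linear[OF smooth_has_derivative[OF f]]] by simp
  ultimately have "((\<lambda>s. f (x + s *\<^sub>R v)) has_real_derivative dir f v x) (at 0)"
    by (simp add: has_field_derivative_def)
  then have "((\<lambda>s. (f (x + s *\<^sub>R v) - f x) / s) \<longlongrightarrow> dir f v x) (at 0)"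
    by (simp add: DERIV_def)
  moreover have "filterlim (\<lambda>n. 1 / real (Suc n)) (at 0) sequentially"
    using LIMSEQ_inverse_real_of_nat
    by (auto simp: filterlim_at inverse_eq_divide intro!: always_eventually)
  ultimately show ?thesis by (rule filterlim_compose)
qed

text \<open>The integral of \<open>f (x + t v)\<close> does not depend on \<open>t\<close>.\<close>

lemma integral_dir_eq_0:
  fixes f :: "'a::euclidean_space \<Rightarrow> real"
  assumes f: "smooth f" and K: "compact K" and f0: "\<And>x. x \<notin> K \<Longrightarrow> f x = 0"
  shows "integral\<^sup>L lborel (dir f v) = 0"
proof -
  let ?t = "\<lambda>n. 1 / real (Suc n)"
  let ?q = "\<lambda>n x. (f (x + ?t n *\<^sub>R v) - f x) / ?t n"
  obtain B where B: "0 < B" "\<And>x. \<bar>dir f v x\<bar> \<le> B"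
    using compact_support_bounded[OF smooth_dir[OF f] K] dir_eq_0_outside f0 K compact_imp_closed
    by metis
  obtain R where R: "\<And>x. x \<in> K \<Longrightarrow> norm x \<le> R"
    using compact_imp_bounded[OF K] unfolding bounded_iff by blast
  have int: "integrable lborel f" by (rule compact_support_integrable[OF f K f0])
  have m: "f \<in> borel_measurable borel" by (rule smooth_borel[OF f])
  have sm: "smooth (\<lambda>x. f (x + y))" for y
    using smooth_rescale[OF f, of 1 "- y"] by simp
  have comp: "compact ((\<lambda>x. x - y) ` K)" for y
    using K by (intro compact_continuous_image continuous_intros)
  have int_shift: "integrable lborel (\<lambda>x. f (x + y))" for y
    by (rule compact_support_integrable[OF sm comp[of y]]) (use f0 in \<open>force simp: image_iff\<close>)
  have shift: "(LINT x|lborel. f (x + y)) = integral\<^sup>L lborel f" for y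
  proof -
    have "integral\<^sup>L (distr lborel borel ((+) y)) f = (LINT x|lborel. f (y + x))"
      using m by (intro integral_distr) auto
    then show ?thesis by (simp add: lborel_distr_plus add.commute)
  qed
  have q0: "integral\<^sup>L lborel (?q n) = 0" for n
    using int int_shift by (simp add: shift)
  \<comment> \<open>For steps of length at most 1 the difference quotient of a function carried by
    \<open>K\<close> vanishes outside radius \<open>R + norm v\<close>, and the mean value theorem
    bounds it by \<open>B\<close>.\<close>
  let ?w = "\<lambda>x. B * indicator (cball 0 (R + norm v)) x"
  have "(\<lambda>n. integral\<^sup>L lborel (?q n)) \<longlonglongrightarrow> integral\<^sup>L lborel (dir f v)"
  proof (rule integral_dominated_convergence[where w = ?w])
    show "dir f v \<in> borel_measurable lborel" using smooth_borel[OF smooth_dir[OF f]] by simp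
    show "?q n \<in> borel_measurable lborel" for n using m by simp
    show "integrable lborel ?w" by (intro integrable_mult_right integrable_real_indicator emeasure_bounded_finite) auto
    show "AE x in lborel. (\<lambda>n. ?q n x) \<longlonglongrightarrow> dir f v x"
      using smooth_difference_tendsto[OF f] by simp
    show "AE x in lborel. norm (?q n x) \<le> ?w x" for n
    proof (rule AE_I2)
      fix x
      show "norm (?q n x) \<le> ?w x"
      proof (cases "x \<in> cball 0 (R + norm v)")
        case True
        then show ?thesis using smooth_difference_bound[OF f B(2), of "?t n" x] by simp
      next
        case False
        have t: "norm (?t n *\<^sub>R v) \<le> norm v" using divide_left_mono[of 1 "1 + real n" "norm v"] by simp
        have "norm x \<le> norm (x + ?t n *\<^sub>R v) + norm (?t n *\<^sub>R v)"
          using norm_triangle_ineq4[of "x + ?t n *\<^sub>R v" "?t n *\<^sub>R v"] by simp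
        then have "x + ?t n *\<^sub>R v \<notin> K" using R[of "x + ?t n *\<^sub>R v"] t False by auto
        moreover have "x \<notin> K" using R[of x] False norm_ge_zero[of v] by (auto simp del: norm_ge_zero)
        ultimately show ?thesis using f0 B by (simp add: indicator_def)
      qed
    qed
  qed
  then show ?thesis unfolding q0 LIMSEQ_const_iff by (rule sym)
qed

lemma integral_lebesgue_on_compact_support:
  fixes f :: "'a::euclidean_space \<Rightarrow> real"
  assumes "f \<in> borel_measurable borel" "\<And>x. x \<notin> \<Omega> \<Longrightarrow> f x = 0" "\<Omega> \<in> sets lebesgue"
  shows "integral\<^sup>L (lebesgue_on \<Omega>) f = integral\<^sup>L lborel f"
    and "integrable (lebesgue_on \<Omega>) f \<longleftrightarrow> integrable lborel f"
proof -
  have eq: "(\<lambda>x. indicator \<Omega> x *\<^sub>R f x) = f"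
    using assms(2) by (auto simp: indicator_def fun_eq_iff)
  show "integral\<^sup>L (lebesgue_on \<Omega>) f = integral\<^sup>L lborel f"
    using assms by (subst integral_restrict_space) (auto simp: eq[simplified] integral_completion)
  show "integrable (lebesgue_on \<Omega>) f \<longleftrightarrow> integrable lborel f"
    using assms by (subst integrable_restrict_space) (auto simp: eq[simplified] integrable_completion)
qed

lemma test_function_integral_dir:
  fixes f :: "'a::euclidean_space \<Rightarrow> real"
  assumes "test_function \<Omega> f" "\<Omega> \<in> sets lebesgue"
  shows "(LINT x|lebesgue_on \<Omega>. dir f v x) = 0"
proof -
  obtain K where K: "smooth f" "compact K" "K \<subseteq> \<Omega>" "\<And>x. x \<notin> K \<Longrightarrow> f x = 0"
    using assms(1) unfolding test_function_iff by blast
  have "dir f v x = 0" if "x \<notin> \<Omega>" for x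
    using that K(3) by (intro dir_eq_0_outside[OF compact_imp_closed[OF K(2)] K(4)]) auto
  then have "(LINT x|lebesgue_on \<Omega>. dir f v x) = integral\<^sup>L lborel (dir f v)"
    by (rule integral_lebesgue_on_compact_support(1)[OF smooth_borel[OF smooth_dir[OF K(1)]] _ assms(2)])
  then show ?thesis using integral_dir_eq_0[OF K(1,2,4)] by simp
qed

lemma test_function_integrable:
  fixes f :: "'a::euclidean_space \<Rightarrow> real"
  assumes "test_function \<Omega> f" "\<Omega> \<in> sets lebesgue"
  shows "integrable (lebesgue_on \<Omega>) f"
proof -
  obtain K where K: "smooth f" "compact K" "K \<subseteq> \<Omega>" "\<And>x. x \<notin> K \<Longrightarrow> f x = 0"
    using assms(1) unfolding test_function_iff by blast
  have "f x = 0" if "x \<notin> \<Omega>" for x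
    using that K(3,4) by auto
  then show ?thesis
    using integral_lebesgue_on_compact_support(2)[OF smooth_borel[OF K(1)] _ assms(2)]
      compact_support_integrable[OF K(1,2,4)] by simp
qed

section \<open>Square integrable functions\<close>

lemma L2_on_dominated:
  fixes f :: "'a::euclidean_space \<Rightarrow> 'b::euclidean_space" and g :: "'a \<Rightarrow> 'c::euclidean_space"
  assumes "L2_on \<Omega> f" "g \<in> borel_measurable (lebesgue_on \<Omega>)"
    "AE x in lebesgue_on \<Omega>. norm (g x) \<le> norm (f x)"
  shows "L2_on \<Omega> g"
  unfolding L2_on_def
proof (rule conjI[OF assms(2) Bochner_Integration.integrable_bound[of _ "\<lambda>x. (norm (f x))\<^sup>2"]])
  show "integrable (lebesgue_on \<Omega>) (\<lambda>x. (norm (f x))\<^sup>2)" using assms(1) by (simp add: L2_on_def)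
  show "(\<lambda>x. (norm (g x))\<^sup>2) \<in> borel_measurable (lebesgue_on \<Omega>)" using assms(2) by simp
  show "AE x in lebesgue_on \<Omega>. norm ((norm (g x))\<^sup>2) \<le> norm ((norm (f x))\<^sup>2)"
    using assms(3) by eventually_elim (simp add: power_mono)
qed

lemma L2_on_add:
  fixes f g :: "'a::euclidean_space \<Rightarrow> 'b::euclidean_space"
  assumes "L2_on \<Omega> f" "L2_on \<Omega> g"
  shows "L2_on \<Omega> (\<lambda>x. f x + g x)"
  unfolding L2_on_def
proof (rule conjI[OF _ Bochner_Integration.integrable_bound[of _ "\<lambda>x. 2 * (norm (f x))\<^sup>2 + 2 * (norm (g x))\<^sup>2"]])
  show "integrable (lebesgue_on \<Omega>) (\<lambda>x. 2 * (norm (f x))\<^sup>2 + 2 * (norm (g x))\<^sup>2)"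
    using assms by (auto simp: L2_on_def)
  show "(\<lambda>x. f x + g x) \<in> borel_measurable (lebesgue_on \<Omega>)"
    "(\<lambda>x. (norm (f x + g x))\<^sup>2) \<in> borel_measurable (lebesgue_on \<Omega>)"
    using assms by (auto simp: L2_on_def)
  have "(norm (f x + g x))\<^sup>2 \<le> 2 * (norm (f x))\<^sup>2 + 2 * (norm (g x))\<^sup>2" for x
  proof -
    have "(norm (f x + g x))\<^sup>2 \<le> (norm (f x) + norm (g x))\<^sup>2"
      by (intro power_mono norm_triangle_ineq) auto
    also have "\<dots> \<le> 2 * (norm (f x))\<^sup>2 + 2 * (norm (g x))\<^sup>2"
      using sum_squares_bound[of "norm (f x)" "norm (g x)"] by (simp add: power2_sum)
    finally show ?thesis .
  qed
  then show "AE x in lebesgue_on \<Omega>. norm ((norm (f x + g x))\<^sup>2)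
      \<le> norm (2 * (norm (f x))\<^sup>2 + 2 * (norm (g x))\<^sup>2)"
    by simp
qed

lemma L2_on_uminus:
  "L2_on \<Omega> f \<Longrightarrow> L2_on \<Omega> (\<lambda>x. - f x)"
  unfolding L2_on_def by simp

lemma L2_on_diff:
  "L2_on \<Omega> f \<Longrightarrow> L2_on \<Omega> g \<Longrightarrow> L2_on \<Omega> (\<lambda>x. f x - g x)"
  using L2_on_add[of \<Omega> f "\<lambda>x. - g x"] by (simp add: L2_on_uminus)

text \<open>Stated for an arbitrary bounded bilinear map because the weak formulations pair
  functions by inner product, by multiplication and by scalar multiplication. Integrability comes
  from |f| |g| \<le> |f|^2 + |g|^2.\<close>

lemma L2_on_bilinear_integrable:
  fixes f :: "'a::euclidean_space \<Rightarrow> 'b::euclidean_space" and g :: "'a \<Rightarrow> 'c::euclidean_space"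
    and B :: "'b \<Rightarrow> 'c \<Rightarrow> 'd::euclidean_space"
  assumes B: "bounded_bilinear B" and "L2_on \<Omega> f" "L2_on \<Omega> g"
  shows "integrable (lebesgue_on \<Omega>) (\<lambda>x. B (f x) (g x))"
    and "integrable (lebesgue_on \<Omega>) (\<lambda>x. norm (f x) * norm (g x))"
    and "(\<lambda>x. B (f x) (g x)) \<in> borel_measurable (lebesgue_on \<Omega>)"
proof -
  interpret B: bounded_bilinear B by fact
  have m: "f \<in> borel_measurable (lebesgue_on \<Omega>)" "g \<in> borel_measurable (lebesgue_on \<Omega>)"
    using assms by (auto simp: L2_on_def)
  show int: "integrable (lebesgue_on \<Omega>) (\<lambda>x. norm (f x) * norm (g x))"
  proof (rule Bochner_Integration.integrable_bound[of _ "\<lambda>x. (norm (f x))\<^sup>2 + (norm (g x))\<^sup>2"])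
    show "integrable (lebesgue_on \<Omega>) (\<lambda>x. (norm (f x))\<^sup>2 + (norm (g x))\<^sup>2)"
      using assms by (auto simp: L2_on_def)
    have "norm (f x) * norm (g x) \<le> (norm (f x))\<^sup>2 + (norm (g x))\<^sup>2" for x
      using sum_squares_bound[of "norm (f x)" "norm (g x)"]
        mult_nonneg_nonneg[OF norm_ge_zero[of "f x"] norm_ge_zero[of "g x"]] by linarith
    then show "AE x in lebesgue_on \<Omega>. norm (norm (f x) * norm (g x))
        \<le> norm ((norm (f x))\<^sup>2 + (norm (g x))\<^sup>2)" by simp
  qed (use m in simp)
  show mB: "(\<lambda>x. B (f x) (g x)) \<in> borel_measurable (lebesgue_on \<Omega>)"
    by (rule borel_measurable_continuous_Pair[OF m])
       (intro B.continuous_on continuous_intros)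
  obtain K where K: "0 \<le> K" "\<And>a b. norm (B a b) \<le> norm a * norm b * K"
    using B.nonneg_bounded by blast
  show "integrable (lebesgue_on \<Omega>) (\<lambda>x. B (f x) (g x))"
    by (rule Bochner_Integration.integrable_bound[OF integrable_mult_left[OF int, of K] mB])
       (use K in \<open>auto simp: abs_mult\<close>)
qed

lemmas L2_on_inner_integrable = L2_on_bilinear_integrable(1)[OF bounded_bilinear_inner]
  and L2_on_mult_integrable = L2_on_bilinear_integrable(1)[OF bounded_bilinear_mult]
  and L2_on_scaleR_integrable = L2_on_bilinear_integrable(1)[OF bounded_bilinear_scaleR]

lemma L2_on_test_function:
  fixes f :: "'a::euclidean_space \<Rightarrow> real"
  assumes "test_function \<Omega> f" "\<Omega> \<in> sets lebesgue"
  shows "L2_on \<Omega> f"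
  unfolding L2_on_def
  using test_function_integrable[OF test_function_mult[OF assms(1) test_function_smooth[OF assms(1)]] assms(2)]
    smooth_measurable[OF test_function_smooth[OF assms(1)] assms(2)]
  by (simp add: power2_eq_square)

lemma norm_gradient: "(norm (gradient f x))\<^sup>2 = (\<Sum>b\<in>Basis. (dir f b x)\<^sup>2)"
  unfolding power2_norm_eq_inner euclidean_inner[of "gradient f x" "gradient f x"]
  by (simp add: gradient_inner_Basis power2_eq_square)

lemma L2_on_gradient:
  fixes f :: "'a::euclidean_space \<Rightarrow> real"
  assumes "test_function \<Omega> f" "\<Omega> \<in> sets lebesgue"
  shows "L2_on \<Omega> (gradient f)"
proof -
  have "integrable (lebesgue_on \<Omega>) (\<lambda>x. \<Sum>b\<in>Basis. (dir f b x)\<^sup>2)"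
    using L2_on_test_function[OF test_function_dir[OF assms(1)] assms(2)]
    by (intro Bochner_Integration.integrable_sum) (simp add: L2_on_def)
  then show ?thesis
    unfolding L2_on_def norm_gradient
    using gradient_measurable[OF test_function_smooth[OF assms(1)] assms(2)] by simp
qed

text \<open>By monotone convergence the pointwise sum has a finite integral, hence is finite almost
  everywhere.\<close>

lemma AE_summable_of_integrals:
  fixes f :: "nat \<Rightarrow> 'a \<Rightarrow> real"
  assumes f: "\<And>n. integrable M (f n)" "\<And>n x. 0 \<le> f n x" and "summable (\<lambda>n. integral\<^sup>L M (f n))"
  shows "AE x in M. summable (\<lambda>n. f n x)"
proof -
  have m: "f n \<in> borel_measurable M" for n using f(1) by auto
  have "(\<integral>\<^sup>+x. (\<Sum>n. ennreal (f n x)) \<partial>M) = (\<Sum>n. \<integral>\<^sup>+x. ennreal (f n x) \<partial>M)"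
    using m by (intro nn_integral_suminf) auto
  also have "\<dots> = (\<Sum>n. ennreal (integral\<^sup>L M (f n)))"
    using f by (intro suminf_cong nn_integral_eq_integral) auto
  also have "\<dots> = ennreal (\<Sum>n. integral\<^sup>L M (f n))"
    using assms by (intro suminf_ennreal_eq) (auto intro: summable_sums)
  finally have "AE x in M. (\<Sum>n. ennreal (f n x)) \<noteq> \<infinity>"
    using m by (intro nn_integral_PInf_AE) auto
  then show ?thesis
    by eventually_elim (use f(2) in \<open>auto intro: summable_suminf_not_top\<close>)
qed

text \<open>
  Instead of Minkowski's inequality: weighted Cauchy--Schwarz
  \<open>(\<Sum> t\<^sub>n)\<^sup>2 \<le> (\<Sum> W\<^sub>n) (\<Sum> t\<^sub>n\<^sup>2 / W\<^sub>n)\<close> with weights slightly larger than the norms.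
\<close>

lemma weighted_Cauchy_Schwarz:
  fixes t W :: "nat \<Rightarrow> real"
  assumes t: "\<And>n. 0 \<le> t n" and W: "\<And>n. 0 < W n" "summable W"
    and H: "summable (\<lambda>n. (t n)\<^sup>2 / W n)"
  shows "summable t" "(\<Sum>n. t n)\<^sup>2 \<le> (\<Sum>n. W n) * (\<Sum>n. (t n)\<^sup>2 / W n)"
proof -
  have le: "t n \<le> (W n + (t n)\<^sup>2 / W n) / 2" for n
  proof -
    have "0 \<le> (t n - W n)\<^sup>2 / W n" using W(1)[of n] by simp
    also have "\<dots> = (t n)\<^sup>2 / W n - 2 * t n + W n"
      using W(1)[of n] by (simp add: field_simps power2_eq_square)
    finally show ?thesis by simp
  qed
  show "summable t"
    by (rule summable_comparison_test[of _ "\<lambda>n. (W n + (t n)\<^sup>2 / W n) / 2"])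
       (use le t W H in \<open>auto intro!: summable_divide summable_add\<close>)
  let ?A = "\<Sum>n. W n" and ?B = "\<Sum>n. (t n)\<^sup>2 / W n"
  have "(\<Sum>i<n. t i) \<le> sqrt (?A * ?B)" for n
  proof (rule real_le_rsqrt)
    have "(\<Sum>i<n. t i)\<^sup>2 = (\<Sum>i<n. sqrt (W i) * (t i / sqrt (W i)))\<^sup>2"
      using W(1) by (simp add: less_imp_neq[symmetric])
    also have "\<dots> \<le> (\<Sum>i<n. (sqrt (W i))\<^sup>2) * (\<Sum>i<n. (t i / sqrt (W i))\<^sup>2)"
      by (rule Cauchy_Schwarz_ineq_sum)
    also have "\<dots> = (\<Sum>i<n. W i) * (\<Sum>i<n. (t i)\<^sup>2 / W i)"
      using W(1) by (simp add: power_divide less_imp_le)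
    also have "\<dots> \<le> ?A * ?B"
      using W H by (intro mult_mono sum_le_suminf suminf_nonneg sum_nonneg) (auto simp: less_imp_le)
    finally show "(\<Sum>i<n. t i)\<^sup>2 \<le> ?A * ?B" .
  qed
  then have "suminf t \<le> sqrt (?A * ?B)"
    using \<open>summable t\<close> by (intro suminf_le_const) auto
  moreover have "0 \<le> ?A * ?B"
    using W H by (intro mult_nonneg_nonneg suminf_nonneg) (auto simp: less_imp_le)
  ultimately show "(\<Sum>n. t n)\<^sup>2 \<le> ?A * ?B"
    using suminf_nonneg[OF \<open>summable t\<close> t] by (metis power_mono real_sqrt_pow2)
qed

text \<open>Let a_n be the L^2 norms and W_n slightly larger. The functions |g_n|^2 / W_n have
  integrals a_n^2 / W_n \<le> a_n, so their sum is integrable, and the weighted Cauchy-Schwarz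
  inequality bounds the square of the sum \<open>D\<close> of all |g_n| by a constant multiple of
  it. This \<open>D\<close> dominates all partial sums.\<close>

lemma L2_on_series_dominated:
  fixes g :: "nat \<Rightarrow> 'a::euclidean_space \<Rightarrow> 'b::euclidean_space"
  assumes g: "\<And>n. L2_on \<Omega> (g n)"
    and sum: "summable (\<lambda>n. sqrt (LINT x|lebesgue_on \<Omega>. (norm (g n x))\<^sup>2))"
  obtains D :: "'a \<Rightarrow> real" where "L2_on \<Omega> D"
    "AE x in lebesgue_on \<Omega>. summable (\<lambda>n. norm (g n x)) \<and> (\<forall>n. norm (\<Sum>i<n. g i x) \<le> D x)"
proof -
  let ?M = "lebesgue_on \<Omega>"
  define a where "a n = sqrt (LINT x|?M. (norm (g n x))\<^sup>2)" for n
  \<comment> \<open>The geometric term keeps the weights positive when some \<open>g n\<close> has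
    norm 0, without spoiling summability.\<close>
  define W where "W n = a n + (1/2) ^ n" for n
  define h where "h n x = (norm (g n x))\<^sup>2 / W n" for n x
  have a0: "0 \<le> a n" for n by (simp add: a_def)
  have W0: "0 < W n" for n unfolding W_def using a0[of n] by (simp add: add_nonneg_pos)
  have sW: "summable W" unfolding W_def using sum by (intro summable_add) (auto simp: a_def[abs_def])
  have h: "integrable ?M (h n)" for n
    using g[of n] unfolding h_def L2_on_def by simp
  have h0: "0 \<le> h n x" for n x using W0[of n] by (simp add: h_def)
  have "integral\<^sup>L ?M (h n) \<le> a n" for n
  proof -
    have "integral\<^sup>L ?M (h n) = a n * a n / W n"
      unfolding h_def a_def by simp
    also have "\<dots> \<le> a n * W n / W n"
      using a0[of n] W0[of n] by (intro divide_right_mono mult_left_mono) (auto simp: W_def)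
    finally show ?thesis using W0[of n] by simp
  qed
  then have sh: "summable (\<lambda>n. integral\<^sup>L ?M (h n))"
    using sum h0 by (intro summable_comparison_test[of "\<lambda>n. integral\<^sup>L ?M (h n)" a])
       (auto simp: a_def[abs_def] Bochner_Integration.integral_nonneg)
  have ae: "AE x in ?M. summable (\<lambda>n. h n x)"
    by (rule AE_summable_of_integrals[OF h h0 sh])
  have m: "g n \<in> borel_measurable ?M" for n using g[of n] by (simp add: L2_on_def)
  define D where "D x = (\<Sum>n. norm (g n x))" for x
  have "L2_on \<Omega> D"
    unfolding L2_on_def
  proof (rule conjI[OF _ Bochner_Integration.integrable_bound[of _ "\<lambda>x. (\<Sum>n. W n) * (\<Sum>n. h n x)"]])
    show "D \<in> borel_measurable ?M" "(\<lambda>x. (norm (D x))\<^sup>2) \<in> borel_measurable ?M"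
      unfolding D_def using m by measurable
    show "integrable ?M (\<lambda>x. (\<Sum>n. W n) * (\<Sum>n. h n x))"
      using ae sh h0 by (intro integrable_mult_right integrable_suminf h) auto
    show "AE x in ?M. norm ((norm (D x))\<^sup>2) \<le> norm ((\<Sum>n. W n) * (\<Sum>n. h n x))"
      using ae
    proof eventually_elim
      case (elim x)
      from weighted_Cauchy_Schwarz(2)[of "\<lambda>n. norm (g n x)" W] W0 sW elim
      show ?case by (auto simp: D_def h_def)
    qed
  qed
  moreover have "AE x in ?M. summable (\<lambda>n. norm (g n x)) \<and> (\<forall>n. norm (\<Sum>i<n. g i x) \<le> D x)"
    using ae
  proof eventually_elim
    case (elim x)
    then have s: "summable (\<lambda>n. norm (g n x))"
      using weighted_Cauchy_Schwarz(1)[of "\<lambda>n. norm (g n x)" W] W0 sW by (auto simp: h_def)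
    have "norm (\<Sum>i<n. g i x) \<le> D x" for n
      using norm_sum[of "\<lambda>i. g i x" "{..<n}"] sum_le_suminf[OF s, of "{..<n}"] by (simp add: D_def)
    with s show ?case by blast
  qed
  ultimately show thesis by (rule that)
qed

text \<open>Dominated convergence with the majorant \<open>D\<close>. The third claim covers every
  pairing that occurs in the weak formulation, so identities known for partial sums pass to the
  limit.\<close>

lemma L2_on_series:
  fixes g :: "nat \<Rightarrow> 'a::euclidean_space \<Rightarrow> 'b::euclidean_space"
  assumes g: "\<And>n. L2_on \<Omega> (g n)"
    and sum: "summable (\<lambda>n. sqrt (LINT x|lebesgue_on \<Omega>. (norm (g n x))\<^sup>2))"
  shows "L2_on \<Omega> (\<lambda>x. \<Sum>n. g n x)" (is "L2_on \<Omega> ?G")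
    and "(\<lambda>n. LINT x|lebesgue_on \<Omega>. (norm ((\<Sum>n. g n x) - (\<Sum>i<n. g i x)))\<^sup>2) \<longlonglongrightarrow> 0"
    and "bounded_bilinear B \<Longrightarrow> L2_on \<Omega> f \<Longrightarrow>
      (\<lambda>n. LINT x|lebesgue_on \<Omega>. B (\<Sum>i<n. g i x) (f x :: 'c::euclidean_space) :: 'd::euclidean_space) \<longlonglongrightarrow>
      (LINT x|lebesgue_on \<Omega>. B (\<Sum>n. g n x) (f x))"
proof -
  let ?M = "lebesgue_on \<Omega>"
  obtain D :: "'a \<Rightarrow> real" where D: "L2_on \<Omega> D"
    and ae: "AE x in ?M. summable (\<lambda>n. norm (g n x)) \<and> (\<forall>n. norm (\<Sum>i<n. g i x) \<le> D x)"
    using L2_on_series_dominated[OF assms] by blast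
  have m[measurable]: "g n \<in> borel_measurable ?M" for n using g[of n] by (simp add: L2_on_def)
  have mG[measurable]: "?G \<in> borel_measurable ?M" by measurable
  have mS[measurable]: "(\<lambda>x. \<Sum>i<n. g i x) \<in> borel_measurable ?M" for n by measurable
  have lim: "AE x in ?M. (\<lambda>n. \<Sum>i<n. g i x) \<longlonglongrightarrow> ?G x"
    using ae by eventually_elim (auto dest!: summable_norm_cancel simp: summable_LIMSEQ)
  have bG: "AE x in ?M. norm (?G x) \<le> D x"
    using ae lim
  proof eventually_elim
    case (elim x)
    then show ?case by (intro Lim_bounded[OF tendsto_norm[OF elim(2)], of 0]) auto
  qed
  show L2G: "L2_on \<Omega> ?G"
    by (rule L2_on_dominated[OF D mG]) (rule eventually_mono[OF bG], auto)
  have L2S: "L2_on \<Omega> (\<lambda>x. \<Sum>i<n. g i x)" for n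
    by (rule L2_on_dominated[OF D mS]) (rule eventually_mono[OF ae], auto intro: order_trans[OF _ abs_ge_self])
  have "(\<lambda>n. LINT x|?M. (norm (?G x - (\<Sum>i<n. g i x)))\<^sup>2) \<longlonglongrightarrow> (LINT x|?M. 0)"
  proof (rule integral_dominated_convergence[where w = "\<lambda>x. 4 * (norm (D x))\<^sup>2"])
    show "integrable ?M (\<lambda>x. 4 * (norm (D x))\<^sup>2)" using D by (simp add: L2_on_def)
    show "AE x in ?M. (\<lambda>n. (norm (?G x - (\<Sum>i<n. g i x)))\<^sup>2) \<longlonglongrightarrow> 0"
      using lim
    proof eventually_elim
      case (elim x)
      then have "(\<lambda>n. (norm (?G x - (\<Sum>i<n. g i x)))\<^sup>2) \<longlonglongrightarrow> (norm (?G x - ?G x))\<^sup>2"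
        by (intro tendsto_intros)
      then show ?case by simp
    qed
    show "AE x in ?M. norm ((norm (?G x - (\<Sum>i<n. g i x)))\<^sup>2) \<le> 4 * (norm (D x))\<^sup>2" for n
      using ae bG
    proof eventually_elim
      case (elim x)
      have "norm (?G x - (\<Sum>i<n. g i x)) \<le> 2 * D x"
        using norm_triangle_ineq4[of "?G x" "\<Sum>i<n. g i x"] elim by (smt (verit))
      then have "(norm (?G x - (\<Sum>i<n. g i x)))\<^sup>2 \<le> (2 * D x)\<^sup>2" by (intro power_mono) auto
      then show ?case by (simp add: power_mult_distrib)
    qed
  qed measurable
  then show "(\<lambda>n. LINT x|?M. (norm (?G x - (\<Sum>i<n. g i x)))\<^sup>2) \<longlonglongrightarrow> 0" by simp
  show "(\<lambda>n. LINT x|?M. B (\<Sum>i<n. g i x) (f x)) \<longlonglongrightarrow> (LINT x|?M. B (?G x) (f x))"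
    if B: "bounded_bilinear B" and f: "L2_on \<Omega> f"
    for B :: "'b \<Rightarrow> 'c \<Rightarrow> 'd" and f :: "'a \<Rightarrow> 'c"
  proof -
    interpret B: bounded_bilinear B by fact
    obtain K where K: "0 \<le> K" "\<And>a b. norm (B a b) \<le> norm a * norm b * K"
      using B.nonneg_bounded by blast
    show ?thesis
    proof (rule integral_dominated_convergence[where w = "\<lambda>x. norm (D x) * norm (f x) * K"])
      show "(\<lambda>x. B (?G x) (f x)) \<in> borel_measurable ?M"
        "(\<lambda>x. B (\<Sum>i<n. g i x) (f x)) \<in> borel_measurable ?M" for n
        using L2_on_bilinear_integrable(3)[OF B _ f] L2G L2S by blast+
      show "integrable ?M (\<lambda>x. norm (D x) * norm (f x) * K)"
        using L2_on_bilinear_integrable(2)[OF bounded_bilinear_scaleR D f] by (rule integrable_mult_left)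
      show "AE x in ?M. (\<lambda>n. B (\<Sum>i<n. g i x) (f x)) \<longlonglongrightarrow> B (?G x) (f x)"
        using lim by eventually_elim (intro B.tendsto tendsto_const)
      show "AE x in ?M. norm (B (\<Sum>i<n. g i x) (f x)) \<le> norm (D x) * norm (f x) * K" for n
        using ae
      proof eventually_elim
        case (elim x)
        have "norm (B (\<Sum>i<n. g i x) (f x)) \<le> norm (\<Sum>i<n. g i x) * norm (f x) * K" by (rule K)
        also have "\<dots> \<le> norm (D x) * norm (f x) * K"
          using elim K(1) by (intro mult_right_mono) (auto intro: order_trans[OF _ abs_ge_self])
        finally show ?case .
      qed
    qed
  qed
qed

section \<open>Weak solutions\<close>

lemma integral_gradient_eq_0:
  fixes f :: "'a::euclidean_space \<Rightarrow> real"
  assumes "test_function \<Omega> f" "\<Omega> \<in> sets lebesgue"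
  shows "(LINT x|lebesgue_on \<Omega>. gradient f x) = 0"
proof -
  have "integrable (lebesgue_on \<Omega>) (\<lambda>x. dir f b x *\<^sub>R b)" for b
    using test_function_integrable[OF test_function_dir[OF assms(1)] assms(2)] by simp
  then have "(LINT x|lebesgue_on \<Omega>. gradient f x) = (\<Sum>b\<in>Basis. LINT x|lebesgue_on \<Omega>. dir f b x *\<^sub>R b)"
    unfolding gradient_eq by (intro Bochner_Integration.integral_sum)
  also have "\<dots> = (\<Sum>b\<in>Basis. (LINT x|lebesgue_on \<Omega>. dir f b x) *\<^sub>R b)"
    using test_function_integrable[OF test_function_dir[OF assms(1)] assms(2)]
    by (intro sum.cong) auto
  finally show ?thesis using test_function_integral_dir[OF assms] by simp
qed

lemma gradient_mult:
  "smooth f \<Longrightarrow> smooth g \<Longrightarrow> gradient (\<lambda>x. f x * g x) x = f x *\<^sub>R gradient g x + g x *\<^sub>R gradient f x"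
  by (simp add: gradient_eq dir_mult smooth_differentiable scaleR_left.add sum.distrib scaleR_sum_right
      mult.commute)

lemma test_function_by_parts:
  fixes f \<phi> :: "'a::euclidean_space \<Rightarrow> real"
  assumes f: "test_function \<Omega> f" and \<phi>: "test_function \<Omega> \<phi>" and \<Omega>: "\<Omega> \<in> sets lebesgue"
  shows "(LINT x|lebesgue_on \<Omega>. f x *\<^sub>R gradient \<phi> x) = - (LINT x|lebesgue_on \<Omega>. \<phi> x *\<^sub>R gradient f x)"
proof -
  note L2 = L2_on_test_function[OF _ \<Omega>] L2_on_gradient[OF _ \<Omega>]
  have "0 = (LINT x|lebesgue_on \<Omega>. gradient (\<lambda>x. f x * \<phi> x) x)"
    using integral_gradient_eq_0[OF test_function_mult[OF \<phi> test_function_smooth[OF f]] \<Omega>] by simp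
  also have "\<dots> = (LINT x|lebesgue_on \<Omega>. f x *\<^sub>R gradient \<phi> x + \<phi> x *\<^sub>R gradient f x)"
    using f \<phi> by (simp add: gradient_mult test_function_smooth)
  also have "\<dots> = (LINT x|lebesgue_on \<Omega>. f x *\<^sub>R gradient \<phi> x) + (LINT x|lebesgue_on \<Omega>. \<phi> x *\<^sub>R gradient f x)"
    using f \<phi> by (intro Bochner_Integration.integral_add L2_on_scaleR_integrable L2)
  finally show ?thesis by (simp add: eq_neg_iff_add_eq_0)
qed

definition laplacian :: "('a::euclidean_space \<Rightarrow> real) \<Rightarrow> 'a \<Rightarrow> real" where
  "laplacian f x = (\<Sum>b\<in>Basis. dir (dir f b) b x)"

lemma test_function_laplacian: "test_function \<Omega> f \<Longrightarrow> test_function \<Omega> (laplacian f)"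
  unfolding laplacian_def[abs_def] by (intro test_function_sum test_function_dir)

text \<open>
  The defining identity of the weak gradient of \<open>v\<close>, tested with the partial derivatives of \<open>f\<close>.
\<close>

lemma laplacian_by_parts:
  fixes f v :: "'a::euclidean_space \<Rightarrow> real"
  assumes f: "test_function \<Omega> f" and v: "H1_with_gradient \<Omega> v Dv" and \<Omega>: "\<Omega> \<in> sets lebesgue"
  shows "(LINT x|lebesgue_on \<Omega>. gradient f x \<bullet> Dv x) = (LINT x|lebesgue_on \<Omega>. (- laplacian f x) * v x)"
proof -
  let ?M = "lebesgue_on \<Omega>"
  have L2: "L2_on \<Omega> v" "L2_on \<Omega> Dv" using v by (auto simp: H1_with_gradient_def)
  have t: "test_function \<Omega> (dir f b)" "test_function \<Omega> (dir (dir f b) b)" for b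
    using f by (auto intro: test_function_dir)
  have i1: "integrable ?M (\<lambda>x. v x *\<^sub>R gradient (dir f b) x)" for b
    by (intro L2_on_scaleR_integrable L2 L2_on_gradient t \<Omega>)
  have i2: "integrable ?M (\<lambda>x. dir f b x *\<^sub>R Dv x)" for b
    by (intro L2_on_scaleR_integrable L2 L2_on_test_function t \<Omega>)
  have i3: "integrable ?M (\<lambda>x. dir (dir f b) b x * v x)" for b
    by (intro L2_on_mult_integrable L2 L2_on_test_function t \<Omega>)
  have eq: "(LINT x|?M. dir f b x * (Dv x \<bullet> b)) = - (LINT x|?M. dir (dir f b) b x * v x)"
    if b: "b \<in> Basis" for b
  proof -
    have "(LINT x|?M. v x *\<^sub>R gradient (dir f b) x) = - (LINT x|?M. dir f b x *\<^sub>R Dv x)"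
      using v t(1) by (simp add: H1_with_gradient_def)
    \<comment> \<open>Taking the component along \<open>b\<close> leaves only the second derivative
      in direction \<open>b\<close> of the vector-valued identity.\<close>
    then have "(LINT x|?M. v x *\<^sub>R gradient (dir f b) x) \<bullet> b = - ((LINT x|?M. dir f b x *\<^sub>R Dv x) \<bullet> b)"
      by simp
    then have "(LINT x|?M. (v x *\<^sub>R gradient (dir f b) x) \<bullet> b) = - (LINT x|?M. (dir f b x *\<^sub>R Dv x) \<bullet> b)"
      by (simp only: integral_inner_left[OF i1] integral_inner_left[OF i2])
    then show ?thesis by (simp add: gradient_inner_Basis[OF b] mult.commute)
  qed
  have i4: "integrable ?M (\<lambda>x. dir f b x * (Dv x \<bullet> b))" for b
    using integrable_inner_left[of b ?M, OF i2[of b]] by simp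
  have "(LINT x|?M. gradient f x \<bullet> Dv x) = (LINT x|?M. (\<Sum>b\<in>Basis. dir f b x * (Dv x \<bullet> b)))"
    by (simp add: gradient_eq inner_sum_left inner_sum_right inner_commute[of _ "Dv _"])
  also have "\<dots> = (\<Sum>b\<in>Basis. LINT x|?M. dir f b x * (Dv x \<bullet> b))"
    by (intro Bochner_Integration.integral_sum i4)
  also have "\<dots> = - (\<Sum>b\<in>Basis. LINT x|?M. dir (dir f b) b x * v x)"
    by (simp add: eq sum_negf)
  also have "\<dots> = - (LINT x|?M. (\<Sum>b\<in>Basis. dir (dir f b) b x * v x))"
    by (simp add: Bochner_Integration.integral_sum i3)
  also have "\<dots> = (LINT x|?M. (- laplacian f x) * v x)"
    by (simp add: laplacian_def sum_distrib_right)
  finally show ?thesis .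
qed

text \<open>Makes the difference of two weak solutions admissible as a test function in the
  uniqueness proof. The approximants are subtracted, with error controlled by |a - b|^2 \<le> 2
  |a|^2 + 2 |b|^2.\<close>

lemma H10_with_gradient_diff:
  fixes u v :: "'a::euclidean_space \<Rightarrow> real"
  assumes u: "H10_with_gradient \<Omega> u Du" and v: "H10_with_gradient \<Omega> v Dv" and \<Omega>: "\<Omega> \<in> sets lebesgue"
  shows "H10_with_gradient \<Omega> (\<lambda>x. u x - v x) (\<lambda>x. Du x - Dv x)"
proof -
  let ?M = "lebesgue_on \<Omega>"
  have L2: "L2_on \<Omega> u" "L2_on \<Omega> Du" "L2_on \<Omega> v" "L2_on \<Omega> Dv"
    using u v by (auto simp: H10_with_gradient_def H1_with_gradient_def)
  have "H1_with_gradient \<Omega> (\<lambda>x. u x - v x) (\<lambda>x. Du x - Dv x)"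
    unfolding H1_with_gradient_def
  proof (intro conjI allI impI)
    fix \<phi> :: "'a \<Rightarrow> real" assume \<phi>: "test_function \<Omega> \<phi>"
    note L2' = L2 L2_on_test_function[OF \<phi> \<Omega>] L2_on_gradient[OF \<phi> \<Omega>]
    have "(LINT x|?M. u x *\<^sub>R gradient \<phi> x) = - (LINT x|?M. \<phi> x *\<^sub>R Du x)"
      "(LINT x|?M. v x *\<^sub>R gradient \<phi> x) = - (LINT x|?M. \<phi> x *\<^sub>R Dv x)"
      using u v \<phi> by (auto simp: H10_with_gradient_def H1_with_gradient_def)
    then show "(LINT x|?M. (u x - v x) *\<^sub>R gradient \<phi> x) = - (LINT x|?M. \<phi> x *\<^sub>R (Du x - Dv x))"
      unfolding scaleR_diff_left scaleR_diff_right
      by (simp add: Bochner_Integration.integral_diff L2_on_scaleR_integrable L2')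
  qed (use L2 in \<open>auto intro: L2_on_diff\<close>)
  moreover have "\<exists>\<phi> :: nat \<Rightarrow> 'a \<Rightarrow> real. (\<forall>n. test_function \<Omega> (\<phi> n)) \<and>
     (\<lambda>n. LINT x|?M. ((u x - v x) - \<phi> n x)\<^sup>2 + (norm ((Du x - Dv x) - gradient (\<phi> n) x))\<^sup>2) \<longlonglongrightarrow> 0"
  proof -
    let ?e = "\<lambda>u Du \<phi> x. (u x - \<phi> x)\<^sup>2 + (norm (Du x - gradient \<phi> x))\<^sup>2"
    obtain \<phi> where \<phi>: "\<And>n. test_function \<Omega> (\<phi> n)" "(\<lambda>n. LINT x|?M. ?e u Du (\<phi> n) x) \<longlonglongrightarrow> 0"
      using u unfolding H10_with_gradient_def by blast
    obtain \<psi> where \<psi>: "\<And>n. test_function \<Omega> (\<psi> n)" "(\<lambda>n. LINT x|?M. ?e v Dv (\<psi> n) x) \<longlonglongrightarrow> 0"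
      using v unfolding H10_with_gradient_def by blast
    define \<xi> where "\<xi> n x = \<phi> n x + (-1) * \<psi> n x" for n x
    have t: "test_function \<Omega> (\<xi> n)" for n
      unfolding \<xi>_def by (intro test_function_add test_function_mult \<phi> \<psi> smooth_const)
    have grad: "gradient (\<xi> n) x = gradient (\<phi> n) x - gradient (\<psi> n) x" for n x
    proof -
      have "gradient (\<xi> n) x = gradient (\<phi> n) x + gradient (\<lambda>x. (-1) * \<psi> n x) x"
        unfolding \<xi>_def by (intro gradient_add smooth_mult smooth_const test_function_smooth[OF \<phi>(1)]
            test_function_smooth[OF \<psi>(1)])
      then show ?thesis
        using gradient_cmult[OF test_function_smooth[OF \<psi>(1)], of "-1" n x] by simp
    qed
    note tL2 = L2_on_test_function[OF _ \<Omega>] L2_on_gradient[OF _ \<Omega>]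
    have int: "integrable ?M (?e w Dw \<eta>)"
      if "L2_on \<Omega> w" "L2_on \<Omega> Dw" "test_function \<Omega> \<eta>" for w Dw \<eta>
      using L2_on_diff[OF that(1) tL2(1)[OF that(3)]] L2_on_diff[OF that(2) tL2(2)[OF that(3)]]
      by (auto simp: L2_on_def)
    have le: "?e (\<lambda>x. u x - v x) (\<lambda>x. Du x - Dv x) (\<xi> n) x \<le> 2 * ?e u Du (\<phi> n) x + 2 * ?e v Dv (\<psi> n) x" for n x
    proof -
      have *: "(norm (a - b))\<^sup>2 \<le> 2 * (norm a)\<^sup>2 + 2 * (norm b)\<^sup>2" for a b :: "'z::real_normed_vector"
      proof -
        have "(norm (a - b))\<^sup>2 \<le> (norm a + norm b)\<^sup>2"
          by (intro power_mono norm_triangle_ineq4) auto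
        also have "\<dots> \<le> 2 * (norm a)\<^sup>2 + 2 * (norm b)\<^sup>2"
          using sum_squares_bound[of "norm a" "norm b"] by (simp add: power2_sum)
        finally show ?thesis .
      qed
      have "u x - v x - \<xi> n x = (u x - \<phi> n x) - (v x - \<psi> n x)" by (simp add: \<xi>_def)
      moreover have "Du x - Dv x - gradient (\<xi> n) x = (Du x - gradient (\<phi> n) x) - (Dv x - gradient (\<psi> n) x)"
        by (simp add: grad)
      moreover have "(u x - \<phi> n x - (v x - \<psi> n x))\<^sup>2 + (norm (Du x - gradient (\<phi> n) x - (Dv x - gradient (\<psi> n) x)))\<^sup>2
        \<le> (2 * (u x - \<phi> n x)\<^sup>2 + 2 * (v x - \<psi> n x)\<^sup>2) +
          (2 * (norm (Du x - gradient (\<phi> n) x))\<^sup>2 + 2 * (norm (Dv x - gradient (\<psi> n) x))\<^sup>2)"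
        using *[of "u x - \<phi> n x" "v x - \<psi> n x"] unfolding real_norm_def power2_abs
        by (rule add_mono[OF _ *])
      ultimately show ?thesis by (simp only: distrib_left add_ac)
    qed
    have "(\<lambda>n. LINT x|?M. ?e (\<lambda>x. u x - v x) (\<lambda>x. Du x - Dv x) (\<xi> n) x) \<longlonglongrightarrow> 0"
    proof (rule tendsto_sandwich[OF always_eventually always_eventually tendsto_const])
      show "\<forall>n. 0 \<le> (LINT x|?M. ?e (\<lambda>x. u x - v x) (\<lambda>x. Du x - Dv x) (\<xi> n) x)" by simp
      show "\<forall>n. (LINT x|?M. ?e (\<lambda>x. u x - v x) (\<lambda>x. Du x - Dv x) (\<xi> n) x)
         \<le> 2 * (LINT x|?M. ?e u Du (\<phi> n) x) + 2 * (LINT x|?M. ?e v Dv (\<psi> n) x)"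
      proof
        fix n
        note i = int[OF L2(1,2) \<phi>(1)[of n]] int[OF L2(3,4) \<psi>(1)[of n]]
        have "(LINT x|?M. ?e (\<lambda>x. u x - v x) (\<lambda>x. Du x - Dv x) (\<xi> n) x)
           \<le> (LINT x|?M. 2 * ?e u Du (\<phi> n) x + 2 * ?e v Dv (\<psi> n) x)"
          by (rule integral_mono[OF int[OF L2_on_diff[OF L2(1,3)] L2_on_diff[OF L2(2,4)] t]
              Bochner_Integration.integrable_add[OF integrable_mult_right[OF i(1)] integrable_mult_right[OF i(2)]] le])
        also have "\<dots> = (LINT x|?M. 2 * ?e u Du (\<phi> n) x) + (LINT x|?M. 2 * ?e v Dv (\<psi> n) x)"
          by (rule Bochner_Integration.integral_add[OF integrable_mult_right[OF i(1)] integrable_mult_right[OF i(2)]])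
        finally show "(LINT x|?M. ?e (\<lambda>x. u x - v x) (\<lambda>x. Du x - Dv x) (\<xi> n) x)
         \<le> 2 * (LINT x|?M. ?e u Du (\<phi> n) x) + 2 * (LINT x|?M. ?e v Dv (\<psi> n) x)"
          by (simp only: integral_mult_right_zero)
      qed
      show "(\<lambda>n. 2 * (LINT x|?M. ?e u Du (\<phi> n) x) + 2 * (LINT x|?M. ?e v Dv (\<psi> n) x)) \<longlonglongrightarrow> 0"
        using tendsto_add[OF tendsto_mult_left[OF \<phi>(2), of 2] tendsto_mult_left[OF \<psi>(2), of 2]] by simp
    qed
    with t show ?thesis by blast
  qed
  ultimately show ?thesis unfolding H10_with_gradient_def by blast
qed

text \<open>For a coordinate direction b the derivative of x_b f^2 integrates to 0, and it equals
  f^2 + 2 x_b f f_b. Subtracting it from f^2 / 2 leaves, after completing a square, at most 2 x_b^2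
  f_b^2, and |x_b| \<le> R on the domain.\<close>

lemma Poincare_inequality:
  fixes f :: "'a::euclidean_space \<Rightarrow> real"
  assumes f: "test_function \<Omega> f" and \<Omega>: "\<Omega> \<in> sets lebesgue" and R: "\<And>x. x \<in> \<Omega> \<Longrightarrow> norm x \<le> R"
  shows "(LINT x|lebesgue_on \<Omega>. (f x)\<^sup>2) \<le> 4 * R\<^sup>2 * (LINT x|lebesgue_on \<Omega>. (norm (gradient f x))\<^sup>2)"
proof -
  let ?M = "lebesgue_on \<Omega>"
  obtain b :: 'a where b: "b \<in> Basis" by (meson nonempty_Basis ex_in_conv)
  have sf: "smooth f" using f by (rule test_function_smooth)
  have df: "f differentiable (at x)" "(\<lambda>x. x \<bullet> b) differentiable (at x)" for x
    using smooth_differentiable sf smooth_inner by blast+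
  define h where "h x = (x \<bullet> b) * f x * f x" for x
  have th: "test_function \<Omega> h"
    unfolding h_def by (intro test_function_mult f smooth_mult smooth_inner sf)
  have dh: "dir h b x = (f x)\<^sup>2 + 2 * (x \<bullet> b) * f x * dir f b x" for x
  proof -
    have "dir (\<lambda>x. x \<bullet> b) b x = 1"
      using b by (subst dir_eqI[where f' = "\<lambda>v. v \<bullet> b"]) (auto intro!: derivative_eq_intros)
    moreover have "(\<lambda>x. (x \<bullet> b) * f x) differentiable (at x)"
      using df by (intro derivative_intros)
    ultimately show ?thesis
      unfolding h_def using df by (simp add: dir_mult power2_eq_square algebra_simps)
  qed
  have i1: "integrable ?M (\<lambda>x. (f x)\<^sup>2)" "integrable ?M (\<lambda>x. (dir f b x)\<^sup>2)"
    "integrable ?M (\<lambda>x. (norm (gradient f x))\<^sup>2)"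
    using L2_on_test_function[OF f \<Omega>] L2_on_test_function[OF test_function_dir[OF f] \<Omega>, of b]
      L2_on_gradient[OF f \<Omega>] by (auto simp: L2_on_def)
  have "(LINT x|?M. (f x)\<^sup>2) / 2 = (LINT x|?M. (f x)\<^sup>2 / 2 - dir h b x)"
    using i1 test_function_integrable[OF test_function_dir[OF th] \<Omega>, of b]
      test_function_integral_dir[OF th \<Omega>, of b] by simp
  also have "\<dots> \<le> (LINT x|?M. 2 * R\<^sup>2 * (norm (gradient f x))\<^sup>2)"
  proof (rule integral_mono)
    show "integrable ?M (\<lambda>x. (f x)\<^sup>2 / 2 - dir h b x)"
      using i1 test_function_integrable[OF test_function_dir[OF th] \<Omega>, of b] by simp
    show "integrable ?M (\<lambda>x. 2 * R\<^sup>2 * (norm (gradient f x))\<^sup>2)" using i1 by simp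
    fix x assume "x \<in> space ?M"
    then have x: "x \<in> \<Omega>" by (simp add: space_restrict_space)
    have "\<bar>x \<bullet> b\<bar> \<le> R" using R[OF x] Basis_le_norm[OF b, of x] by linarith
    then have "(x \<bullet> b)\<^sup>2 \<le> R\<^sup>2" using power_mono[of "\<bar>x \<bullet> b\<bar>" R 2] by simp
    moreover have "(dir f b x)\<^sup>2 \<le> (norm (gradient f x))\<^sup>2"
      unfolding norm_gradient using b by (intro member_le_sum[of b Basis "\<lambda>b. (dir f b x)\<^sup>2"]) auto
    ultimately have "(x \<bullet> b)\<^sup>2 * (dir f b x)\<^sup>2 \<le> R\<^sup>2 * (norm (gradient f x))\<^sup>2"
      by (intro mult_mono) auto
    moreover have "0 \<le> (f x / 2 + (x \<bullet> b) * dir f b x)\<^sup>2" by simp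
    then have "- 2 * (x \<bullet> b) * f x * dir f b x \<le> (f x)\<^sup>2 / 2 + 2 * ((x \<bullet> b)\<^sup>2 * (dir f b x)\<^sup>2)"
      by (simp add: power2_eq_square field_simps)
    ultimately show "(f x)\<^sup>2 / 2 - dir h b x \<le> 2 * R\<^sup>2 * (norm (gradient f x))\<^sup>2"
      unfolding dh by (simp add: algebra_simps)
  qed
  also have "\<dots> = 2 * R\<^sup>2 * (LINT x|?M. (norm (gradient f x))\<^sup>2)" by simp
  finally show ?thesis by simp
qed

text \<open>Testing both equations with the difference w shows that its weak gradient vanishes
  almost everywhere. Poincare's inequality is stated for test functions, so it is applied to the
  approximants of w, whose gradients tend to 0 in L^2.\<close>

lemma weak_solution_unique:
  fixes u u' :: "'a::euclidean_space \<Rightarrow> real"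
  assumes \<Omega>: "\<Omega> \<in> sets lebesgue" and bdd: "bounded \<Omega>"
    and u: "weak_solution \<Omega> F u" and u': "weak_solution \<Omega> F u'"
  shows "AE x in lebesgue_on \<Omega>. u x = u' x"
proof -
  let ?M = "lebesgue_on \<Omega>"
  obtain R where R: "\<And>x. x \<in> \<Omega> \<Longrightarrow> norm x \<le> R" using bdd unfolding bounded_iff by blast
  obtain Du where Du: "H10_with_gradient \<Omega> u Du"
    "\<And>v Dv. H10_with_gradient \<Omega> v Dv \<Longrightarrow> (LINT x|?M. Du x \<bullet> Dv x) = (LINT x|?M. F x * v x)"
    using u unfolding weak_solution_def by blast
  obtain Du' where Du': "H10_with_gradient \<Omega> u' Du'"
    "\<And>v Dv. H10_with_gradient \<Omega> v Dv \<Longrightarrow> (LINT x|?M. Du' x \<bullet> Dv x) = (LINT x|?M. F x * v x)"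
    using u' unfolding weak_solution_def by blast
  define w where "w x = u x - u' x" for x
  define Dw where "Dw x = Du x - Du' x" for x
  have w: "H10_with_gradient \<Omega> w Dw"
    unfolding w_def Dw_def by (rule H10_with_gradient_diff[OF Du(1) Du'(1) \<Omega>])
  have L2: "L2_on \<Omega> Du" "L2_on \<Omega> Du'" "L2_on \<Omega> w" "L2_on \<Omega> Dw"
    using Du(1) Du'(1) w by (auto simp: H10_with_gradient_def H1_with_gradient_def)
  have iw: "integrable ?M (\<lambda>x. (w x)\<^sup>2)" "integrable ?M (\<lambda>x. (norm (Dw x))\<^sup>2)"
    using L2 by (auto simp: L2_on_def)
  have "(LINT x|?M. (norm (Dw x))\<^sup>2) = (LINT x|?M. Du x \<bullet> Dw x - Du' x \<bullet> Dw x)"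
    by (simp add: power2_norm_eq_inner Dw_def inner_diff_left)
  also have "\<dots> = (LINT x|?M. Du x \<bullet> Dw x) - (LINT x|?M. Du' x \<bullet> Dw x)"
    by (intro Bochner_Integration.integral_diff L2_on_inner_integrable L2)
  also have "\<dots> = 0" using Du(2)[OF w] Du'(2)[OF w] by simp
  finally have "AE x in ?M. (norm (Dw x))\<^sup>2 = 0"
    using iw by (subst (asm) integral_nonneg_eq_0_iff_AE) auto
  then have Dw0: "AE x in ?M. Dw x = 0" by simp
  obtain \<phi> where \<phi>: "\<And>n. test_function \<Omega> (\<phi> n)"
    "(\<lambda>n. LINT x|?M. (w x - \<phi> n x)\<^sup>2 + (norm (Dw x - gradient (\<phi> n) x))\<^sup>2) \<longlonglongrightarrow> 0"
    using w unfolding H10_with_gradient_def by blast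
  let ?e = "\<lambda>n. LINT x|?M. (w x - \<phi> n x)\<^sup>2 + (norm (Dw x - gradient (\<phi> n) x))\<^sup>2"
  \<comment> \<open>The 2 comes from w^2 \<le> 2 (w - \<phi>)^2 + 2 \<phi>^2, and 8 R^2 is twice the
    Poincare constant 4 R^2.\<close>
  have "(LINT x|?M. (w x)\<^sup>2) \<le> (2 + 8 * R\<^sup>2) * ?e n" for n
  proof -
    note t = L2_on_test_function[OF \<phi>(1) \<Omega>, of n] L2_on_gradient[OF \<phi>(1) \<Omega>, of n]
    have i: "integrable ?M (\<lambda>x. (w x - \<phi> n x)\<^sup>2)"
      "integrable ?M (\<lambda>x. (norm (Dw x - gradient (\<phi> n) x))\<^sup>2)" "integrable ?M (\<lambda>x. (\<phi> n x)\<^sup>2)"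
      using L2_on_diff[OF L2(3) t(1)] L2_on_diff[OF L2(4) t(2)] t by (auto simp: L2_on_def)
    have e: "?e n = (LINT x|?M. (w x - \<phi> n x)\<^sup>2) + (LINT x|?M. (norm (Dw x - gradient (\<phi> n) x))\<^sup>2)"
      by (rule Bochner_Integration.integral_add[OF i(1,2)])
    have "(LINT x|?M. (norm (gradient (\<phi> n) x))\<^sup>2) = (LINT x|?M. (norm (Dw x - gradient (\<phi> n) x))\<^sup>2)"
    proof (rule integral_cong_AE)
      show "AE x in ?M. (norm (gradient (\<phi> n) x))\<^sup>2 = (norm (Dw x - gradient (\<phi> n) x))\<^sup>2"
        using Dw0 by eventually_elim simp
    qed (use t L2 in \<open>auto simp: L2_on_def\<close>)
    then have 1: "(LINT x|?M. (\<phi> n x)\<^sup>2) \<le> 4 * R\<^sup>2 * (LINT x|?M. (norm (Dw x - gradient (\<phi> n) x))\<^sup>2)"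
      using Poincare_inequality[OF \<phi>(1)[of n] \<Omega> R] by simp
    have "(LINT x|?M. (w x)\<^sup>2) \<le> (LINT x|?M. 2 * (w x - \<phi> n x)\<^sup>2 + 2 * (\<phi> n x)\<^sup>2)"
    proof (rule integral_mono[OF iw(1)])
      show "(w x)\<^sup>2 \<le> 2 * (w x - \<phi> n x)\<^sup>2 + 2 * (\<phi> n x)\<^sup>2" for x
        using sum_squares_bound[of "w x - \<phi> n x" "\<phi> n x"] zero_le_power2[of "w x - 2 * \<phi> n x"]
        by (simp add: power2_eq_square algebra_simps)
    qed (use i in simp)
    also have "\<dots> = 2 * (LINT x|?M. (w x - \<phi> n x)\<^sup>2) + 2 * (LINT x|?M. (\<phi> n x)\<^sup>2)"
      using i by simp
    also have "\<dots> \<le> 2 * (LINT x|?M. (w x - \<phi> n x)\<^sup>2)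
        + 8 * R\<^sup>2 * (LINT x|?M. (norm (Dw x - gradient (\<phi> n) x))\<^sup>2)"
      using 1 by simp
    also have "\<dots> \<le> (2 + 8 * R\<^sup>2) * ?e n"
    proof -
      have "0 \<le> (LINT x|?M. (w x - \<phi> n x)\<^sup>2)" "0 \<le> (LINT x|?M. (norm (Dw x - gradient (\<phi> n) x))\<^sup>2)"
        by simp_all
      then show ?thesis unfolding e by (simp add: algebra_simps mult_nonneg_nonneg)
    qed
    finally show ?thesis .
  qed
  moreover have "(\<lambda>n. (2 + 8 * R\<^sup>2) * ?e n) \<longlonglongrightarrow> (2 + 8 * R\<^sup>2) * 0"
    by (intro tendsto_mult_left \<phi>(2))
  ultimately have "(LINT x|?M. (w x)\<^sup>2) \<le> (2 + 8 * R\<^sup>2) * 0"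
    using LIMSEQ_le_const by blast
  then have "(LINT x|?M. (w x)\<^sup>2) = 0" by (simp add: antisym)
  then have "AE x in ?M. (w x)\<^sup>2 = 0"
    using iw by (subst (asm) integral_nonneg_eq_0_iff_AE) auto
  then show ?thesis by (simp add: w_def)
qed

text \<open>For finite partial sums the identities are integrations by parts with test functions;
  \<open>L2_on_series\<close> passes them to the limit, and the partial sums themselves witness
  membership in H_0^1. The right-hand side is read off from the solution, so existence is part of
  the construction.\<close>

lemma weak_solution_series:
  fixes g :: "nat \<Rightarrow> 'a::euclidean_space \<Rightarrow> real"
  assumes \<Omega>: "\<Omega> \<in> sets lebesgue" and g: "\<And>n. test_function \<Omega> (g n)"
    and s0: "summable (\<lambda>n. sqrt (LINT x|lebesgue_on \<Omega>. (g n x)\<^sup>2))"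
    and s1: "summable (\<lambda>n. sqrt (LINT x|lebesgue_on \<Omega>. (norm (gradient (g n) x))\<^sup>2))"
    and s2: "summable (\<lambda>n. sqrt (LINT x|lebesgue_on \<Omega>. (laplacian (g n) x)\<^sup>2))"
  shows "L2_on \<Omega> (\<lambda>x. \<Sum>n. - laplacian (g n) x)"
    and "weak_solution \<Omega> (\<lambda>x. \<Sum>n. - laplacian (g n) x) (\<lambda>x. \<Sum>n. g n x)"
proof -
  let ?M = "lebesgue_on \<Omega>"
  let ?u = "\<lambda>x. \<Sum>n. g n x" and ?Du = "\<lambda>x. \<Sum>n. gradient (g n) x"
    and ?F = "\<lambda>x. \<Sum>n. - laplacian (g n) x"
  have L0: "L2_on \<Omega> (g n)" and L1: "L2_on \<Omega> (gradient (g n))" and L2: "L2_on \<Omega> (\<lambda>x. - laplacian (g n) x)" for n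
    using g by (auto intro!: L2_on_test_function L2_on_gradient L2_on_uminus test_function_laplacian \<Omega>)
  have s0': "summable (\<lambda>n. sqrt (LINT x|?M. (norm (g n x))\<^sup>2))"
    and s2': "summable (\<lambda>n. sqrt (LINT x|?M. (norm (- laplacian (g n) x))\<^sup>2))"
    using s0 s2 by simp_all
  note S0 = L2_on_series[where g = g, OF L0 s0']
    and S1 = L2_on_series[where g = "\<lambda>n. gradient (g n)", OF L1 s1]
    and S2 = L2_on_series[where g = "\<lambda>n x. - laplacian (g n) x", OF L2 s2']
  show LF: "L2_on \<Omega> ?F" by (rule S2)
  define S where "S n x = (\<Sum>i<n. g i x)" for n x
  have tS: "test_function \<Omega> (S n)" for n
    unfolding S_def by (intro test_function_sum g)
  have gS: "gradient (S n) x = (\<Sum>i<n. gradient (g i) x)" for n x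
    unfolding S_def by (intro gradient_sum test_function_smooth[OF g])
  have H1: "H1_with_gradient \<Omega> ?u ?Du"
    unfolding H1_with_gradient_def
  proof (intro conjI allI impI)
    fix \<phi> :: "'a \<Rightarrow> real" assume \<phi>: "test_function \<Omega> \<phi>"
    have a: "(\<lambda>n. LINT x|?M. (\<Sum>i<n. g i x) *\<^sub>R gradient \<phi> x) \<longlonglongrightarrow> (LINT x|?M. ?u x *\<^sub>R gradient \<phi> x)"
      by (rule S0(3)[OF bounded_bilinear_scaleR L2_on_gradient[OF \<phi> \<Omega>]])
    have b: "(\<lambda>n. LINT x|?M. \<phi> x *\<^sub>R (\<Sum>i<n. gradient (g i) x)) \<longlonglongrightarrow> (LINT x|?M. \<phi> x *\<^sub>R ?Du x)"
      by (rule S1(3)[OF bounded_bilinear.flip[OF bounded_bilinear_scaleR] L2_on_test_function[OF \<phi> \<Omega>]])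
    have c: "(LINT x|?M. (\<Sum>i<n. g i x) *\<^sub>R gradient \<phi> x) = - (LINT x|?M. \<phi> x *\<^sub>R (\<Sum>i<n. gradient (g i) x))" for n
      using test_function_by_parts[OF tS[of n] \<phi> \<Omega>] unfolding gS unfolding S_def .
    show "(LINT x|?M. ?u x *\<^sub>R gradient \<phi> x) = - (LINT x|?M. \<phi> x *\<^sub>R ?Du x)"
      using a unfolding c by (rule LIMSEQ_unique[OF _ tendsto_minus[OF b]])
  qed (rule S0 S1)+
  have H10: "H10_with_gradient \<Omega> ?u ?Du"
    unfolding H10_with_gradient_def
  proof (intro conjI H1 exI[of _ S] allI tS)
    have "(LINT x|?M. (?u x - S n x)\<^sup>2 + (norm (?Du x - gradient (S n) x))\<^sup>2)
       = (LINT x|?M. (norm (?u x - (\<Sum>i<n. g i x)))\<^sup>2) + (LINT x|?M. (norm (?Du x - (\<Sum>i<n. gradient (g i) x)))\<^sup>2)" for n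
    proof -
      have "L2_on \<Omega> (\<lambda>x. ?u x - S n x)" "L2_on \<Omega> (\<lambda>x. ?Du x - gradient (S n) x)"
        by (intro L2_on_diff S0(1) S1(1) L2_on_test_function L2_on_gradient tS \<Omega>)+
      then show ?thesis by (simp add: L2_on_def gS S_def)
    qed
    then show "(\<lambda>n. LINT x|?M. (?u x - S n x)\<^sup>2 + (norm (?Du x - gradient (S n) x))\<^sup>2) \<longlonglongrightarrow> 0"
      using tendsto_add[OF S0(2) S1(2)] by simp
  qed
  show "weak_solution \<Omega> ?F ?u"
    unfolding weak_solution_def
  proof (intro exI[of _ ?Du] conjI H10 allI impI)
    fix v Dv assume "H10_with_gradient \<Omega> v Dv"
    then have v: "H1_with_gradient \<Omega> v Dv" by (simp add: H10_with_gradient_def)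
    then have Lv: "L2_on \<Omega> v" "L2_on \<Omega> Dv" by (auto simp: H1_with_gradient_def)
    have a: "(\<lambda>n. LINT x|?M. (\<Sum>i<n. gradient (g i) x) \<bullet> Dv x) \<longlonglongrightarrow> (LINT x|?M. ?Du x \<bullet> Dv x)"
      by (rule S1(3)[OF bounded_bilinear_inner Lv(2)])
    have b: "(\<lambda>n. LINT x|?M. (\<Sum>i<n. - laplacian (g i) x) * v x) \<longlonglongrightarrow> (LINT x|?M. ?F x * v x)"
      by (rule S2(3)[OF bounded_bilinear_mult Lv(1)])
    have c: "(LINT x|?M. (\<Sum>i<n. gradient (g i) x) \<bullet> Dv x) = (LINT x|?M. (\<Sum>i<n. - laplacian (g i) x) * v x)" for n
    proof -
      have "(LINT x|?M. (\<Sum>i<n. gradient (g i) x) \<bullet> Dv x) = (\<Sum>i<n. LINT x|?M. gradient (g i) x \<bullet> Dv x)"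
        unfolding inner_sum_left by (intro Bochner_Integration.integral_sum L2_on_inner_integrable L1 Lv)
      also have "\<dots> = (\<Sum>i<n. LINT x|?M. (- laplacian (g i) x) * v x)"
        by (intro sum.cong refl laplacian_by_parts g v \<Omega>)
      also have "\<dots> = (LINT x|?M. (\<Sum>i<n. - laplacian (g i) x) * v x)"
        unfolding sum_distrib_right
        by (intro Bochner_Integration.integral_sum[symmetric] L2_on_mult_integrable L2 Lv)
      finally show ?thesis .
    qed
    show "(LINT x|?M. ?Du x \<bullet> Dv x) = (LINT x|?M. ?F x * v x)"
      using a unfolding c by (rule LIMSEQ_unique[OF _ b])
  qed
qed

section \<open>Hausdorff measure and Cantor sets\<close>

text \<open>One parameter bounds the mesh and the total weight at once. Covers of this kind for
  every \<open>\<eta>\<close> force measure 0, and a countable union only requires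
  \<open>\<eta>\<close> to be split geometrically.\<close>

definition small_cover :: "real \<Rightarrow> real \<Rightarrow> 'a::metric_space set \<Rightarrow> bool" where
  "small_cover s \<eta> A \<longleftrightarrow> (\<exists>U :: nat \<Rightarrow> 'a set. A \<subseteq> (\<Union>i. U i) \<and>
     (\<forall>i. bounded (U i) \<and> diameter (U i) \<le> \<eta>) \<and> (\<Sum>i. diam_power s (U i)) \<le> ennreal \<eta>)"

lemma hausdorff_measure_eq_0:
  assumes "\<And>\<eta>. 0 < \<eta> \<Longrightarrow> small_cover s \<eta> A"
  shows "hausdorff_measure s A = 0"
proof -
  have "hausdorff_premeasure s \<delta> A \<le> 0" if "0 < \<delta>" for \<delta>
  proof (rule ennreal_le_epsilon)
    fix e :: real assume "0 < e"
    with that have "0 < min \<delta> e" by simp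
    from assms[OF this] obtain U where U: "A \<subseteq> (\<Union>i. U i)"
      "\<forall>i. bounded (U i) \<and> diameter (U i) \<le> min \<delta> e" "(\<Sum>i. diam_power s (U i)) \<le> ennreal (min \<delta> e)"
      unfolding small_cover_def by blast
    have "hausdorff_premeasure s \<delta> A \<le> (\<Sum>i. diam_power s (U i))"
      unfolding hausdorff_premeasure_def by (rule INF_lower) (use U in auto)
    also have "\<dots> \<le> ennreal e" using U(3) by (meson ennreal_leI min.cobounded2 order_trans)
    finally show "hausdorff_premeasure s \<delta> A \<le> 0 + ennreal e" by simp
  qed
  then have "hausdorff_measure s A \<le> 0"
    unfolding hausdorff_measure_def by (intro SUP_least) auto
  then show ?thesis by simp
qed

lemma small_cover_subset: "small_cover s \<eta> B \<Longrightarrow> A \<subseteq> B \<Longrightarrow> small_cover s \<eta> A"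
  unfolding small_cover_def by (meson subset_trans)

lemma small_cover_UN:
  assumes "\<And>k. small_cover s (\<eta> * (1/2) ^ Suc k) (A k)" and \<eta>: "0 < \<eta>"
  shows "small_cover s \<eta> (\<Union>k. A k)"
proof -
  have "\<exists>U. \<forall>k. A k \<subseteq> (\<Union>i. U k i) \<and> (\<forall>i. bounded (U k i) \<and> diameter (U k i) \<le> \<eta> * (1/2) ^ Suc k)
     \<and> (\<Sum>i. diam_power s (U k i)) \<le> ennreal (\<eta> * (1/2) ^ Suc k)"
    using assms(1) unfolding small_cover_def by (rule choice[OF allI])
  then obtain U where U: "\<And>k. A k \<subseteq> (\<Union>i. U k i)" "\<And>k i. bounded (U k i)"
    "\<And>k i. diameter (U k i) \<le> \<eta> * (1/2) ^ Suc k"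
    "\<And>k. (\<Sum>i. diam_power s (U k i)) \<le> ennreal (\<eta> * (1/2) ^ Suc k)" by blast
  define V where "V n = (case prod_decode n of (k, i) \<Rightarrow> U k i)" for n
  have "(\<Sum>n. diam_power s (V n)) = (\<Sum>n. case prod_decode n of (k, i) \<Rightarrow> diam_power s (U k i))"
    unfolding V_def by (simp add: case_prod_beta)
  also have "\<dots> = (\<Sum>k. \<Sum>i. diam_power s (U k i))"
    by (rule suminf_ennreal_2dimen[of _ "\<lambda>(k, i). diam_power s (U k i)", symmetric, THEN sym]) simp
  also have "\<dots> \<le> (\<Sum>k. ennreal (\<eta> * (1/2) ^ Suc k))"
    using U(4) by (intro suminf_le) auto
  also have "\<dots> = ennreal \<eta>"
    using sums_mult[OF power_half_series, of \<eta>] \<eta> by (intro suminf_ennreal_eq) auto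
  finally have "(\<Sum>n. diam_power s (V n)) \<le> ennreal \<eta>" .
  moreover have "(\<Union>k. A k) \<subseteq> (\<Union>n. V n)"
  proof
    fix x assume "x \<in> (\<Union>k. A k)"
    then obtain k i where "x \<in> U k i" using U(1) by blast
    then have "x \<in> V (prod_encode (k, i))" by (simp add: V_def)
    then show "x \<in> (\<Union>n. V n)" by blast
  qed
  moreover have "bounded (V n) \<and> diameter (V n) \<le> \<eta>" for n
  proof -
    obtain k i where n: "prod_decode n = (k, i)" by force
    have "\<eta> * (1/2) ^ Suc k \<le> \<eta> * 1" using \<eta> by (intro mult_left_mono power_le_one) auto
    then show ?thesis using U(2)[of k i] order_trans[OF U(3)[of k i]] by (simp add: V_def n)
  qed
  ultimately show ?thesis unfolding small_cover_def by blast
qed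

lemma small_cover_finite:
  fixes A :: "'a::euclidean_space set"
  assumes P: "finite P" and A: "A \<subseteq> (\<Union>p\<in>P. cball p e)" and e: "0 < e" and s: "0 < s"
    and c: "real (card P) * (2 * e) powr s \<le> \<eta>" and \<eta>: "2 * e \<le> \<eta>"
  shows "small_cover s \<eta> A"
proof -
  obtain h where h: "bij_betw h {0..<card P} P" using ex_bij_betw_nat_finite[OF P] by blast
  define U where "U i = (if i < card P then cball (h i) e else {})" for i
  have "(\<Sum>i. diam_power s (U i)) = (\<Sum>i<card P. diam_power s (U i))"
    by (rule suminf_finite) (auto simp: U_def diam_power_def)
  also have "\<dots> = (\<Sum>i<card P. ennreal ((2 * e) powr s))"
    using e s by (intro sum.cong) (auto simp: U_def diam_power_def)
  also have "\<dots> = ennreal (real (card P) * (2 * e) powr s)"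
    by (simp add: ennreal_mult ennreal_of_nat_eq_real_of_nat)
  also have "\<dots> \<le> ennreal \<eta>" using c by (rule ennreal_leI)
  finally have "(\<Sum>i. diam_power s (U i)) \<le> ennreal \<eta>" .
  moreover have "A \<subseteq> (\<Union>i. U i)"
  proof
    fix x assume "x \<in> A"
    then obtain p where "p \<in> P" "x \<in> cball p e" using A by blast
    moreover then obtain i where "i < card P" "p = h i" using bij_betw_imp_surj_on[OF h] by force
    ultimately have "x \<in> U i" by (simp add: U_def)
    then show "x \<in> (\<Union>i. U i)" by blast
  qed
  moreover have "bounded (U i) \<and> diameter (U i) \<le> \<eta>" for i
    using e \<eta> by (auto simp: U_def)
  ultimately show ?thesis unfolding small_cover_def by blast
qed

lemma hausdorff_dim_le: "0 \<le> s \<Longrightarrow> hausdorff_measure s A = 0 \<Longrightarrow> hausdorff_dim A \<le> ereal s"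
  unfolding hausdorff_dim_def by (rule INF_lower) auto

text \<open>The hypothesis bounds the Hausdorff content from below, over covers of any mesh. For t <
  s a cover by sets of diameter at most 1 has s-weight at most its t-weight, so the t-premeasure at
  scale 1 is at least c, and the t-dimensional measure is not 0.\<close>

lemma hausdorff_dim_ge:
  fixes A :: "'a::metric_space set"
  assumes c: "0 < c" and s: "0 < s"
    and U: "\<And>U :: nat \<Rightarrow> 'a set. A \<subseteq> (\<Union>i. U i) \<Longrightarrow> (\<And>i. bounded (U i)) \<Longrightarrow>
       ennreal c \<le> (\<Sum>i. diam_power s (U i))"
  shows "ereal s \<le> hausdorff_dim A"
  unfolding hausdorff_dim_def
proof (rule INF_greatest)
  fix t assume "t \<in> {t. 0 \<le> t \<and> hausdorff_measure t A = 0}"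
  then have t: "0 \<le> t" "hausdorff_measure t A = 0" by auto
  show "ereal s \<le> ereal t"
  proof (rule ccontr)
    assume "\<not> ereal s \<le> ereal t"
    then have ts: "t < s" by simp
    have "hausdorff_premeasure t 1 A \<le> hausdorff_measure t A"
      unfolding hausdorff_measure_def by (rule SUP_upper) simp
    then have "hausdorff_premeasure t 1 A < ennreal c" using t c by simp
    then obtain V where V: "A \<subseteq> (\<Union>i. V i)" "\<And>i. bounded (V i)" "\<And>i. diameter (V i) \<le> 1"
      "(\<Sum>i. diam_power t (V i)) < ennreal c"
      unfolding hausdorff_premeasure_def INF_less_iff by blast
    have "diam_power s (V i) \<le> diam_power t (V i)" for i
    \<comment> \<open>Exponent 0 is separate because \<open>diam_power\<close> then gives every
      nonempty set weight 1.\<close>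
    proof (cases "t = 0")
      case True
      then show ?thesis using s V(3)[of i] diameter_ge_0[OF V(2)[of i]]
        by (auto simp: diam_power_def powr_le1)
    next
      case False
      then show ?thesis using s ts V(3)[of i] diameter_ge_0[OF V(2)[of i]]
        by (auto simp: diam_power_def intro!: ennreal_leI powr_mono')
    qed
    then have "(\<Sum>i. diam_power s (V i)) \<le> (\<Sum>i. diam_power t (V i))"
      by (intro suminf_le) auto
    with U[OF V(1,2)] V(4) show False by simp
  qed
qed

section \<open>Cantor sets on the line, parametrised by binary digits\<close>

fun cantor_node :: "real \<Rightarrow> nat \<Rightarrow> nat \<Rightarrow> real" where
  "cantor_node l 0 k = 0"
| "cantor_node l (Suc J) k = cantor_node l J (k div 2) + l ^ J * real (k mod 2)"

definition dyadic_index :: "nat \<Rightarrow> real \<Rightarrow> nat" where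
  "dyadic_index J y = nat \<lfloor>2 ^ J * y\<rfloor>"

text \<open>The binary digits of y read with the weights l^j: for l < 1/2 a right inverse of a
  rescaled Cantor function. Truncation after J digits gives the \<open>cantor_node\<close> with
  index \<open>dyadic_index J y\<close>.\<close>

definition cantor_point :: "real \<Rightarrow> real \<Rightarrow> real" where
  "cantor_point l y = (\<Sum>j. l ^ j * real (dyadic_index (Suc j) y mod 2))"

text \<open>If the parents agree, the last digits differ and contribute l^J at level
  \<open>Suc J\<close>. Otherwise the parents are at least l^J / l \<ge> 2 l^J apart, of which the
  last digits take back at most l^J. The form \<open>l ^ J / l\<close> replaces an exponent J - 1,
  which would be truncated at J = 0.\<close>

lemma cantor_node_separated:
  assumes l: "0 < l" "l \<le> 1/2" and "k < 2 ^ J" "k' < 2 ^ J" "k \<noteq> k'"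
  shows "l ^ J / l \<le> \<bar>cantor_node l J k - cantor_node l J k'\<bar>"
  using assms(3-)
proof (induction J arbitrary: k k')
  case 0
  then show ?case by simp
next
  case (Suc J)
  show ?case
  proof (cases "k div 2 = k' div 2")
    case True
    then have "k mod 2 \<noteq> k' mod 2" using Suc.prems(3) by (metis div_mult_mod_eq)
    then have "\<bar>real (k mod 2) - real (k' mod 2)\<bar> = 1"
      using mod_less_divisor[of 2 k] mod_less_divisor[of 2 k'] by linarith
    then have "\<bar>l ^ J * real (k mod 2) - l ^ J * real (k' mod 2)\<bar> = l ^ J"
      unfolding right_diff_distrib[symmetric] using l by (simp add: abs_mult)
    then show ?thesis using True l by simp
  next
    case False
    have "l ^ J / l \<le> \<bar>cantor_node l J (k div 2) - cantor_node l J (k' div 2)\<bar>"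
      using Suc.prems False by (intro Suc.IH) auto
    moreover have "\<bar>l ^ J * real (k mod 2) - l ^ J * real (k' mod 2)\<bar> \<le> l ^ J"
    proof -
      have "\<bar>real (k mod 2) - real (k' mod 2)\<bar> \<le> 1" by (simp add: abs_if) linarith
      then show ?thesis
        unfolding right_diff_distrib[symmetric] using l by (simp add: abs_mult)
    qed
    moreover have "2 * l ^ J \<le> l ^ J / l"
      using l mult_left_mono[of "2 * l" 1 "l ^ J"] by (simp add: field_simps)
    moreover have "l ^ Suc J / l = l ^ J" using l by simp
    ultimately show ?thesis unfolding cantor_node.simps by linarith
  qed
qed

lemma dyadic_index_div_2: "0 \<le> y \<Longrightarrow> dyadic_index (Suc J) y div 2 = dyadic_index J y"
proof -
  assume y: "0 \<le> y"
  have "\<lfloor>2 ^ Suc J * y\<rfloor> div 2 = \<lfloor>2 ^ Suc J * y / 2\<rfloor>"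
    using floor_divide_real_eq_div[of 2 "2 ^ Suc J * y"] by simp
  then have "nat \<lfloor>2 ^ J * y\<rfloor> = nat (\<lfloor>2 ^ Suc J * y\<rfloor> div 2)" by simp
  then show ?thesis by (simp add: dyadic_index_def nat_div_distrib)
qed

lemma dyadic_index_less: "0 \<le> y \<Longrightarrow> y < 1 \<Longrightarrow> dyadic_index J y < 2 ^ J"
proof -
  assume y: "0 \<le> y" "y < 1"
  then have "2 ^ J * y < 2 ^ J" by simp
  then have "\<lfloor>2 ^ J * y\<rfloor> < 2 ^ J" by (simp add: floor_less_iff)
  then show ?thesis using y by (simp add: dyadic_index_def nat_less_iff)
qed

lemma dyadic_index_differ:
  assumes "0 \<le> y" "0 \<le> z" "(1/2) ^ J \<le> \<bar>y - z\<bar>"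
  shows "dyadic_index J y \<noteq> dyadic_index J z"
proof
  assume "dyadic_index J y = dyadic_index J z"
  then have "\<lfloor>2 ^ J * y\<rfloor> = \<lfloor>2 ^ J * z\<rfloor>" using assms by (simp add: dyadic_index_def nat_eq_iff2)
  then have "\<bar>2 ^ J * y - 2 ^ J * z\<bar> < 1" by linarith
  then have "2 ^ J * \<bar>y - z\<bar> < 1" unfolding right_diff_distrib[symmetric] by (simp add: abs_mult)
  moreover have "1 \<le> 2 ^ J * \<bar>y - z\<bar>"
    using mult_left_mono[OF assms(3), of "2 ^ J"] by (simp add: power_one_over)
  ultimately show False by simp
qed

lemma cantor_node_eq_sum:
  "0 \<le> y \<Longrightarrow> cantor_node l J (dyadic_index J y) = (\<Sum>j<J. l ^ j * real (dyadic_index (Suc j) y mod 2))"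
  by (induction J) (auto simp: dyadic_index_div_2)

lemma cantor_point_bounds:
  assumes l: "0 < l" "l < 1" and y: "0 \<le> y"
  shows "cantor_node l J (dyadic_index J y) \<le> cantor_point l y"
    and "cantor_point l y \<le> cantor_node l J (dyadic_index J y) + l ^ J / (1 - l)"
proof -
  let ?t = "\<lambda>j. l ^ j * real (dyadic_index (Suc j) y mod 2)"
  have t: "0 \<le> ?t j" "?t j \<le> l ^ j" for j using l by (auto simp: mult_left_le)
  have g: "summable (\<lambda>j. l ^ j)" using l by (simp add: summable_geometric)
  have s: "summable ?t" by (rule summable_comparison_test[OF _ g]) (use t in auto)
  have eq: "cantor_point l y = cantor_node l J (dyadic_index J y) + (\<Sum>j. ?t (j + J))"
    unfolding cantor_point_def cantor_node_eq_sum[OF y] using suminf_split_initial_segment[OF s, of J] by simp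
  have "0 \<le> (\<Sum>j. ?t (j + J))"
    using t summable_ignore_initial_segment[OF s, of J] by (intro suminf_nonneg) auto
  then show "cantor_node l J (dyadic_index J y) \<le> cantor_point l y" unfolding eq by simp
  have "(\<Sum>j. ?t (j + J)) \<le> (\<Sum>j. l ^ J * l ^ j)"
  proof (rule suminf_le)
    show "?t (j + J) \<le> l ^ J * l ^ j" for j using t(2)[of "j + J"] by (simp add: power_add mult.commute)
    show "summable (\<lambda>j. ?t (j + J))" by (rule summable_ignore_initial_segment[OF s])
    show "summable (\<lambda>j. l ^ J * l ^ j)" by (intro summable_mult g)
  qed
  also have "\<dots> = l ^ J / (1 - l)"
    using l g by (simp add: suminf_mult suminf_geometric)
  finally show "cantor_point l y \<le> cantor_node l J (dyadic_index J y) + l ^ J / (1 - l)"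
    unfolding eq by simp
qed

lemma power_bracket:
  fixes q d :: real
  assumes "0 < q" "q < 1" "0 < d" "d < 1"
  obtains n where "q ^ Suc n \<le> d" "d < q ^ n"
proof -
  obtain m where "q ^ m < d" using real_arch_pow_inv[OF assms(3,2)] by blast
  then have ex: "\<exists>n. q ^ n \<le> d" by (auto intro: less_imp_le)
  define m where "m = (LEAST n. q ^ n \<le> d)"
  have m: "q ^ m \<le> d" unfolding m_def using ex by (rule LeastI_ex)
  then obtain n where n: "m = Suc n" using assms by (cases m) auto
  have "\<not> q ^ n \<le> d" by (rule not_less_Least) (use n in \<open>simp add: m_def\<close>)
  with m n that[of n] show thesis by simp
qed

text \<open>Let n satisfy 2^(-n-1) \<le> |y - z| < 2^(-n) and put J = n + 1. The dyadic indices at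
  level J differ, so the nodes are l^J / l apart. Both points lie above their nodes by at most l^J /
  (1 - l); as the errors have the same sign, only one of them is lost and \<kappa> l^J remains, with
  \<kappa> > 0 because l < 1/2. Raising to the power \<theta> turns l^J into 2^(-J), and the factor
  2 in the constant undoes the shift from J to n.\<close>

lemma cantor_point_Hoelder:
  assumes l: "0 < l" "l < 1/2" and \<theta>: "0 < \<theta>" "l powr \<theta> = 1/2"
  obtains C where "0 < C" "\<And>y z. 0 \<le> y \<Longrightarrow> y < 1 \<Longrightarrow> 0 \<le> z \<Longrightarrow> z < 1 \<Longrightarrow>
    \<bar>y - z\<bar> \<le> C * \<bar>cantor_point l y - cantor_point l z\<bar> powr \<theta>"
proof -
  define \<kappa> where "\<kappa> = 1 / l - 1 / (1 - l)"
  have \<kappa>: "0 < \<kappa>" unfolding \<kappa>_def using l by (simp add: field_simps)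
  have "\<bar>y - z\<bar> \<le> 2 / \<kappa> powr \<theta> * \<bar>cantor_point l y - cantor_point l z\<bar> powr \<theta>"
    if y: "0 \<le> y" "y < 1" and z: "0 \<le> z" "z < 1" for y z
  proof (cases "y = z")
    case False
    then have "0 < \<bar>y - z\<bar>" "\<bar>y - z\<bar> < 1" using y z by auto
    then obtain n where n: "(1/2) ^ Suc n \<le> \<bar>y - z\<bar>" "\<bar>y - z\<bar> < (1/2) ^ n"
      using power_bracket[of "1/2" "\<bar>y - z\<bar>"] by auto
    let ?J = "Suc n"
    have "l ^ ?J / l \<le> \<bar>cantor_node l ?J (dyadic_index ?J y) - cantor_node l ?J (dyadic_index ?J z)\<bar>"
      using l y z dyadic_index_differ[OF y(1) z(1) n(1)]
      by (intro cantor_node_separated dyadic_index_less) auto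
    moreover have "cantor_node l ?J (dyadic_index ?J y) \<le> cantor_point l y"
      "cantor_point l y \<le> cantor_node l ?J (dyadic_index ?J y) + l ^ ?J / (1 - l)"
      "cantor_node l ?J (dyadic_index ?J z) \<le> cantor_point l z"
      "cantor_point l z \<le> cantor_node l ?J (dyadic_index ?J z) + l ^ ?J / (1 - l)"
      using l y z by (intro cantor_point_bounds; simp)+
    ultimately have "l ^ ?J / l - l ^ ?J / (1 - l) \<le> \<bar>cantor_point l y - cantor_point l z\<bar>"
      by linarith
    then have "\<kappa> * l ^ ?J \<le> \<bar>cantor_point l y - cantor_point l z\<bar>"
      unfolding \<kappa>_def by (simp add: left_diff_distrib)
    then have "(\<kappa> * l ^ ?J) powr \<theta> \<le> \<bar>cantor_point l y - cantor_point l z\<bar> powr \<theta>"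
      using \<kappa> l \<theta> by (intro powr_mono2) auto
    moreover have "(\<kappa> * l ^ ?J) powr \<theta> = \<kappa> powr \<theta> * (1/2) ^ ?J"
    proof -
      have "(l ^ ?J) powr \<theta> = (l powr \<theta>) ^ ?J"
        using l by (simp add: powr_power powr_realpow[symmetric] powr_powr mult.commute del: power_Suc)
      then show ?thesis using \<kappa> l \<theta> by (simp add: powr_mult del: power_Suc)
    qed
    ultimately have "\<kappa> powr \<theta> * ((1/2) ^ n / 2) \<le> \<bar>cantor_point l y - cantor_point l z\<bar> powr \<theta>" by simp
    then have "(1/2) ^ n \<le> 2 / \<kappa> powr \<theta> * \<bar>cantor_point l y - cantor_point l z\<bar> powr \<theta>"
      using \<kappa> by (simp add: field_simps)
    with n(2) show ?thesis by linarith
  qed simp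
  then show thesis using \<kappa> by (intro that[of "2 / \<kappa> powr \<theta>"]) auto
qed

section \<open>Separated points and the Cantor dust in N dimensions\<close>

lemma packing_bound:
  fixes x :: "'a::euclidean_space"
  assumes P: "finite P" "P \<subseteq> cball x T" and t: "0 < t" "0 \<le> T"
    and sep: "\<And>p q. p \<in> P \<Longrightarrow> q \<in> P \<Longrightarrow> p \<noteq> q \<Longrightarrow> t \<le> dist p q"
  shows "real (card P) \<le> (1 + 2 * T / t) ^ DIM('a)"
proof -
  let ?N = "DIM('a)" and ?V = "unit_ball_vol (real DIM('a))"
  have disj: "disjoint_family_on (\<lambda>p. ball p (t/2)) P"
    unfolding disjoint_family_on_def
  proof (intro ballI impI)
    fix p q assume *: "p \<in> P" "q \<in> P" "p \<noteq> q"
    have False if "z \<in> ball p (t/2)" "z \<in> ball q (t/2)" for z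
      using that sep[OF *] dist_triangle[of p q z] by (simp add: dist_commute)
    then show "ball p (t/2) \<inter> ball q (t/2) = {}" by blast
  qed
  have fin: "emeasure lborel (ball p r) \<noteq> \<infinity>" for p :: 'a and r
    using emeasure_bounded_finite[of "ball p r"] by auto
  have V: "0 < ?V" by simp
  have "real (card P) * (?V * (t/2) ^ ?N) = (\<Sum>p\<in>P. measure lborel (ball p (t/2)))"
    using t by (simp add: content_ball)
  also have "\<dots> = measure lborel (\<Union>p\<in>P. ball p (t/2))"
    using P disj by (intro measure_finite_Union[symmetric]) (auto simp: fin[simplified])
  also have "\<dots> \<le> measure lborel (ball x (T + t/2))"
  proof (rule measure_mono_fmeasurable)
    show "(\<Union>p\<in>P. ball p (t/2)) \<subseteq> ball x (T + t/2)"
    proof clarify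
      fix p z assume "p \<in> P" "z \<in> ball p (t/2)"
      then show "z \<in> ball x (T + t/2)" using P(2) dist_triangle[of x z p] by auto
    qed
    show "(\<Union>p\<in>P. ball p (t/2)) \<in> sets lborel" by (auto intro!: borel_open open_UN)
    show "ball x (T + t/2) \<in> fmeasurable lborel"
      by (intro fmeasurableI emeasure_bounded_finite) auto
  qed
  also have "\<dots> = ?V * (T + t/2) ^ ?N" using t by (simp add: content_ball)
  finally have "real (card P) * (t/2) ^ ?N \<le> (T + t/2) ^ ?N"
    using V by (simp add: mult.left_commute)
  then have "real (card P) \<le> (T + t/2) ^ ?N / (t/2) ^ ?N"
    using t by (simp add: pos_le_divide_eq)
  also have "\<dots> = ((T + t/2) / (t/2)) ^ ?N" by (rule power_divide[symmetric])
  also have "(T + t/2) / (t/2) = 1 + 2 * T / t" using t by (simp add: field_simps)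
  finally show ?thesis .
qed

lemma dist_le_of_coordinates:
  fixes p q :: "'a::euclidean_space" and t :: real
  assumes "\<And>b. b \<in> Basis \<Longrightarrow> \<bar>p \<bullet> b - q \<bullet> b\<bar> \<le> t"
  shows "dist p q \<le> DIM('a) * t"
proof -
  have "dist p q \<le> (\<Sum>b\<in>Basis. \<bar>(p - q) \<bullet> b\<bar>)" unfolding dist_norm by (rule norm_le_l1)
  also have "\<dots> \<le> (\<Sum>b\<in>(Basis :: 'a set). t)" using assms by (intro sum_mono) (simp add: inner_diff_left)
  finally show ?thesis by simp
qed

text \<open>A product of N linear Cantor sets. Each generation replaces a piece by 2^N copies scaled
  by l, and \<open>ls\<close> says 2^N l^s = 1, so s is the similarity dimension. The factor \<rho>
  serves to fit the set into a prescribed ball.\<close>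

locale cantor_dust =
  fixes x0 :: "'a::euclidean_space" and \<rho> l s :: real
  assumes \<rho>: "0 < \<rho>" and l: "0 < l" "l < 1/2" and s: "0 < s" and ls: "l powr s = (1/2) ^ DIM('a)"
begin

definition node :: "nat \<Rightarrow> ('a \<Rightarrow> nat) \<Rightarrow> 'a" where
  "node J k = x0 + \<rho> *\<^sub>R (\<Sum>b\<in>Basis. cantor_node l J (k b) *\<^sub>R b)"

definition nodes :: "nat \<Rightarrow> 'a set" where
  "nodes J = node J ` (Basis \<rightarrow>\<^sub>E {..<2 ^ J})"

definition dust_point :: "'a \<Rightarrow> 'a" where
  "dust_point y = x0 + \<rho> *\<^sub>R (\<Sum>b\<in>Basis. cantor_point l (y \<bullet> b) *\<^sub>R b)"

definition unit_cube :: "'a set" where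
  "unit_cube = {y. \<forall>b\<in>Basis. 0 \<le> y \<bullet> b \<and> y \<bullet> b < 1}"

definition dust :: "'a set" where
  "dust = dust_point ` unit_cube"

text \<open>A dust point differs from its node by at most \<rho> l^J / (1 - l) \<le> 2 \<rho> l^J in
  each coordinate; the factor \<open>DIM('a)\<close> passes from coordinates to the Euclidean
  distance.\<close>

definition eps :: "nat \<Rightarrow> real" where
  "eps J = 2 * DIM('a) * \<rho> * l ^ J"

text \<open>The radius is that of the support of a bump rescaled by \<open>eps J\<close>.\<close>

definition nbhd :: "nat \<Rightarrow> 'a set" where
  "nbhd J = (\<Union>p\<in>nodes J. cball p (3 * eps J))"

lemma eps_pos: "0 < eps J"
  using \<rho> l by (simp add: eps_def)

lemma finite_nodes: "finite (nodes J)"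
  unfolding nodes_def by (intro finite_imageI finite_PiE) auto

lemma card_nodes: "card (nodes J) \<le> (2 ^ J) ^ DIM('a)"
proof -
  have "card (nodes J) \<le> card ((Basis :: 'a set) \<rightarrow>\<^sub>E {..<2 ^ J :: nat})"
    unfolding nodes_def by (intro card_image_le finite_PiE) auto
  then show ?thesis by (simp add: card_PiE)
qed

lemma nodes_0: "nodes 0 = {x0}"
  by (simp add: nodes_def node_def image_constant_conv PiE_eq_empty_iff lessThan_Suc)

lemma node_inner: "b \<in> Basis \<Longrightarrow> node J k \<bullet> b = x0 \<bullet> b + \<rho> * cantor_node l J (k b)"
  by (simp add: node_def inner_add_left)

lemma dust_point_inner: "b \<in> Basis \<Longrightarrow> dust_point y \<bullet> b = x0 \<bullet> b + \<rho> * cantor_point l (y \<bullet> b)"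
  by (simp add: dust_point_def inner_add_left)

lemma nodes_separated:
  assumes "p \<in> nodes J" "q \<in> nodes J" "p \<noteq> q"
  shows "\<rho> * l ^ J \<le> dist p q"
proof -
  obtain k k' where k: "k \<in> Basis \<rightarrow>\<^sub>E {..<2 ^ J}" "p = node J k" "k' \<in> Basis \<rightarrow>\<^sub>E {..<2 ^ J}" "q = node J k'"
    using assms by (auto simp: nodes_def)
  with assms(3) have "k \<noteq> k'" by auto
  then obtain b where b: "b \<in> Basis" "k b \<noteq> k' b"
    using PiE_ext[OF k(1,3)] by blast
  have "k b < 2 ^ J" "k' b < 2 ^ J" using k b by (auto simp: PiE_iff)
  then have "l ^ J / l \<le> \<bar>cantor_node l J (k b) - cantor_node l J (k' b)\<bar>"
    using l b by (intro cantor_node_separated) auto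
  moreover have "l ^ J \<le> l ^ J / l" using l by (simp add: le_divide_eq mult_left_le)
  ultimately have "\<rho> * l ^ J \<le> \<rho> * \<bar>cantor_node l J (k b) - cantor_node l J (k' b)\<bar>"
    using \<rho> by (intro mult_left_mono) auto
  also have "\<dots> = \<bar>(p - q) \<bullet> b\<bar>"
    using b \<rho> by (simp add: k inner_diff_left node_inner abs_mult right_diff_distrib[symmetric])
  also have "\<dots> \<le> dist p q" unfolding dist_norm using b by (intro Basis_le_norm)
  finally show ?thesis .
qed

text \<open>Nodes are \<open>\<rho> * l ^ J\<close> apart and the radius is a fixed multiple of this
  distance, so the packing bound does not depend on J. It keeps a sum of rescaled bumps comparable
  to a single one.\<close>

lemma nodes_overlap:
  "real (card {p \<in> nodes J. dist x p \<le> 3 * eps J}) \<le> (1 + 12 * real DIM('a)) ^ DIM('a)"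
proof -
  have "real (card {p \<in> nodes J. dist x p \<le> 3 * eps J}) \<le> (1 + 2 * (3 * eps J) / (\<rho> * l ^ J)) ^ DIM('a)"
    using finite_nodes eps_pos[of J] \<rho> l nodes_separated by (intro packing_bound) auto
  also have "2 * (3 * eps J) / (\<rho> * l ^ J) = 12 * DIM('a)"
    using \<rho> l by (simp add: eps_def)
  finally show ?thesis by simp
qed

lemma nodes_parent:
  assumes "p \<in> nodes (Suc J)"
  obtains q where "q \<in> nodes J" "dist p q \<le> DIM('a) * (\<rho> * l ^ J)"
proof -
  obtain k where k: "k \<in> Basis \<rightarrow>\<^sub>E {..<2 ^ Suc J}" "p = node (Suc J) k"
    using assms by (auto simp: nodes_def)
  let ?k = "restrict (\<lambda>b. k b div 2) Basis"
  have "k b < 2 * 2 ^ J" if "b \<in> Basis" for b using k(1) that by (auto simp: PiE_iff)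
  then have "node J ?k \<in> nodes J"
    unfolding nodes_def by (intro imageI) (auto intro!: less_mult_imp_div_less simp: mult.commute)
  moreover have "dist p (node J ?k) \<le> DIM('a) * (\<rho> * l ^ J)"
  proof (rule dist_le_of_coordinates)
    fix b :: 'a assume b: "b \<in> Basis"
    have "\<bar>p \<bullet> b - node J ?k \<bullet> b\<bar> = \<rho> * (l ^ J * real (k b mod 2))"
      using b \<rho> l by (simp add: k node_inner algebra_simps abs_mult)
    also have "\<dots> \<le> \<rho> * l ^ J" using \<rho> l by (intro mult_left_mono mult_left_le) auto
    finally show "\<bar>p \<bullet> b - node J ?k \<bullet> b\<bar> \<le> \<rho> * l ^ J" .
  qed
  ultimately show thesis by (rule that)
qed

text \<open>A parent is within eps J / 2, and 3 eps (J + 1) \<le> (3/2) eps J because l < 1/2, so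
  the child's ball stays within 2 eps J of the parent.\<close>

lemma nbhd_Suc: "nbhd (Suc J) \<subseteq> nbhd J"
proof
  fix x assume "x \<in> nbhd (Suc J)"
  then obtain p where p: "p \<in> nodes (Suc J)" "dist p x \<le> 3 * eps (Suc J)" by (auto simp: nbhd_def)
  obtain q where q: "q \<in> nodes J" "dist p q \<le> DIM('a) * (\<rho> * l ^ J)" by (rule nodes_parent[OF p(1)])
  let ?c = "DIM('a) * (\<rho> * l ^ J)"
  have c: "0 \<le> ?c" using \<rho> l by simp
  have "3 * eps (Suc J) = 6 * (l * ?c)" by (simp add: eps_def)
  also have "\<dots> \<le> 6 * (1/2 * ?c)" using c l by (intro mult_left_mono mult_right_mono) auto
  finally have "3 * eps (Suc J) \<le> 3 * ?c" by (simp add: mult_ac)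
  then have "dist q x \<le> 3 * ?c + ?c"
    using dist_triangle[of q x p] p(2) q(2) dist_commute[of p q] by linarith
  also have "\<dots> \<le> 3 * eps J" using c by (simp add: eps_def mult_ac)
  finally show "x \<in> nbhd J" using q by (auto simp: nbhd_def)
qed

lemma nbhd_antimono: "i \<le> j \<Longrightarrow> nbhd j \<subseteq> nbhd i"
  by (rule lift_Suc_antimono_le) (rule nbhd_Suc)

lemma compact_nbhd: "compact (nbhd J)"
  unfolding nbhd_def using finite_nodes by (intro compact_UN) auto

lemma dust_near_nodes:
  assumes "a \<in> dust"
  obtains p where "p \<in> nodes J" "dist p a \<le> eps J"
proof -
  obtain y where y: "y \<in> unit_cube" "a = dust_point y" using assms by (auto simp: dust_def)
  let ?k = "restrict (\<lambda>b. dyadic_index J (y \<bullet> b)) Basis"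
  have "node J ?k \<in> nodes J"
    unfolding nodes_def using y by (intro imageI) (auto simp: unit_cube_def dyadic_index_less)
  moreover have "dist (node J ?k) a \<le> DIM('a) * (\<rho> * (l ^ J / (1 - l)))"
  proof (rule dist_le_of_coordinates)
    fix b :: 'a assume b: "b \<in> Basis"
    then have y0: "0 \<le> y \<bullet> b" using y by (auto simp: unit_cube_def)
    have "\<bar>node J ?k \<bullet> b - a \<bullet> b\<bar> = \<rho> * \<bar>cantor_node l J (dyadic_index J (y \<bullet> b)) - cantor_point l (y \<bullet> b)\<bar>"
      using b \<rho> by (simp add: y node_inner dust_point_inner abs_mult right_diff_distrib[symmetric])
    also have "\<dots> \<le> \<rho> * (l ^ J / (1 - l))"
    proof (rule mult_left_mono)
      have l1: "l < 1" using l by simp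
      show "\<bar>cantor_node l J (dyadic_index J (y \<bullet> b)) - cantor_point l (y \<bullet> b)\<bar> \<le> l ^ J / (1 - l)"
        using cantor_point_bounds[OF l(1) l1 y0, of J] by linarith
    qed (use \<rho> in simp)
    finally show "\<bar>node J ?k \<bullet> b - a \<bullet> b\<bar> \<le> \<rho> * (l ^ J / (1 - l))" .
  qed
  moreover have "DIM('a) * (\<rho> * (l ^ J / (1 - l))) \<le> DIM('a) * (\<rho> * (2 * l ^ J))"
  proof (intro mult_left_mono)
    show "l ^ J / (1 - l) \<le> 2 * l ^ J"
      using l mult_left_mono[of 1 "2 * (1 - l)" "l ^ J"] by (simp add: divide_le_eq algebra_simps)
  qed (use \<rho> in auto)
  ultimately show thesis by (intro that) (auto simp: eps_def algebra_simps)
qed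

text \<open>
  Since the inverse of the parametrisation is Hoelder continuous with exponent \<open>s / N\<close>, a cover of
  the Cantor dust pulls back to a cover of the unit cube by boxes of volume proportional
  to the \<open>s\<close>-th powers of the diameters.
\<close>

lemma dust_dim: "ereal s \<le> hausdorff_dim dust"
proof -
  let ?N = "DIM('a)"
  \<comment> \<open>With this exponent l^\<theta> = 1/2, and a box with sides of order diam^\<theta>
    has volume of order diam^s.\<close>
  define \<theta> where "\<theta> = s / ?N"
  have \<theta>: "0 < \<theta>" using s by (simp add: \<theta>_def)
  have "(l powr \<theta>) ^ ?N = (1/2) ^ ?N"
    using l ls by (simp add: \<theta>_def powr_power)
  then have l\<theta>: "l powr \<theta> = 1/2"
    by (rule power_eq_imp_eq_base) auto
  obtain C where C: "0 < C" "\<And>y z. 0 \<le> y \<Longrightarrow> y < 1 \<Longrightarrow> 0 \<le> z \<Longrightarrow> z < 1 \<Longrightarrow>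
    \<bar>y - z\<bar> \<le> C * \<bar>cantor_point l y - cantor_point l z\<bar> powr \<theta>"
    using cantor_point_Hoelder[OF l \<theta> l\<theta>] by blast
  define D where "D = C * (1 / \<rho>) powr \<theta>"
  have D: "0 < D" using C \<rho> by (simp add: D_def)
  have hoelder: "\<bar>y \<bullet> b - z \<bullet> b\<bar> \<le> D * d powr \<theta>"
    if "y \<in> unit_cube" "z \<in> unit_cube" "b \<in> Basis" "dist (dust_point y) (dust_point z) \<le> d" for y z b d
  proof -
    have "\<rho> * \<bar>cantor_point l (y \<bullet> b) - cantor_point l (z \<bullet> b)\<bar> = \<bar>(dust_point y - dust_point z) \<bullet> b\<bar>"
      using that \<rho> by (simp add: inner_diff_left dust_point_inner abs_mult right_diff_distrib[symmetric])
    also have "\<dots> \<le> d" using Basis_le_norm[OF that(3), of "dust_point y - dust_point z"] that(4)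
      by (simp add: dist_norm)
    finally have "\<bar>cantor_point l (y \<bullet> b) - cantor_point l (z \<bullet> b)\<bar> \<le> 1 / \<rho> * d"
      using \<rho> by (simp add: field_simps)
    then have "\<bar>cantor_point l (y \<bullet> b) - cantor_point l (z \<bullet> b)\<bar> powr \<theta> \<le> (1 / \<rho> * d) powr \<theta>"
      using \<theta> by (intro powr_mono2) auto
    also have "\<dots> = (1 / \<rho>) powr \<theta> * d powr \<theta>" using \<rho>
      using that(4) zero_le_dist[of "dust_point y" "dust_point z"] by (intro powr_mult)
    finally have "C * \<bar>cantor_point l (y \<bullet> b) - cantor_point l (z \<bullet> b)\<bar> powr \<theta> \<le> D * d powr \<theta>"
      using C by (simp add: D_def mult.assoc)
    moreover have "\<bar>y \<bullet> b - z \<bullet> b\<bar> \<le> C * \<bar>cantor_point l (y \<bullet> b) - cantor_point l (z \<bullet> b)\<bar> powr \<theta>"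
      using that by (intro C(2)) (auto simp: unit_cube_def)
    ultimately show ?thesis by linarith
  qed
  show ?thesis
  \<comment> \<open>A box of half side D diam^\<theta> has volume (2 D)^N diam^s, and the boxes
    pulled back from a cover of the dust must cover an open cube of volume 1.\<close>
  proof (rule hausdorff_dim_ge[of "1 / (2 * D) ^ ?N"])
    fix U :: "nat \<Rightarrow> 'a set"
    assume U: "dust \<subseteq> (\<Union>i. U i)" "\<And>i. bounded (U i)"
    define T where "T i = {y \<in> unit_cube. dust_point y \<in> U i}" for i
    define y where "y i = (SOME y. y \<in> T i)" for i
    define w where "w i = D * diameter (U i) powr \<theta>" for i
    define Q where "Q i = (if T i = {} then {} else cbox (y i - w i *\<^sub>R One) (y i + w i *\<^sub>R One))" for i
    have w: "0 \<le> w i" for i using D by (simp add: w_def)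
    have TQ: "T i \<subseteq> Q i" for i
    proof
      fix z assume z: "z \<in> T i"
      then have yi: "y i \<in> T i" unfolding y_def by (rule someI)
      have "\<bar>y i \<bullet> b - z \<bullet> b\<bar> \<le> w i" if b: "b \<in> Basis" for b
        unfolding w_def
      proof (rule hoelder)
        show "dist (dust_point (y i)) (dust_point z) \<le> diameter (U i)"
          using z yi by (intro diameter_bounded_bound U) (auto simp: T_def)
      qed (use z yi b in \<open>auto simp: T_def\<close>)
      then have "z \<in> cbox (y i - w i *\<^sub>R One) (y i + w i *\<^sub>R One)"
        by (fastforce simp: mem_box inner_diff_left inner_add_left abs_le_iff)
      then show "z \<in> Q i" using z by (auto simp: Q_def)
    qed
    have "box 0 One \<subseteq> (\<Union>i. Q i)"
    proof
      fix z :: 'a assume "z \<in> box 0 One"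
      then have "z \<in> unit_cube" by (auto simp: unit_cube_def mem_box less_imp_le)
      then obtain i where "z \<in> T i" using U(1) by (auto simp: dust_def T_def)
      then show "z \<in> (\<Union>i. Q i)" using TQ by blast
    qed
    then have "emeasure lborel (box 0 One :: 'a set) \<le> emeasure lborel (\<Union>i. Q i)"
      by (intro emeasure_mono) (auto simp: Q_def)
    also have "\<dots> \<le> (\<Sum>i. emeasure lborel (Q i))"
      by (intro emeasure_subadditive_countably) (auto simp: Q_def)
    also have "\<dots> \<le> (\<Sum>i. ennreal ((2 * D) ^ ?N) * diam_power s (U i))"
    proof (rule suminf_le)
      fix i
      show "emeasure lborel (Q i) \<le> ennreal ((2 * D) ^ ?N) * diam_power s (U i)"
      proof (cases "T i = {}")
        case False
        then have "U i \<noteq> {}" by (auto simp: T_def)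
        have "emeasure lborel (Q i) = ennreal (\<Prod>b\<in>(Basis::'a set). 2 * w i)"
          using False w[of i] unfolding Q_def
          by (simp add: inner_diff_left inner_add_left algebra_simps emeasure_lborel_cbox)
        also have "(\<Prod>b\<in>(Basis::'a set). 2 * w i) = (2 * D) ^ ?N * (diameter (U i) powr \<theta>) ^ ?N"
          by (simp add: w_def power_mult_distrib mult.assoc)
        also have "(diameter (U i) powr \<theta>) ^ ?N = diameter (U i) powr s"
          by (cases "diameter (U i) = 0") (auto simp: \<theta>_def powr_power)
        finally show ?thesis
          using \<open>U i \<noteq> {}\<close> s D by (simp add: diam_power_def ennreal_mult)
      qed (simp add: Q_def)
    qed auto
    also have "\<dots> = ennreal ((2 * D) ^ ?N) * (\<Sum>i. diam_power s (U i))"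
      by (rule ennreal_suminf_cmult)
    finally have "1 \<le> ennreal ((2 * D) ^ ?N) * (\<Sum>i. diam_power s (U i))"
      by (simp add: emeasure_lborel_box_eq inner_diff_left)
    then have "ennreal (1 / (2 * D) ^ ?N) * 1
        \<le> ennreal (1 / (2 * D) ^ ?N) * (ennreal ((2 * D) ^ ?N) * (\<Sum>i. diam_power s (U i)))"
      by (rule mult_left_mono) simp
    also have "\<dots> = (\<Sum>i. diam_power s (U i))"
    proof -
      have "ennreal (1 / (2 * D) ^ ?N) * ennreal ((2 * D) ^ ?N) = ennreal (1 / (2 * D) ^ ?N * (2 * D) ^ ?N)"
        using D by (intro ennreal_mult[symmetric]) auto
      also have "\<dots> = 1" using D by simp
      finally show ?thesis by (simp only: mult.assoc[symmetric] mult_1_left)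
    qed
    finally show "ennreal (1 / (2 * D) ^ ?N) \<le> (\<Sum>i. diam_power s (U i))" by simp
  qed (use D s in auto)
qed

end

section \<open>Singular building blocks\<close>

lemma bump_derivatives_bounded:
  obtains B :: real where "0 < B" "\<And>x :: 'a::euclidean_space. \<bar>bump x\<bar> \<le> B"
    "\<And>b x. b \<in> (Basis :: 'a set) \<Longrightarrow> \<bar>dir bump b x\<bar> \<le> B"
    "\<And>b x. b \<in> (Basis :: 'a set) \<Longrightarrow> \<bar>dir (dir bump b) b x\<bar> \<le> B"
proof -
  define F where "F = insert bump ((\<lambda>b. dir bump b) ` Basis \<union> (\<lambda>b. dir (dir bump b) b) ` (Basis :: 'a set))"
  have cl: "closed (cball (0::'a) 3)" by simp
  have z0: "bump x = 0" if "x \<notin> cball (0::'a) 3" for x using that by (intro bump_eq_0) simp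
  have z1: "dir bump b x = 0" if "x \<notin> cball (0::'a) 3" for x b
    by (rule dir_eq_0_outside[OF cl z0 that])
  have z2: "dir (dir bump b) b x = 0" if "x \<notin> cball (0::'a) 3" for x b
    by (rule dir_eq_0_outside[OF cl z1 that])
  have "\<exists>B>0. \<forall>x. \<bar>f x\<bar> \<le> B" if "f \<in> F" for f
  proof -
    have "smooth f" using that smooth_bump smooth_dir unfolding F_def by blast
    moreover have "f x = 0" if "x \<notin> cball 0 3" for x
      using \<open>f \<in> F\<close> z0[OF that] z1[OF that] z2[OF that] unfolding F_def by blast
    ultimately show ?thesis
      using compact_support_bounded[of f "cball 0 3"] by (metis compact_cball)
  qed
  then have "\<exists>g. \<forall>f\<in>F. 0 < g f \<and> (\<forall>x. \<bar>f x\<bar> \<le> g f)" by (intro bchoice) blast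
  then obtain g where g: "\<And>f. f \<in> F \<Longrightarrow> 0 < g f" "\<And>f x. f \<in> F \<Longrightarrow> \<bar>f x\<bar> \<le> g f" by blast
  have fin: "finite F" by (simp add: F_def)
  have B: "g f \<le> sum g F" if "f \<in> F" for f
    by (rule member_le_sum[OF that _ fin]) (simp add: g(1) less_imp_le)
  have *: "\<bar>f x\<bar> \<le> sum g F" if "f \<in> F" for f x
    using g(2)[OF that, of x] B[OF that] by linarith
  have mem: "bump \<in> F" "\<And>b. b \<in> Basis \<Longrightarrow> dir bump b \<in> F"
    "\<And>b. b \<in> Basis \<Longrightarrow> dir (dir bump b) b \<in> F"
    unfolding F_def by blast+
  show thesis
  proof (rule that)
    show "0 < sum g F" using g(1)[OF mem(1)] B[OF mem(1)] by linarith
  qed (intro * mem; assumption?)+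
qed

text \<open>A plain sum of bumps in place of a normalised cutoff. It is visibly smooth, is at least
  1 near P, and is bounded as soon as the overlap of the supports is.\<close>

definition patch :: "'a::euclidean_space set \<Rightarrow> real \<Rightarrow> 'a \<Rightarrow> real" where
  "patch P e x = (\<Sum>p\<in>P. bump ((1 / e) *\<^sub>R (x - p)))"

lemma smooth_patch: "smooth (patch P e)"
  unfolding patch_def[abs_def] by (intro smooth_sum smooth_rescale smooth_bump)

lemma patch_nonneg: "0 \<le> patch P e x"
  unfolding patch_def by (intro sum_nonneg bump_nonneg)

lemma patch_ge_1:
  assumes "finite P" "p \<in> P" "0 < e" "dist x p \<le> 2 * e"
  shows "1 \<le> patch P e x"
proof -
  have "1 \<le> bump ((1 / e) *\<^sub>R (x - p))"
    using assms by (intro bump_ge_1) (simp add: dist_norm divide_le_eq)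
  also have "\<dots> \<le> patch P e x"
    unfolding patch_def using assms by (intro member_le_sum) (auto simp: bump_nonneg)
  finally show ?thesis .
qed

lemma patch_eq_0:
  assumes "0 < e" "x \<notin> (\<Union>p\<in>P. cball p (3 * e))"
  shows "patch P e x = 0"
  unfolding patch_def
proof (intro sum.neutral ballI bump_eq_0)
  fix p assume "p \<in> P"
  then have "3 * e < dist x p" using assms(2) by (auto simp: dist_commute not_le)
  then show "3 \<le> norm ((1 / e) *\<^sub>R (x - p))" using assms(1) by (simp add: dist_norm le_divide_eq)
qed

text \<open>Only points of P within distance 3 e of x contribute. A general f is allowed in order to
  treat the bump and its derivatives alike.\<close>

lemma rescaled_sum_bound:
  fixes f :: "'a::euclidean_space \<Rightarrow> real"
  assumes P: "finite P" and e: "0 < e" and M: "real (card {p \<in> P. dist x p \<le> 3 * e}) \<le> M"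
    and B: "0 \<le> B" "\<And>x. \<bar>f x\<bar> \<le> B" and f0: "\<And>x. x \<notin> cball 0 3 \<Longrightarrow> f x = 0"
  shows "\<bar>\<Sum>p\<in>P. f ((1 / e) *\<^sub>R (x - p))\<bar> \<le> M * B"
proof -
  let ?Q = "{p \<in> P. dist x p \<le> 3 * e}"
  have "f ((1 / e) *\<^sub>R (x - p)) = 0" if "p \<in> P - ?Q" for p
    using that e by (intro f0) (auto simp: dist_norm divide_le_eq)
  then have "(\<Sum>p\<in>P. f ((1 / e) *\<^sub>R (x - p))) = (\<Sum>p\<in>?Q. f ((1 / e) *\<^sub>R (x - p)))"
    using P by (intro sum.mono_neutral_right) auto
  also have "\<bar>\<dots>\<bar> \<le> (\<Sum>p\<in>?Q. B)"
    by (rule order_trans[OF sum_abs]) (intro sum_mono B)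
  also have "\<dots> = real (card ?Q) * B" by simp
  also have "\<dots> \<le> M * B" using M B by (intro mult_right_mono)
  finally show ?thesis .
qed

lemma norm_gradient_le: "norm (gradient f x) \<le> (\<Sum>b\<in>Basis. \<bar>dir f b x\<bar>)"
  using norm_le_l1[of "gradient f x"] by (simp add: gradient_inner_Basis)

lemma dir_patch: "dir (patch P e) b = (\<lambda>x. 1 / e * (\<Sum>p\<in>P. dir bump b ((1 / e) *\<^sub>R (x - p))))"
proof
  fix x
  have "dir (patch P e) b x = (\<Sum>p\<in>P. dir (\<lambda>x. bump ((1 / e) *\<^sub>R (x - p))) b x)"
    unfolding patch_def[abs_def] by (intro dir_sum dir_rescale(2) smooth_bump)
  then show "dir (patch P e) b x = 1 / e * (\<Sum>p\<in>P. dir bump b ((1 / e) *\<^sub>R (x - p)))"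
    by (simp add: dir_rescale(1)[OF smooth_bump] sum_distrib_left)
qed

lemma dir_dir_patch:
  "dir (dir (patch P e) b) b x = (1 / e)\<^sup>2 * (\<Sum>p\<in>P. dir (dir bump b) b ((1 / e) *\<^sub>R (x - p)))"
proof -
  have s: "smooth (dir bump b)" by (rule smooth_dir[OF smooth_bump])
  have "dir (dir (patch P e) b) b x = 1 / e * dir (\<lambda>x. \<Sum>p\<in>P. dir bump b ((1 / e) *\<^sub>R (x - p))) b x"
    unfolding dir_patch by (intro dir_cmult smooth_differentiable smooth_sum smooth_rescale s)
  also have "dir (\<lambda>x. \<Sum>p\<in>P. dir bump b ((1 / e) *\<^sub>R (x - p))) b x
      = (\<Sum>p\<in>P. dir (\<lambda>x. dir bump b ((1 / e) *\<^sub>R (x - p))) b x)"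
    by (intro dir_sum dir_rescale(2) s)
  finally show ?thesis
    by (simp add: dir_rescale(1)[OF s] sum_distrib_left power2_eq_square)
qed

text \<open>Rescaling costs 1/e per derivative. As e \<le> 1, the majorant of order 1/e^2 for second
  derivatives serves all three quantities; the factor \<open>DIM('a)\<close> comes from summing over
  the coordinate directions.\<close>

lemma patch_bounds:
  fixes P :: "'a::euclidean_space set" and M B e :: real
  assumes P: "finite P" and e: "0 < e" "e \<le> 1" and M: "0 \<le> M" "\<And>x. real (card {p \<in> P. dist x p \<le> 3 * e}) \<le> M"
    and B: "0 < B" "\<And>x :: 'a. \<bar>bump x\<bar> \<le> B"
      "\<And>b x. b \<in> (Basis :: 'a set) \<Longrightarrow> \<bar>dir bump b x\<bar> \<le> B"
      "\<And>b x. b \<in> (Basis :: 'a set) \<Longrightarrow> \<bar>dir (dir bump b) b x\<bar> \<le> B"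
  shows "\<bar>patch P e x\<bar> \<le> DIM('a) * (M * B) / e\<^sup>2" (is "_ \<le> ?R")
    and "norm (gradient (patch P e) x) \<le> DIM('a) * (M * B) / e\<^sup>2"
    and "\<bar>laplacian (patch P e) x\<bar> \<le> DIM('a) * (M * B) / e\<^sup>2"
proof -
  have cl: "closed (cball (0::'a) 3)" by simp
  have z0: "bump x = 0" if "x \<notin> cball (0::'a) 3" for x using that by (intro bump_eq_0) simp
  have z1: "dir bump b x = 0" if "x \<notin> cball (0::'a) 3" for x b
    by (rule dir_eq_0_outside[OF cl z0 that])
  have z2: "dir (dir bump b) b x = 0" if "x \<notin> cball (0::'a) 3" for x b
    by (rule dir_eq_0_outside[OF cl z1 that])
  have B0: "0 \<le> B" using B(1) by simp
  have MB: "0 \<le> M * B" using M(1) B0 by simp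
  have e2: "1 \<le> 1 / e" "1 / e \<le> (1 / e)\<^sup>2" "1 \<le> (1 / e)\<^sup>2"
  proof -
    show 1: "1 \<le> 1 / e" using e by simp
    then show 2: "1 / e \<le> (1 / e)\<^sup>2" using mult_left_mono[of 1 "1 / e" "1 / e"] e(1) by (simp add: power2_eq_square)
    show "1 \<le> (1 / e)\<^sup>2" using 1 2 by linarith
  qed
  have N: "1 \<le> real DIM('a)" using DIM_positive[where 'a = 'a] by linarith
  have eq: "?R = DIM('a) * ((1 / e)\<^sup>2 * (M * B))" by (simp add: power_divide)
  have "\<bar>patch P e x\<bar> \<le> 1 * (1 * (M * B))"
    unfolding patch_def using rescaled_sum_bound[OF P e(1) M(2) B0 B(2) z0] by simp
  also have "\<dots> \<le> ?R"
    unfolding eq using N e2 MB M(1) B0 by (intro mult_mono) auto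
  finally show "\<bar>patch P e x\<bar> \<le> ?R" .
  have d1: "\<bar>dir (patch P e) b x\<bar> \<le> (1 / e)\<^sup>2 * (M * B)" if "b \<in> Basis" for b
  proof -
    have "\<bar>dir (patch P e) b x\<bar> = 1 / e * \<bar>\<Sum>p\<in>P. dir bump b ((1 / e) *\<^sub>R (x - p))\<bar>"
      using e by (simp add: dir_patch abs_mult)
    also have "\<dots> \<le> (1 / e)\<^sup>2 * (M * B)"
      using rescaled_sum_bound[OF P e(1) M(2) B0 B(3)[OF that] z1] e2 M(1) B0 by (intro mult_mono) auto
    finally show ?thesis .
  qed
  have d2: "\<bar>dir (dir (patch P e) b) b x\<bar> \<le> (1 / e)\<^sup>2 * (M * B)" if "b \<in> Basis" for b
  proof -
    have "\<bar>dir (dir (patch P e) b) b x\<bar> = (1 / e)\<^sup>2 * \<bar>\<Sum>p\<in>P. dir (dir bump b) b ((1 / e) *\<^sub>R (x - p))\<bar>"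
      using e by (simp add: dir_dir_patch abs_mult)
    also have "\<dots> \<le> (1 / e)\<^sup>2 * (M * B)"
      using rescaled_sum_bound[OF P e(1) M(2) B0 B(4)[OF that] z2] by (intro mult_left_mono) auto
    finally show ?thesis .
  qed
  have "norm (gradient (patch P e) x) \<le> (\<Sum>b\<in>(Basis :: 'a set). (1 / e)\<^sup>2 * (M * B))"
    by (rule order_trans[OF norm_gradient_le sum_mono[OF d1]])
  then show "norm (gradient (patch P e) x) \<le> ?R" unfolding eq by simp
  have "\<bar>laplacian (patch P e) x\<bar> \<le> (\<Sum>b\<in>(Basis :: 'a set). (1 / e)\<^sup>2 * (M * B))"
    unfolding laplacian_def by (rule order_trans[OF sum_abs sum_mono[OF d2]])
  then show "\<bar>laplacian (patch P e) x\<bar> \<le> ?R" unfolding eq by simp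
qed

lemma laplacian_cmult: "smooth f \<Longrightarrow> laplacian (\<lambda>x. c * f x) x = c * laplacian f x"
proof -
  assume f: "smooth f"
  then have "dir (\<lambda>x. c * f x) b = (\<lambda>x. c * dir f b x)" for b
    by (intro ext dir_cmult smooth_differentiable)
  then show ?thesis
    unfolding laplacian_def using smooth_differentiable[OF smooth_dir[OF f]]
    by (simp add: dir_cmult sum_distrib_left)
qed

lemma L2_norm_bound:
  fixes h :: "'a::euclidean_space \<Rightarrow> 'b::euclidean_space"
  assumes P: "finite P" "(\<Union>p\<in>P. cball p r) \<subseteq> \<Omega>" and r: "0 \<le> r" and \<Omega>: "\<Omega> \<in> sets lebesgue"
    and h: "\<And>x. norm (h x) \<le> \<beta>" "\<And>x. x \<notin> (\<Union>p\<in>P. cball p r) \<Longrightarrow> h x = 0" and \<beta>: "0 \<le> \<beta>"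
  shows "sqrt (LINT x|lebesgue_on \<Omega>. (norm (h x))\<^sup>2)
    \<le> \<beta> * sqrt (real (card P) * (unit_ball_vol DIM('a) * r ^ DIM('a)))"
proof -
  let ?S = "\<Union>p\<in>P. cball p r"
  have S: "compact ?S" using P by (intro compact_UN) auto
  then have Sm: "?S \<in> sets borel" by (intro borel_closed compact_imp_closed)
  have fin: "emeasure lborel ?S < \<infinity>" using S by (intro emeasure_bounded_finite compact_imp_bounded)
  have z: "indicat_real ?S x = 0" if "x \<notin> \<Omega>" for x using that P(2) by (metis indicator_simps(2) subsetD)
  have mi: "(indicator ?S :: 'a \<Rightarrow> real) \<in> borel_measurable borel" using Sm by simp
  have int: "integrable (lebesgue_on \<Omega>) (indicator ?S :: 'a \<Rightarrow> real)"
    by (rule integral_lebesgue_on_compact_support(2)[OF mi z \<Omega>, THEN iffD2], assumption,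
        rule integrable_real_indicator) (use Sm fin in auto)
  have "(LINT x|lebesgue_on \<Omega>. (norm (h x))\<^sup>2) \<le> (LINT x|lebesgue_on \<Omega>. \<beta>\<^sup>2 * indicator ?S x)"
  proof (rule integral_mono')
    show "integrable (lebesgue_on \<Omega>) (\<lambda>x. \<beta>\<^sup>2 * indicator ?S x)" using int by (intro integrable_mult_right)
    fix x
    show "(norm (h x))\<^sup>2 \<le> \<beta>\<^sup>2 * indicator ?S x"
      using h[of x] by (cases "x \<in> ?S") (auto intro: power_mono)
  qed simp
  also have "\<dots> = \<beta>\<^sup>2 * measure lborel ?S"
  proof -
    have "(LINT x|lebesgue_on \<Omega>. indicat_real ?S x) = (LINT x|lborel. indicat_real ?S x)"
      by (rule integral_lebesgue_on_compact_support(1)[OF mi z \<Omega>])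
    also have "\<dots> = measure lborel ?S" using Sm by simp
    finally show ?thesis by (simp only: integral_mult_right_zero)
  qed
  also have "measure lborel ?S \<le> (\<Sum>p\<in>P. measure lborel (cball p r))"
    using P by (intro measure_UNION_le) auto
  also have "\<dots> = real (card P) * (unit_ball_vol DIM('a) * r ^ DIM('a))"
    using r by (simp add: content_cball)
  finally have "(LINT x|lebesgue_on \<Omega>. (norm (h x))\<^sup>2) \<le> \<beta>\<^sup>2 * (real (card P) * (unit_ball_vol DIM('a) * r ^ DIM('a)))"
    by (simp add: mult_left_mono)
  then have "sqrt (LINT x|lebesgue_on \<Omega>. (norm (h x))\<^sup>2) \<le> sqrt (\<beta>\<^sup>2 * (real (card P) * (unit_ball_vol DIM('a) * r ^ DIM('a))))"
    by (rule real_sqrt_le_mono)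
  then show ?thesis using \<beta> by (simp add: real_sqrt_mult)
qed

text \<open>What the superposition has to know about one Cantor set \<open>A\<close>, independently
  of its construction: \<open>f\<close> are the terms of its series, \<open>K\<close> carries all of
  them, and outside the set \<open>Z\<close>, null in dimension N - 4, only finitely many are seen
  locally. The cover is asked of the enlargement by \<delta> because a point outside it has a ball
  of radius \<delta> free of \<open>K\<close>. In \<open>blow_up\<close> a single term, depending on
  x, gives the lower bound; the other terms are nonnegative.\<close>

locale singular_block =
  fixes \<Omega> B :: "'a::euclidean_space set" and s \<eta> :: real and A K Z :: "'a set" and \<delta> :: real
    and f :: "nat \<Rightarrow> 'a \<Rightarrow> real"
  assumes dim: "ereal s \<le> hausdorff_dim A" and A_sub: "A \<subseteq> B"
    and \<delta>: "0 < \<delta>" and cover: "small_cover (real DIM('a) - 4) \<eta> {x. \<exists>y\<in>K. dist x y \<le> \<delta>}"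
    and null: "\<And>\<eta>'. 0 < \<eta>' \<Longrightarrow> small_cover (real DIM('a) - 4) \<eta>' Z"
    and test: "\<And>J. test_function B (f J)" and nonneg: "\<And>J x. 0 \<le> f J x"
    and support: "\<And>J x. x \<notin> K \<Longrightarrow> f J x = 0"
    and locally_finite: "\<And>a. a \<notin> Z \<Longrightarrow> \<exists>r>0. \<exists>m. \<forall>J\<ge>m. \<forall>x\<in>ball a r. f J x = 0"
    and blow_up: "\<And>a. a \<in> A \<Longrightarrow> \<exists>C>0. \<exists>\<gamma>>0. \<exists>r>0. \<forall>x\<in>ball a r - {a}. \<exists>J. C * norm (x - a) powr (- \<gamma>) \<le> f J x"
    and summable_f: "summable (\<lambda>J. sqrt (LINT x|lebesgue_on \<Omega>. (f J x)\<^sup>2))"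
    and summable_gradient: "summable (\<lambda>J. sqrt (LINT x|lebesgue_on \<Omega>. (norm (gradient (f J) x))\<^sup>2))"
    and summable_laplacian: "summable (\<lambda>J. sqrt (LINT x|lebesgue_on \<Omega>. (laplacian (f J) x)\<^sup>2))"

section \<open>The functions attached to the generations of a Cantor dust\<close>

context cantor_dust
begin

lemma eps_powr: "eps J powr t = eps 0 powr t * (l powr t) ^ J"
proof -
  have "eps J = eps 0 * l ^ J" by (simp add: eps_def)
  moreover have "(l ^ J) powr t = (l powr t) ^ J"
    using l by (simp add: powr_power powr_realpow[symmetric] powr_powr mult.commute)
  ultimately show ?thesis using eps_pos[of 0] l by (simp add: powr_mult)
qed

text \<open>As 2^N = l^(-s), the at most 2^(N J) nodes weighted with eps^t are dominated by a
  geometric progression of ratio l^(t-s). Used with t = N - 4 for covers and with t = N - 4 - 2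
  \<gamma> for L^2 norms.\<close>

lemma card_nodes_eps: "real (card (nodes J)) * eps J powr t \<le> eps 0 powr t * (l powr (t - s)) ^ J"
proof -
  have "real (card (nodes J)) \<le> real ((2 ^ J) ^ DIM('a))"
    using card_nodes[of J] by (rule of_nat_mono)
  also have "\<dots> = (2 ^ DIM('a)) ^ J" by (simp add: power_mult[symmetric] mult.commute)
  finally have "real (card (nodes J)) * eps J powr t \<le> (2 ^ DIM('a)) ^ J * (eps 0 powr t * (l powr t) ^ J)"
    unfolding eps_powr[of J t] by (rule mult_right_mono) simp
  also have "\<dots> = eps 0 powr t * (2 ^ DIM('a) * l powr t) ^ J"
    by (simp add: power_mult_distrib)
  also have "2 ^ DIM('a) * l powr t = l powr (t - s)"
    using l by (simp add: powr_diff ls power_one_over)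
  finally show ?thesis .
qed

lemma nodes_small_cover:
  assumes t: "s < t" and \<eta>: "0 < \<eta>"
  obtains m where "\<And>J. m \<le> J \<Longrightarrow> small_cover t \<eta> (\<Union>p\<in>nodes J. cball p (4 * eps J))"
proof -
  \<comment> \<open>The balls have diameter \<open>8 * eps J\<close>: their radius 4 is the support
    radius 3 plus an enlargement by one scale.\<close>
  have "(\<lambda>J. 8 powr t * (eps 0 powr t * (l powr (t - s)) ^ J)) \<longlonglongrightarrow> 8 powr t * (eps 0 powr t * 0)"
    using l t by (intro tendsto_mult tendsto_const LIMSEQ_power_zero) (simp add: powr01_less_one)
  then have 1: "\<forall>\<^sub>F J in sequentially. 8 powr t * (eps 0 powr t * (l powr (t - s)) ^ J) < \<eta>"
    using \<eta> by (intro order_tendstoD(2)) auto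
  have "(\<lambda>J. 8 * (2 * DIM('a) * \<rho> * l ^ J)) \<longlonglongrightarrow> 8 * (2 * DIM('a) * \<rho> * 0)"
    using l by (intro tendsto_mult tendsto_const LIMSEQ_power_zero) simp
  then have 2: "\<forall>\<^sub>F J in sequentially. 8 * eps J < \<eta>"
    unfolding eps_def using \<eta> by (intro order_tendstoD(2)) auto
  from eventually_conj[OF 1 2] obtain m where
    m: "\<And>J. m \<le> J \<Longrightarrow> 8 powr t * (eps 0 powr t * (l powr (t - s)) ^ J) < \<eta> \<and> 8 * eps J < \<eta>"
    unfolding eventually_sequentially by blast
  show thesis
  proof (rule that[of m])
    fix J assume "m \<le> J"
    then have *: "8 powr t * (eps 0 powr t * (l powr (t - s)) ^ J) < \<eta>" "8 * eps J < \<eta>"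
      using m by auto
    show "small_cover t \<eta> (\<Union>p\<in>nodes J. cball p (4 * eps J))"
    proof (rule small_cover_finite[OF finite_nodes subset_refl])
      have "real (card (nodes J)) * (2 * (4 * eps J)) powr t = 8 powr t * (real (card (nodes J)) * eps J powr t)"
        using eps_pos[of J] by (simp add: powr_mult)
      also have "\<dots> \<le> 8 powr t * (eps 0 powr t * (l powr (t - s)) ^ J)"
        by (intro mult_left_mono card_nodes_eps) simp
      finally show "real (card (nodes J)) * (2 * (4 * eps J)) powr t \<le> \<eta>" using * by simp
    qed (use * eps_pos[of J] s t in auto)
  qed
qed

definition block :: "real \<Rightarrow> nat \<Rightarrow> 'a \<Rightarrow> real" where
  "block \<gamma> J x = eps J powr (- \<gamma>) * patch (nodes J) (eps J) x"

lemma smooth_block: "smooth (block \<gamma> J)"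
  unfolding block_def[abs_def] by (intro smooth_mult smooth_const smooth_patch)

lemma block_nonneg: "0 \<le> block \<gamma> J x"
  by (simp add: block_def patch_nonneg)

lemma block_eq_0: "x \<notin> nbhd J \<Longrightarrow> block \<gamma> J x = 0"
  unfolding block_def nbhd_def by (simp only: patch_eq_0[OF eps_pos] mult_zero_right not_False_eq_True)

text \<open>The function, its gradient and its Laplacian are bounded by a multiple of
  eps^(-\<gamma>-2) and live on a volume of order card * eps^N, so the squared norms are of order
  card * eps^e with e = N - 4 - 2 \<gamma>. By the count of nodes they decay like the powers of q =
  l^(e-s), and the assumption on \<gamma> says e > s.\<close>

lemma block_summable:
  assumes \<Omega>: "\<Omega> \<in> sets lebesgue" "nbhd 0 \<subseteq> \<Omega>" and e1: "eps 0 \<le> 1"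
    and \<gamma>: "s + 2 * \<gamma> + 4 < DIM('a)"
  shows "summable (\<lambda>J. sqrt (LINT x|lebesgue_on \<Omega>. (block \<gamma> J x)\<^sup>2))"
    and "summable (\<lambda>J. sqrt (LINT x|lebesgue_on \<Omega>. (norm (gradient (block \<gamma> J) x))\<^sup>2))"
    and "summable (\<lambda>J. sqrt (LINT x|lebesgue_on \<Omega>. (laplacian (block \<gamma> J) x)\<^sup>2))"
proof -
  let ?N = "DIM('a)"
  define M :: real where "M = (1 + 12 * real DIM('a)) ^ DIM('a)"
  have M: "0 \<le> M" by (simp add: M_def)
  obtain B where B: "0 < B" "\<And>x :: 'a. \<bar>bump x\<bar> \<le> B"
    "\<And>b x. b \<in> (Basis :: 'a set) \<Longrightarrow> \<bar>dir bump b x\<bar> \<le> B"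
    "\<And>b x. b \<in> (Basis :: 'a set) \<Longrightarrow> \<bar>dir (dir bump b) b x\<bar> \<le> B"
    using bump_derivatives_bounded[where 'a = 'a] by blast
  define c where "c = DIM('a) * (M * B)"
  have c: "0 \<le> c" using M B by (simp add: c_def)
  have eps1: "eps J \<le> 1" for J
  proof -
    have "eps J = eps 0 * l ^ J" by (simp add: eps_def)
    also have "\<dots> \<le> 1 * 1" using e1 l eps_pos[of 0] by (intro mult_mono power_le_one) auto
    finally show ?thesis by simp
  qed
  define \<beta> where "\<beta> J = eps J powr (- \<gamma>) * (c / (eps J)\<^sup>2)" for J
  have \<beta>: "0 \<le> \<beta> J" for J using c by (simp add: \<beta>_def)
  note pb = patch_bounds[OF finite_nodes eps_pos eps1 M nodes_overlap[folded M_def] B, folded c_def]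
  have grad: "gradient (block \<gamma> J) x = eps J powr (- \<gamma>) *\<^sub>R gradient (patch (nodes J) (eps J)) x" for J x
    unfolding block_def[abs_def] by (rule gradient_cmult[OF smooth_patch])
  have lap: "laplacian (block \<gamma> J) x = eps J powr (- \<gamma>) * laplacian (patch (nodes J) (eps J)) x" for J x
    unfolding block_def[abs_def] by (rule laplacian_cmult[OF smooth_patch])
  have b0: "norm (block \<gamma> J x) \<le> \<beta> J" for J x
    using mult_left_mono[OF pb(1)[of J x], of "eps J powr (- \<gamma>)"] by (simp add: block_def \<beta>_def abs_mult)
  have b1: "norm (gradient (block \<gamma> J) x) \<le> \<beta> J" for J x
    using mult_left_mono[OF pb(2)[of J x], of "eps J powr (- \<gamma>)"] by (simp add: grad \<beta>_def)
  have b2: "norm (laplacian (block \<gamma> J) x) \<le> \<beta> J" for J x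
    using mult_left_mono[OF pb(3)[of J x], of "eps J powr (- \<gamma>)"] by (simp add: lap \<beta>_def abs_mult)
  have cl: "closed (nbhd J)" for J by (rule compact_imp_closed[OF compact_nbhd])
  have d0: "dir (block \<gamma> J) b x = 0" if "x \<notin> nbhd J" for J b x
    by (rule dir_eq_0_outside[OF cl block_eq_0 that])
  have dd0: "dir (dir (block \<gamma> J) b) b x = 0" if "x \<notin> nbhd J" for J b x
    by (rule dir_eq_0_outside[OF cl d0 that])
  have z1: "gradient (block \<gamma> J) x = 0" if "x \<notin> nbhd J" for J x
    by (simp add: gradient_eq d0[OF that])
  have z2: "laplacian (block \<gamma> J) x = 0" if "x \<notin> nbhd J" for J x
    by (simp add: laplacian_def dd0[OF that])
  let ?V = "unit_ball_vol (real ?N)"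
  define E where "E J = \<beta> J * sqrt (real (card (nodes J)) * (?V * (3 * eps J) ^ ?N))" for J
  have sub: "(\<Union>p\<in>nodes J. cball p (3 * eps J)) \<subseteq> \<Omega>" for J
    using nbhd_antimono[of 0 J] \<Omega>(2) by (auto simp: nbhd_def)
  have e3: "0 \<le> 3 * eps J" for J using eps_pos[of J] by simp
  have L2: "sqrt (LINT x|lebesgue_on \<Omega>. (norm (h x))\<^sup>2) \<le> E J"
    if "\<And>x. norm (h x) \<le> \<beta> J" "\<And>x. x \<notin> nbhd J \<Longrightarrow> h x = 0" for h :: "'a \<Rightarrow> 'z::euclidean_space" and J
    unfolding E_def
    by (rule L2_norm_bound[OF finite_nodes sub e3 \<Omega>(1) that(1) that(2) \<beta>]) (simp_all add: nbhd_def)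
  define e where "e = real ?N - 4 - 2 * \<gamma>"
  define q where "q = l powr (e - s)"
  have q: "0 \<le> q" "q < 1" using l \<gamma> by (auto simp: q_def e_def powr01_less_one)
  have E: "E J \<le> (c * sqrt (?V * 3 ^ ?N) * sqrt (eps 0 powr e)) * (sqrt q) ^ J" for J
  proof -
    have "eps J powr (- \<gamma>) / (eps J)\<^sup>2 = eps J powr (- \<gamma> - 2)"
      using eps_pos[of J] by (simp add: powr_diff powr_numeral)
    also have "\<dots> = sqrt ((eps J powr (- \<gamma> - 2))\<^sup>2)" by simp
    also have "(eps J powr (- \<gamma> - 2))\<^sup>2 = eps J powr (- 2 * \<gamma> - 4)"
      using eps_pos[of J] by (simp add: power2_eq_square powr_add[symmetric])
    finally have 1: "eps J powr (- \<gamma>) / (eps J)\<^sup>2 = sqrt (eps J powr (- 2 * \<gamma> - 4))" .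
    have "E J = c * (eps J powr (- \<gamma>) / (eps J)\<^sup>2) * sqrt (real (card (nodes J)) * (?V * (3 * eps J) ^ ?N))"
      by (simp add: E_def \<beta>_def)
    also have "\<dots> = c * sqrt (eps J powr (- 2 * \<gamma> - 4) * (real (card (nodes J)) * (?V * (3 * eps J) ^ ?N)))"
      by (simp add: 1 real_sqrt_mult)
    also have "eps J powr (- 2 * \<gamma> - 4) * (real (card (nodes J)) * (?V * (3 * eps J) ^ ?N))
       = (?V * 3 ^ ?N) * (real (card (nodes J)) * (eps J powr (- 2 * \<gamma> - 4) * eps J powr ?N))"
      using eps_pos[of J] by (simp add: power_mult_distrib powr_realpow)
    also have "eps J powr (- 2 * \<gamma> - 4) * eps J powr ?N = eps J powr e"
      by (simp add: powr_add[symmetric] e_def algebra_simps)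
    also have "c * sqrt ((?V * 3 ^ ?N) * (real (card (nodes J)) * eps J powr e))
        \<le> c * sqrt ((?V * 3 ^ ?N) * (eps 0 powr e * q ^ J))"
      unfolding q_def using c
      by (intro mult_left_mono real_sqrt_le_mono card_nodes_eps) auto
    also have "\<dots> = (c * sqrt (?V * 3 ^ ?N) * sqrt (eps 0 powr e)) * (sqrt q) ^ J"
      by (simp add: real_sqrt_mult real_sqrt_power)
    finally show ?thesis .
  qed
  have "summable (\<lambda>J. (c * sqrt (?V * 3 ^ ?N) * sqrt (eps 0 powr e)) * (sqrt q) ^ J)"
    using q by (intro summable_mult summable_geometric) auto
  then have sE: "summable F" if "\<And>J. 0 \<le> F J" "\<And>J. F J \<le> E J" for F
    by (rule summable_comparison_test[rotated]) (use order_trans[OF that(2) E] that(1) in auto)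
  show "summable (\<lambda>J. sqrt (LINT x|lebesgue_on \<Omega>. (block \<gamma> J x)\<^sup>2))"
    by (rule sE) (use L2[OF b0 block_eq_0] in simp_all)
  show "summable (\<lambda>J. sqrt (LINT x|lebesgue_on \<Omega>. (norm (gradient (block \<gamma> J) x))\<^sup>2))"
    by (rule sE) (use L2[OF b1 z1] in simp_all)
  show "summable (\<lambda>J. sqrt (LINT x|lebesgue_on \<Omega>. (laplacian (block \<gamma> J) x)\<^sup>2))"
    by (rule sE) (use L2[OF b2 z2] in simp_all)
qed

text \<open>The generation is matched to the distance: some scale eps (n + m) lies between |x - a|
  and |x - a| / l. A node lies within one such scale of a, hence within two of x, where the patch is
  at least 1. The factor l^\<gamma> is the price of rounding to a generation.\<close>

lemma block_blow_up:
  assumes a: "a \<in> dust" and \<gamma>: "0 < \<gamma>" and x: "x \<in> ball a (eps m)" "x \<noteq> a"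
  shows "\<exists>J. l powr \<gamma> * norm (x - a) powr (- \<gamma>) \<le> block \<gamma> (J + m) x"
proof -
  let ?d = "norm (x - a)"
  have d: "0 < ?d" "?d < eps m" using x by (auto simp: dist_norm norm_minus_commute)
  then obtain n where n: "l ^ Suc n \<le> ?d / eps m" "?d / eps m < l ^ n"
    using power_bracket[of l "?d / eps m"] l eps_pos[of m] by auto
  have em: "eps (n + m) = eps m * l ^ n" by (simp add: eps_def power_add)
  have up: "?d \<le> eps (n + m)" using n(2) eps_pos[of m] by (simp add: em pos_divide_less_eq mult.commute)
  have lo: "eps (n + m) \<le> ?d / l" unfolding em using n(1) eps_pos[of m] l by (simp add: field_simps)
  obtain p where p: "p \<in> nodes (n + m)" "dist p a \<le> eps (n + m)" by (rule dust_near_nodes[OF a])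
  have "dist x p \<le> 2 * eps (n + m)"
    using dist_triangle[of x p a] p(2) up by (simp add: dist_norm norm_minus_commute)
  then have "1 \<le> patch (nodes (n + m)) (eps (n + m)) x"
    by (rule patch_ge_1[OF finite_nodes p(1) eps_pos])
  then have "eps (n + m) powr (- \<gamma>) * 1 \<le> block \<gamma> (n + m) x"
    unfolding block_def by (intro mult_left_mono) auto
  moreover have "(?d / l) powr (- \<gamma>) \<le> eps (n + m) powr (- \<gamma>)"
    using lo eps_pos[of "n + m"] \<gamma> by (intro powr_mono2') auto
  moreover have "(?d / l) powr (- \<gamma>) = l powr \<gamma> * ?d powr (- \<gamma>)"
    using d l by (simp add: powr_divide powr_minus field_simps)
  ultimately show ?thesis by (intro exI[of _ n]) linarith
qed

end

lemma singular_block_exists: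
  fixes x0 :: "'a::euclidean_space"
  assumes N: "5 \<le> DIM('a)" and s_bounds: "0 < s" "s < real DIM('a) - 4" and r: "0 < r" "ball x0 r \<subseteq> \<Omega>"
    and \<Omega>: "\<Omega> \<in> sets lebesgue" and \<eta>: "0 < \<eta>"
  shows "\<exists>A K Z \<delta> f. singular_block \<Omega> (ball x0 r) s \<eta> A K Z \<delta> f"
proof -
  \<comment> \<open>This gives \<open>eps 0 = min 1 r / 4\<close>: the first neighbourhood, of
    radius \<open>3 * eps 0\<close> around x0, fits into the ball, and all scales are at most
    1.\<close>
  define \<rho> where "\<rho> = min 1 r / (8 * DIM('a))"
  \<comment> \<open>The ratio solving 2^N l^s = 1; it is below 1/2 because s < N.\<close>
  define l :: real where "l = (1/2) powr (DIM('a) / s)"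
  \<comment> \<open>A quarter of the gap keeps s + 2 \<gamma> + 4 strictly below N.\<close>
  define \<gamma> where "\<gamma> = (real DIM('a) - 4 - s) / 4"
  have N0: "0 < real DIM('a)" by simp
  interpret cantor_dust x0 \<rho> l s
  proof
    show "0 < \<rho>" using r N0 by (simp add: \<rho>_def)
    show "0 < l" by (simp add: l_def)
    have "(1/2 :: real) powr (DIM('a) / s) < (1/2) powr 1"
      using s_bounds by (intro powr_less_mono') auto
    then show "l < 1/2" by (simp add: l_def)
    show "0 < s" by fact
    show "l powr s = (1/2) ^ DIM('a)" using s_bounds by (simp add: l_def powr_powr powr_realpow)
  qed
  have "4 * \<gamma> = real DIM('a) - 4 - s" by (simp add: \<gamma>_def)
  then have \<gamma>: "0 < \<gamma>" "s + 2 * \<gamma> + 4 < DIM('a)" using s_bounds(2) by linarith+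
  have e0: "eps 0 = min 1 r / 4" unfolding eps_def using N0 by (simp add: \<rho>_def)
  then have e1: "eps 0 \<le> 1" by simp
  obtain m where m: "\<And>J. m \<le> J \<Longrightarrow> small_cover (real DIM('a) - 4) \<eta> (\<Union>p\<in>nodes J. cball p (4 * eps J))"
    using nodes_small_cover[OF s_bounds(2) \<eta>] by blast
  have nb0: "nbhd 0 \<subseteq> ball x0 r" using e0 r by (auto simp: nbhd_def nodes_0)
  have nb: "nbhd J \<subseteq> ball x0 r" for J using nbhd_antimono[of 0 J] nb0 by blast
  note S = block_summable[OF \<Omega> subset_trans[OF nb0 r(2)] e1 \<gamma>(2)]
  \<comment> \<open>Starting at generation m makes the set carrying all terms, even enlarged by
    \<open>eps m\<close>, as thin as \<open>\<eta>\<close> demands. A point outside the closed set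
    \<open>nbhd n\<close> has a ball on which all terms from generation n on vanish, so infinitely
    many terms can only accumulate on the intersection.\<close>
  have "singular_block \<Omega> (ball x0 r) s \<eta> dust (nbhd m) (\<Inter>J. nbhd J) (eps m) (\<lambda>J. block \<gamma> (J + m))"
  proof
    show "ereal s \<le> hausdorff_dim dust" by (rule dust_dim)
    show "dust \<subseteq> ball x0 r"
    proof
      fix a assume "a \<in> dust"
      then obtain p where "p \<in> nodes 0" "dist p a \<le> eps 0" by (rule dust_near_nodes)
      then show "a \<in> ball x0 r" using e0 r by (auto simp: nodes_0)
    qed
    show "0 < eps m" by (rule eps_pos)
    show "small_cover (real DIM('a) - 4) \<eta> {x. \<exists>y\<in>nbhd m. dist x y \<le> eps m}"
    proof (rule small_cover_subset[OF m[OF order_refl]])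
      show "{x. \<exists>y\<in>nbhd m. dist x y \<le> eps m} \<subseteq> (\<Union>p\<in>nodes m. cball p (4 * eps m))"
      proof
        fix x assume "x \<in> {x. \<exists>y\<in>nbhd m. dist x y \<le> eps m}"
        then obtain y p where "p \<in> nodes m" "dist p y \<le> 3 * eps m" "dist x y \<le> eps m"
          by (auto simp: nbhd_def)
        moreover have "dist p x \<le> dist p y + dist x y" by (rule dist_triangle2)
        ultimately have "p \<in> nodes m" "dist p x \<le> 4 * eps m" by auto
        then show "x \<in> (\<Union>p\<in>nodes m. cball p (4 * eps m))" by auto
      qed
    qed
    show "small_cover (real DIM('a) - 4) \<eta>' (\<Inter>J. nbhd J)" if pos: "0 < \<eta>'" for \<eta>'
    proof -
      obtain n where n: "\<And>J. n \<le> J \<Longrightarrow> small_cover (real DIM('a) - 4) \<eta>' (\<Union>p\<in>nodes J. cball p (4 * eps J))"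
        using nodes_small_cover[OF s_bounds(2) pos] by blast
      have "nbhd n \<subseteq> (\<Union>p\<in>nodes n. cball p (4 * eps n))"
        unfolding nbhd_def using eps_pos[of n] by (intro UN_mono) auto
      then show ?thesis by (intro small_cover_subset[OF n[OF order_refl]]) blast
    qed
    show "test_function (ball x0 r) (block \<gamma> (J + m))" for J
      unfolding test_function_iff
      using smooth_block compact_nbhd nb block_eq_0 by (intro conjI exI[of _ "nbhd (J + m)"]) auto
    show "0 \<le> block \<gamma> (J + m) x" for J x by (rule block_nonneg)
    show "block \<gamma> (J + m) x = 0" if "x \<notin> nbhd m" for J x
      using that nbhd_antimono[of m "J + m"] by (intro block_eq_0) auto
    show "\<exists>r>0. \<exists>n. \<forall>J\<ge>n. \<forall>x\<in>ball a r. block \<gamma> (J + m) x = 0" if "a \<notin> (\<Inter>J. nbhd J)" for a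
    proof -
      obtain n where "a \<in> - nbhd n" using \<open>a \<notin> (\<Inter>J. nbhd J)\<close> by blast
      moreover have "open (- nbhd n)" by (simp add: open_Compl compact_imp_closed compact_nbhd)
      ultimately obtain r' where "0 < r'" "ball a r' \<subseteq> - nbhd n"
        using openE by blast
      moreover have "nbhd (J + m) \<subseteq> nbhd n" if "n \<le> J" for J using that by (intro nbhd_antimono) simp
      ultimately show ?thesis by (intro exI[of _ r'] conjI exI[of _ n] allI impI ballI block_eq_0) blast+
    qed
    show "\<exists>C>0. \<exists>\<gamma>'>0. \<exists>r>0. \<forall>x\<in>ball a r - {a}. \<exists>J. C * norm (x - a) powr (- \<gamma>') \<le> block \<gamma> (J + m) x"
      if "a \<in> dust" for a
    proof -
      have *: "\<forall>x\<in>ball a (eps m) - {a}. \<exists>J. l powr \<gamma> * norm (x - a) powr (- \<gamma>) \<le> block \<gamma> (J + m) x"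
        using block_blow_up[OF that \<gamma>(1)] by blast
      have "0 < l powr \<gamma>" using l by simp
      then show ?thesis using \<gamma>(1) eps_pos[of m] * by blast
    qed
    show "summable (\<lambda>J. sqrt (LINT x|lebesgue_on \<Omega>. (block \<gamma> (J + m) x)\<^sup>2))"
      by (rule summable_ignore_initial_segment[OF S(1)])
    show "summable (\<lambda>J. sqrt (LINT x|lebesgue_on \<Omega>. (norm (gradient (block \<gamma> (J + m)) x))\<^sup>2))"
      by (rule summable_ignore_initial_segment[OF S(2)])
    show "summable (\<lambda>J. sqrt (LINT x|lebesgue_on \<Omega>. (laplacian (block \<gamma> (J + m)) x)\<^sup>2))"
      by (rule summable_ignore_initial_segment[OF S(3)])
  qed
  then show ?thesis by blast
qed

section \<open>Superposition of the building blocks\<close>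

lemma small_cover_mono:
  assumes "small_cover s \<eta> A" "\<eta> \<le> \<eta>'"
  shows "small_cover s \<eta>' A"
proof -
  obtain U where U: "A \<subseteq> (\<Union>i. U i)" "\<And>i. bounded (U i)" "\<And>i. diameter (U i) \<le> \<eta>"
    "(\<Sum>i. diam_power s (U i)) \<le> ennreal \<eta>"
    using assms(1) unfolding small_cover_def by blast
  have "diameter (U i) \<le> \<eta>'" for i using U(3)[of i] assms(2) by linarith
  moreover have "(\<Sum>i. diam_power s (U i)) \<le> ennreal \<eta>'"
    using U(4) ennreal_leI[OF assms(2)] by (rule order_trans)
  ultimately show ?thesis unfolding small_cover_def using U(1,2) by blast
qed

lemma test_function_mono: "test_function B f \<Longrightarrow> B \<subseteq> \<Omega> \<Longrightarrow> test_function \<Omega> f"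
  unfolding test_function_def by blast

text \<open>Integrate f \<le> t + f^2 / t, with t the L^2 norm. If t = 0, then f vanishes almost
  everywhere.\<close>

lemma test_function_L1_le_L2:
  fixes f :: "'a::euclidean_space \<Rightarrow> real"
  assumes f: "test_function \<Omega> f" "\<And>x. 0 \<le> f x" and \<Omega>: "\<Omega> \<in> lmeasurable"
  shows "(LINT x|lebesgue_on \<Omega>. f x)
    \<le> (measure (lebesgue_on \<Omega>) (space (lebesgue_on \<Omega>)) + 1) * sqrt (LINT x|lebesgue_on \<Omega>. (f x)\<^sup>2)"
proof -
  let ?M = "lebesgue_on \<Omega>"
  interpret finite_measure ?M by (rule finite_measure_lebesgue_on[OF \<Omega>])
  have \<Omega>': "\<Omega> \<in> sets lebesgue" using \<Omega> by (rule fmeasurableD)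
  define t where "t = sqrt (LINT x|?M. (f x)\<^sup>2)"
  let ?m = "measure ?M (space ?M)"
  have i2: "integrable ?M (\<lambda>x. (f x)\<^sup>2)"
    using L2_on_test_function[OF f(1) \<Omega>'] by (simp add: L2_on_def)
  have t2: "(LINT x|?M. (f x)\<^sup>2) = t * t" by (simp add: t_def)
  have t0: "0 \<le> t" by (simp add: t_def)
  show ?thesis
  proof (cases "t = 0")
    case True
    then have "(LINT x|?M. (f x)\<^sup>2) = 0" by (simp add: t2)
    then have "AE x in ?M. f x = 0"
      using i2 by (subst (asm) integral_nonneg_eq_0_iff_AE) auto
    then have "(LINT x|?M. f x) = 0" by (rule integral_eq_zero_AE)
    then show ?thesis unfolding t_def[symmetric] by (simp add: True)
  next
    case False
    then have t: "0 < t" using t0 by simp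
    have "(LINT x|?M. f x) \<le> (LINT x|?M. t + (f x)\<^sup>2 / t)"
    proof (rule integral_mono[OF test_function_integrable[OF f(1) \<Omega>']])
      show "integrable ?M (\<lambda>x. t + (f x)\<^sup>2 / t)" using i2 by simp
      fix x
      have "0 \<le> (f x - t)\<^sup>2 / t" using t by simp
      also have "\<dots> = (f x)\<^sup>2 / t - 2 * f x + t" using t by (simp add: field_simps power2_eq_square)
      finally show "f x \<le> t + (f x)\<^sup>2 / t" using f(2)[of x] by linarith
    qed
    also have "\<dots> = t * ?m + t * t / t" using i2 by (simp add: t2[symmetric] mult.commute)
    also have "\<dots> = (?m + 1) * t" using t by (simp add: algebra_simps)
    finally show ?thesis unfolding t_def .
  qed
qed

lemma summable_prod_decode:
  fixes F :: "nat \<Rightarrow> nat \<Rightarrow> real"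
  assumes "\<And>k J. 0 \<le> F k J" "\<And>k. summable (F k)" "summable (\<lambda>k. \<Sum>J. F k J)"
  shows "summable (\<lambda>n. case prod_decode n of (k, J) \<Rightarrow> F k J)"
proof (rule summable_suminf_not_top)
  show "0 \<le> (case prod_decode n of (k, J) \<Rightarrow> F k J)" for n
    using assms(1) by (simp add: case_prod_beta)
  have "(\<Sum>n. ennreal (case prod_decode n of (k, J) \<Rightarrow> F k J))
      = (\<Sum>n. (\<lambda>(k, J). ennreal (F k J)) (prod_decode n))"
    by (simp add: case_prod_beta)
  also have "\<dots> = (\<Sum>k. \<Sum>J. ennreal (F k J))" by (rule suminf_ennreal_2dimen) simp
  also have "\<dots> = (\<Sum>k. ennreal (\<Sum>J. F k J))"
    using assms by (intro suminf_cong suminf_ennreal_eq summable_sums)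
  also have "\<dots> = ennreal (\<Sum>k. \<Sum>J. F k J)"
    using assms by (intro suminf_ennreal_eq summable_sums suminf_nonneg)
  finally show "(\<Sum>n. ennreal (case prod_decode n of (k, J) \<Rightarrow> F k J)) \<noteq> top" by simp
qed

text \<open>The thickness bounds 2^(-k-1) are summable, as a Borel-Cantelli argument for the
  enlarged supports requires. The assumption \<open>dense\<close> makes N - 4 a lower bound for the
  supremum of the dimensions inside every ball, not only globally.\<close>

locale block_family =
  fixes \<Omega> :: "'a::euclidean_space set" and B A K Z :: "nat \<Rightarrow> 'a set"
    and s \<delta> :: "nat \<Rightarrow> real" and f :: "nat \<Rightarrow> nat \<Rightarrow> 'a \<Rightarrow> real"
  assumes DIM: "5 \<le> DIM('a)" and open_\<Omega>: "open \<Omega>" and bounded_\<Omega>: "bounded \<Omega>"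
    and block: "\<And>k. singular_block \<Omega> (B k) (s k) ((1/2) ^ Suc k) (A k) (K k) (Z k) (\<delta> k) (f k)"
    and B: "\<And>k. open (B k)" "\<And>k. B k \<subseteq> \<Omega>"
    and dense: "\<And>x r t. 0 < r \<Longrightarrow> ball x r \<subseteq> \<Omega> \<Longrightarrow> t < real DIM('a) - 4 \<Longrightarrow> \<exists>k. B k \<subseteq> ball x r \<and> t < s k"
begin

abbreviation "M \<equiv> lebesgue_on \<Omega>"

lemma \<Omega>_lmeasurable: "\<Omega> \<in> lmeasurable"
  by (rule lmeasurable_open[OF bounded_\<Omega> open_\<Omega>])

lemma \<Omega>_sets: "\<Omega> \<in> sets lebesgue"
  using \<Omega>_lmeasurable by (rule fmeasurableD)

lemma test_f: "test_function \<Omega> (f k J)"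
  using test_function_mono[OF singular_block.test[OF block] B(2)] .

definition L1_const :: real where "L1_const = measure M (space M) + 1"

definition norm_total :: "nat \<Rightarrow> real" where
  "norm_total k = (\<Sum>J. sqrt (LINT x|M. (f k J x)\<^sup>2)) + (\<Sum>J. sqrt (LINT x|M. (norm (gradient (f k J) x))\<^sup>2))
     + (\<Sum>J. sqrt (LINT x|M. (laplacian (f k J) x)\<^sup>2))"

text \<open>Three tasks at once: 2^(-k) makes the sum over k converge, the denominator normalises
  the norms of the k-th series, and the factor with \<open>\<delta> k\<close> makes its integral
  small compared with the volume of any ball of radius larger than
  \<open>\<delta> k\<close>.\<close>

definition coeff :: "nat \<Rightarrow> real" where
  "coeff k = (1/2) ^ k * (min 1 (\<delta> k ^ DIM('a)) / (1 + L1_const * norm_total k))"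

text \<open>The double family is enumerated as one sequence of test functions, the form in which
  \<open>weak_solution_series\<close> takes it.\<close>

definition term_fun :: "nat \<Rightarrow> 'a \<Rightarrow> real" where
  "term_fun n x = (case prod_decode n of (k, J) \<Rightarrow> coeff k * f k J x)"

definition sol :: "'a \<Rightarrow> real" where "sol x = (\<Sum>n. term_fun n x)"

lemmas summables = singular_block.summable_f[OF block] singular_block.summable_gradient[OF block]
  singular_block.summable_laplacian[OF block]

lemma L1_const: "1 \<le> L1_const" by (simp add: L1_const_def)

lemma norm_total_bounds:
  shows "(\<Sum>J. sqrt (LINT x|M. (f k J x)\<^sup>2)) \<le> norm_total k"
    and "(\<Sum>J. sqrt (LINT x|M. (norm (gradient (f k J) x))\<^sup>2)) \<le> norm_total k"
    and "(\<Sum>J. sqrt (LINT x|M. (laplacian (f k J) x)\<^sup>2)) \<le> norm_total k"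
    and "0 \<le> norm_total k"
proof -
  have "0 \<le> (\<Sum>J. sqrt (LINT x|M. (f k J x)\<^sup>2))"
    "0 \<le> (\<Sum>J. sqrt (LINT x|M. (norm (gradient (f k J) x))\<^sup>2))"
    "0 \<le> (\<Sum>J. sqrt (LINT x|M. (laplacian (f k J) x)\<^sup>2))"
    by (intro suminf_nonneg summables; simp)+
  then show "(\<Sum>J. sqrt (LINT x|M. (f k J x)\<^sup>2)) \<le> norm_total k"
    "(\<Sum>J. sqrt (LINT x|M. (norm (gradient (f k J) x))\<^sup>2)) \<le> norm_total k"
    "(\<Sum>J. sqrt (LINT x|M. (laplacian (f k J) x)\<^sup>2)) \<le> norm_total k" "0 \<le> norm_total k"
    unfolding norm_total_def by linarith+
qed

lemma coeff_pos: "0 < coeff k"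
  unfolding coeff_def using L1_const norm_total_bounds(4)[of k] singular_block.\<delta>[OF block, of k]
  by (intro mult_pos_pos divide_pos_pos add_pos_nonneg) auto

lemma coeff_bound: "coeff k * (L1_const * norm_total k) \<le> (1/2) ^ k * min 1 (\<delta> k ^ DIM('a))"
proof -
  let ?t = "L1_const * norm_total k"
  have t: "0 \<le> ?t" using L1_const norm_total_bounds(4)[of k] by simp
  have d: "0 \<le> min 1 (\<delta> k ^ DIM('a))" using singular_block.\<delta>[OF block, of k] by simp
  have "coeff k * ?t = (1/2) ^ k * min 1 (\<delta> k ^ DIM('a)) * (?t / (1 + ?t))"
    unfolding coeff_def by simp
  also have "\<dots> \<le> (1/2) ^ k * min 1 (\<delta> k ^ DIM('a)) * 1"
    using t d by (intro mult_left_mono) auto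
  finally show ?thesis by simp
qed

lemma coeff_bound1: "0 \<le> t \<Longrightarrow> t \<le> norm_total k \<Longrightarrow> coeff k * t \<le> (1/2) ^ k"
proof -
  assume t: "0 \<le> t" "t \<le> norm_total k"
  have "t \<le> L1_const * norm_total k"
    using mult_right_mono[OF L1_const norm_total_bounds(4)[of k]] t by simp
  then have "coeff k * t \<le> coeff k * (L1_const * norm_total k)"
    using coeff_pos[of k] by (intro mult_left_mono) auto
  also have "\<dots> \<le> (1/2) ^ k * min 1 (\<delta> k ^ DIM('a))" by (rule coeff_bound)
  also have "\<dots> \<le> (1/2) ^ k * 1" by (intro mult_left_mono) auto
  finally show ?thesis by simp
qed

lemma term_fun_encode: "term_fun (prod_encode (k, J)) = (\<lambda>x. coeff k * f k J x)"
  by (simp add: term_fun_def fun_eq_iff)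

lemma term_fun_cases:
  obtains k J where "prod_decode n = (k, J)" "term_fun n = (\<lambda>x. coeff k * f k J x)"
  by (cases "prod_decode n") (auto simp: term_fun_def fun_eq_iff)

lemma test_term: "test_function \<Omega> (term_fun n)"
  by (rule term_fun_cases[of n]) (simp add: test_function_mult[OF test_f smooth_const])

lemma term_nonneg: "0 \<le> term_fun n x"
  by (rule term_fun_cases[of n]) (simp add: coeff_pos less_imp_le singular_block.nonneg[OF block])

lemma weighted_summable:
  assumes "\<And>k J. 0 \<le> a k J" "\<And>k. summable (a k)" "\<And>k. (\<Sum>J. a k J) \<le> norm_total k"
  shows "summable (\<lambda>n. case prod_decode n of (k, J) \<Rightarrow> coeff k * a k J)"
proof (rule summable_prod_decode)
  show "0 \<le> coeff k * a k J" for k J using coeff_pos[of k] assms(1)[of k J] by simp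
  show "summable (\<lambda>J. coeff k * a k J)" for k using assms(2) by (rule summable_mult)
  have eq: "(\<Sum>J. coeff k * a k J) = coeff k * (\<Sum>J. a k J)" for k
    using assms(2) by (rule suminf_mult)
  have "0 \<le> (\<Sum>J. a k J)" for k using assms by (intro suminf_nonneg)
  then have "norm (\<Sum>J. coeff k * a k J) \<le> (1/2) ^ k" for k
    unfolding eq using coeff_bound1[OF _ assms(3)] coeff_pos[of k] by (simp add: abs_mult)
  then show "summable (\<lambda>k. \<Sum>J. coeff k * a k J)"
    by (intro summable_comparison_test[OF _ summable_geometric[of "1/2 :: real"]]) auto
qed

lemma term_summable:
  shows "summable (\<lambda>n. sqrt (LINT x|M. (term_fun n x)\<^sup>2))" (is ?t0)
    and "summable (\<lambda>n. sqrt (LINT x|M. (norm (gradient (term_fun n) x))\<^sup>2))" (is ?t1)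
    and "summable (\<lambda>n. sqrt (LINT x|M. (laplacian (term_fun n) x)\<^sup>2))" (is ?t2)
proof -
  have c: "sqrt (LINT x|M. (coeff k)\<^sup>2 * h x) = coeff k * sqrt (LINT x|M. h x)" for k and h :: "'a \<Rightarrow> real"
    using coeff_pos[of k] by (simp add: real_sqrt_mult less_imp_le)
  have sf: "smooth (f k J)" for k J by (rule test_function_smooth[OF test_f])
  have "sqrt (LINT x|M. (term_fun n x)\<^sup>2)
     = (case prod_decode n of (k, J) \<Rightarrow> coeff k * sqrt (LINT x|M. (f k J x)\<^sup>2))" for n
    by (rule term_fun_cases[of n]) (simp add: power_mult_distrib c del: integral_mult_right_zero)
  then show ?t0
    using weighted_summable[OF _ summables(1) norm_total_bounds(1)] by simp
  have "sqrt (LINT x|M. (norm (gradient (term_fun n) x))\<^sup>2)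
     = (case prod_decode n of (k, J) \<Rightarrow> coeff k * sqrt (LINT x|M. (norm (gradient (f k J) x))\<^sup>2))" for n
    by (rule term_fun_cases[of n])
      (simp add: gradient_cmult[OF sf] power_mult_distrib c del: integral_mult_right_zero)
  then show ?t1
    using weighted_summable[OF _ summables(2) norm_total_bounds(2)] by simp
  have "sqrt (LINT x|M. (laplacian (term_fun n) x)\<^sup>2)
     = (case prod_decode n of (k, J) \<Rightarrow> coeff k * sqrt (LINT x|M. (laplacian (f k J) x)\<^sup>2))" for n
    by (rule term_fun_cases[of n])
      (simp add: laplacian_cmult[OF sf] power_mult_distrib c del: integral_mult_right_zero)
  then show ?t2
    using weighted_summable[OF _ summables(3) norm_total_bounds(3)] by simp
qed

text \<open>\<open>sol\<close> is a real \<open>suminf\<close>, with no meaningful value where the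
  series diverges. Summability of the L^2 norms gives convergence almost everywhere, and there
  nonnegativity puts each term below the sum.\<close>

lemma sol_ge_term: "AE x in lebesgue. x \<in> \<Omega> \<longrightarrow> (\<forall>n. term_fun n x \<le> sol x)"
proof -
  have L2: "L2_on \<Omega> (term_fun n)" for n by (rule L2_on_test_function[OF test_term \<Omega>_sets])
  have sN: "summable (\<lambda>n. sqrt (LINT x|M. (norm (term_fun n x))\<^sup>2))" using term_summable(1) by simp
  obtain D :: "'a \<Rightarrow> real" where
    "AE x in M. summable (\<lambda>n. norm (term_fun n x)) \<and> (\<forall>n. norm (\<Sum>i<n. term_fun i x) \<le> D x)"
    by (rule L2_on_series_dominated[OF L2 sN])
  then have "AE x in M. \<forall>n. term_fun n x \<le> sol x"
  proof eventually_elim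
    case (elim x)
    then have s: "summable (\<lambda>n. term_fun n x)" by (auto intro: summable_rabs_cancel)
    have "term_fun n x \<le> sol x" for n
      unfolding sol_def using sum_le_suminf[OF s, of "{n}"] term_nonneg by simp
    then show ?case by blast
  qed
  then show ?thesis using \<Omega>_sets by (subst (asm) AE_restrict_space_iff) auto
qed

text \<open>Valid at every point: where the real series diverges the right-hand side is infinite, so
  the value of \<open>sol\<close> there is harmless.\<close>

lemma sol_le_suminf: "ennreal (sol x) \<le> (\<Sum>n. ennreal (term_fun n x))"
proof (cases "(\<Sum>n. ennreal (term_fun n x)) = top")
  case False
  then have "summable (\<lambda>n. term_fun n x)" by (rule summable_suminf_not_top[OF term_nonneg])
  then have "(\<Sum>n. ennreal (term_fun n x)) = ennreal (sol x)"
    unfolding sol_def by (intro suminf_ennreal_eq term_nonneg summable_sums)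
  then show ?thesis by simp
qed simp

section \<open>Upper bound: no singularities outside a null set\<close>

definition enlarged :: "nat \<Rightarrow> 'a set" where
  "enlarged k = {x. \<exists>y\<in>K k. dist x y \<le> \<delta> k}"

definition exceptional :: "'a set" where
  "exceptional = (\<Union>k. Z k) \<union> (\<Inter>m. \<Union>k. enlarged (k + m))"

text \<open>A Borel-Cantelli argument: the enlarged supports from index m on have a common cover of
  weight at most 2^(-m).\<close>

lemma exceptional_null: "hausdorff_measure (real DIM('a) - 4) exceptional = 0"
proof (rule hausdorff_measure_eq_0)
  let ?t = "real DIM('a) - 4"
  fix \<eta> :: real assume \<eta>: "0 < \<eta>"
  have Z: "small_cover ?t \<eta> (\<Union>k. Z k)" if "0 < \<eta>" for \<eta>
    using that by (intro small_cover_UN singular_block.null[OF block]) auto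
  have E: "small_cover ?t \<eta> (\<Inter>m. \<Union>k. enlarged (k + m))" if pos: "0 < \<eta>" for \<eta>
  proof -
    obtain m where m: "(1/2) ^ m < \<eta>" using real_arch_pow_inv[OF pos, of "1/2"] by auto
    have "small_cover ?t ((1/2) ^ m * (1/2) ^ Suc k) (enlarged (k + m))" for k
      using singular_block.cover[OF block, of "k + m"]
      by (simp add: enlarged_def power_add mult.commute mult.left_commute)
    then have "small_cover ?t ((1/2) ^ m) (\<Union>k. enlarged (k + m))"
      by (intro small_cover_UN) auto
    then have "small_cover ?t \<eta> (\<Union>k. enlarged (k + m))"
      by (rule small_cover_mono) (use m in simp)
    then show ?thesis by (rule small_cover_subset) blast
  qed
  \<comment> \<open>A union of two sets written as a sequence, the second repeated, to reuse the
    lemma on countable unions.\<close>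
  define X where "X k = (if k = (0::nat) then (\<Union>k. Z k) else (\<Inter>m. \<Union>k. enlarged (k + m)))" for k
  have "small_cover ?t \<eta> (\<Union>k. X k)"
  proof (rule small_cover_UN[OF _ \<eta>])
    fix k
    have p: "0 < \<eta> * (1/2) ^ Suc k" using \<eta> by simp
    show "small_cover ?t (\<eta> * (1/2) ^ Suc k) (X k)"
    proof (cases "k = 0")
      case True
      then have "X k = (\<Union>k. Z k)" by (simp add: X_def)
      then show ?thesis using Z[OF p] by (simp only:)
    next
      case False
      then have "X k = (\<Inter>m. \<Union>k. enlarged (k + m))" by (simp add: X_def)
      then show ?thesis using E[OF p] by (simp only:)
    qed
  qed
  moreover have "exceptional = X 0 \<union> X 1" unfolding exceptional_def X_def by simp
  then have "exceptional \<subseteq> (\<Union>k. X k)" by blast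
  ultimately show "small_cover ?t \<eta> exceptional" by (rule small_cover_subset)
qed

lemma suminf_terms: "(\<Sum>n. ennreal (term_fun n x)) = (\<Sum>k. \<Sum>J. ennreal (coeff k * f k J x))"
proof -
  have "(\<Sum>n. ennreal (term_fun n x)) = (\<Sum>n. (\<lambda>(k, J). ennreal (coeff k * f k J x)) (prod_decode n))"
    by (simp add: term_fun_def case_prod_beta)
  then show ?thesis by (simp only:) (rule suminf_ennreal_2dimen, simp)
qed

lemma f_nonneg: "0 \<le> f k J x" by (rule singular_block.nonneg[OF block])

text \<open>Near a point outside \<open>Z k\<close> only finitely many terms of the k-th series are
  nonzero, and each is bounded. The radius shrinks with every further k, which is why only a finite
  head can be treated in this way.\<close>

lemma head_bounded:
  assumes "\<And>k. a \<notin> Z k"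
  shows "\<exists>\<rho>>0. \<exists>L\<ge>0. \<forall>x\<in>ball a \<rho>. (\<Sum>k<m. \<Sum>J. ennreal (coeff k * f k J x)) \<le> ennreal L"
proof (induction m)
  case 0
  show ?case by (intro exI[of _ 1] conjI exI[of _ 0]) auto
next
  case (Suc m)
  then obtain \<rho> L where \<rho>: "0 < \<rho>" "0 \<le> L"
    "\<And>x. x \<in> ball a \<rho> \<Longrightarrow> (\<Sum>k<m. \<Sum>J. ennreal (coeff k * f k J x)) \<le> ennreal L" by blast
  obtain r n where r: "0 < r" "\<And>J x. n \<le> J \<Longrightarrow> x \<in> ball a r \<Longrightarrow> f m J x = 0"
    using singular_block.locally_finite[OF block assms, of m] by blast
  have "\<exists>b. \<forall>x. f m J x \<le> b" for J
  proof -
    obtain C where "smooth (f m J)" "compact C" "\<And>x. x \<notin> C \<Longrightarrow> f m J x = 0"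
      using test_f[of m J] unfolding test_function_iff by blast
    from compact_support_bounded[OF this] show ?thesis by (metis abs_le_D1)
  qed
  then obtain b where b: "\<And>J x. f m J x \<le> b J" by metis
  define L' where "L' = (\<Sum>J<n. coeff m * b J)"
  have cb: "0 \<le> coeff m * b J" for J
    using order_trans[OF f_nonneg[of m J undefined] b[of J undefined]] coeff_pos[of m] by simp
  have L': "0 \<le> L'" unfolding L'_def by (intro sum_nonneg cb)
  have "(\<Sum>J. ennreal (coeff m * f m J x)) \<le> ennreal L'" if x: "x \<in> ball a r" for x
  proof -
    have "(\<Sum>J. ennreal (coeff m * f m J x)) = (\<Sum>J<n. ennreal (coeff m * f m J x))"
      using r(2)[OF _ x] by (intro suminf_finite) (auto simp: not_less)
    also have "\<dots> \<le> (\<Sum>J<n. ennreal (coeff m * b J))"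
      using coeff_pos[of m] by (intro sum_mono ennreal_leI mult_left_mono b) simp
    also have "\<dots> = ennreal L'" unfolding L'_def by (intro sum_ennreal cb)
    finally show ?thesis .
  qed
  then have "(\<Sum>k<Suc m. \<Sum>J. ennreal (coeff k * f k J x)) \<le> ennreal (L + L')"
    if "x \<in> ball a (min \<rho> r)" for x
    using that \<rho>(2) L' by (simp add: add_mono[OF \<rho>(3)])
  then show ?case using \<rho> r(1) L' by (intro exI[of _ "min \<rho> r"] conjI exI[of _ "L + L'"]) auto
qed

text \<open>The integral of each term is controlled by its L^2 norm, which \<open>norm_total\<close>
  already contains; the coefficient was chosen for this product.\<close>

lemma block_mass:
  "(\<integral>\<^sup>+x. (\<Sum>J. ennreal (coeff k * f k J x)) \<partial>lborel) \<le> ennreal ((1/2) ^ k * \<delta> k ^ DIM('a))"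
proof -
  have meas: "f k J \<in> borel_measurable borel" for J
    by (rule smooth_borel[OF test_function_smooth[OF test_f]])
  have int: "integrable lborel (f k J) \<and> (LINT x|M. f k J x) = integral\<^sup>L lborel (f k J)" for J
  proof -
    obtain C where C: "smooth (f k J)" "compact C" "C \<subseteq> \<Omega>" "\<And>x. x \<notin> C \<Longrightarrow> f k J x = 0"
      using test_f[of k J] unfolding test_function_iff by blast
    have "f k J x = 0" if "x \<notin> \<Omega>" for x using that C(3,4) by auto
    from integral_lebesgue_on_compact_support(1)[OF meas this \<Omega>_sets] show ?thesis
      using compact_support_integrable[OF C(1,2,4)] by simp
  qed
  let ?a = "\<lambda>J. sqrt (LINT x|M. (f k J x)\<^sup>2)"
  have "(\<integral>\<^sup>+x. (\<Sum>J. ennreal (coeff k * f k J x)) \<partial>lborel) = (\<Sum>J. \<integral>\<^sup>+x. ennreal (coeff k * f k J x) \<partial>lborel)"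
    using meas by (intro nn_integral_suminf) auto
  also have "\<dots> \<le> (\<Sum>J. ennreal (coeff k * (L1_const * ?a J)))"
  proof (intro suminf_le)
    fix J
    have "(\<integral>\<^sup>+x. ennreal (coeff k * f k J x) \<partial>lborel) = ennreal (coeff k * integral\<^sup>L lborel (f k J))"
      using int[of J] coeff_pos[of k] f_nonneg by (subst nn_integral_eq_integral) (auto simp: less_imp_le)
    also have "\<dots> \<le> ennreal (coeff k * (L1_const * ?a J))"
      using test_function_L1_le_L2[OF test_f f_nonneg \<Omega>_lmeasurable, of k J] int[of J] coeff_pos[of k]
      by (intro ennreal_leI mult_left_mono) (auto simp: L1_const_def)
    finally show "(\<integral>\<^sup>+x. ennreal (coeff k * f k J x) \<partial>lborel) \<le> ennreal (coeff k * (L1_const * ?a J))" .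
  qed auto
  also have "\<dots> = ennreal (coeff k * (L1_const * (\<Sum>J. ?a J)))"
  proof (rule suminf_ennreal_eq)
    show "0 \<le> coeff k * (L1_const * ?a J)" for J using coeff_pos[of k] L1_const by simp
    show "(\<lambda>J. coeff k * (L1_const * ?a J)) sums (coeff k * (L1_const * (\<Sum>J. ?a J)))"
      by (intro sums_mult summable_sums summables)
  qed
  also have "\<dots> \<le> ennreal ((1/2) ^ k * \<delta> k ^ DIM('a))"
  proof (rule ennreal_leI)
    have "coeff k * (L1_const * (\<Sum>J. ?a J)) \<le> coeff k * (L1_const * norm_total k)"
      using coeff_pos[of k] L1_const norm_total_bounds(1)[of k] by (intro mult_left_mono) auto
    also have "\<dots> \<le> (1/2) ^ k * min 1 (\<delta> k ^ DIM('a))" by (rule coeff_bound)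
    also have "\<dots> \<le> (1/2) ^ k * \<delta> k ^ DIM('a)" by (intro mult_left_mono) auto
    finally show "coeff k * (L1_const * (\<Sum>J. ?a J)) \<le> (1/2) ^ k * \<delta> k ^ DIM('a)" .
  qed
  finally show ?thesis .
qed

text \<open>
  A block with index \<open>k\<close> meets the ball of radius \<open>r\<close> only if \<open>r > \<delta> k\<close>, and then its
  total mass is at most \<open>2\<^sup>-\<^sup>k r\<^sup>N\<close> by the choice of the coefficients.
\<close>

lemma tail_mass:
  assumes a: "\<And>k. a \<notin> enlarged (k + m)" and r: "0 < r"
  shows "(\<integral>\<^sup>+x. (\<Sum>k. \<Sum>J. ennreal (coeff (k + m) * f (k + m) J x)) * indicator (ball a r) x \<partial>lborel)
    \<le> ennreal (2 * r ^ DIM('a))"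
proof -
  let ?h = "\<lambda>k x. \<Sum>J. ennreal (coeff k * f k J x)"
  have meas[measurable]: "f k J \<in> borel_measurable borel" for k J
    by (rule smooth_borel[OF test_function_smooth[OF test_f]])
  have [measurable]: "ball a r \<in> sets borel" by simp
  have "(\<integral>\<^sup>+x. (\<Sum>k. ?h (k + m) x) * indicator (ball a r) x \<partial>lborel)
      = (\<integral>\<^sup>+x. (\<Sum>k. ?h (k + m) x * indicator (ball a r) x) \<partial>lborel)"
    by (simp add: ennreal_suminf_multc)
  also have "\<dots> = (\<Sum>k. \<integral>\<^sup>+x. ?h (k + m) x * indicator (ball a r) x \<partial>lborel)"
    by (intro nn_integral_suminf) measurable
  also have "\<dots> \<le> (\<Sum>k. ennreal ((1/2) ^ k * r ^ DIM('a)))"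
  proof (intro suminf_le)
    fix k
    show "(\<integral>\<^sup>+x. ?h (k + m) x * indicator (ball a r) x \<partial>lborel) \<le> ennreal ((1/2) ^ k * r ^ DIM('a))"
    proof (cases "r \<le> \<delta> (k + m)")
      case True
      have "?h (k + m) x * indicator (ball a r) x = 0" for x
      proof (cases "x \<in> ball a r")
        case x: True
        have "x \<notin> K (k + m)"
        proof
          assume "x \<in> K (k + m)"
          moreover have "dist a x \<le> \<delta> (k + m)" using x True by simp
          ultimately show False using a[of k] unfolding enlarged_def by blast
        qed
        then have "f (k + m) J x = 0" for J by (rule singular_block.support[OF block])
        then show ?thesis by simp
      qed simp
      then show ?thesis by (simp only: nn_integral_const mult_zero_left zero_le)
    next
      case False
      have "(\<integral>\<^sup>+x. ?h (k + m) x * indicator (ball a r) x \<partial>lborel) \<le> (\<integral>\<^sup>+x. ?h (k + m) x \<partial>lborel)"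
        by (intro nn_integral_mono) (auto simp: indicator_def)
      also have "\<dots> \<le> ennreal ((1/2) ^ (k + m) * \<delta> (k + m) ^ DIM('a))" by (rule block_mass)
      also have "\<dots> \<le> ennreal ((1/2) ^ k * r ^ DIM('a))"
        using False singular_block.\<delta>[OF block, of "k + m"]
        by (intro ennreal_leI mult_mono power_mono power_decreasing) auto
      finally show ?thesis .
    qed
  qed auto
  also have "\<dots> = ennreal (2 * r ^ DIM('a))"
  proof (rule suminf_ennreal_eq)
    show "(\<lambda>k. (1/2) ^ k * r ^ DIM('a)) sums (2 * r ^ DIM('a))"
      using sums_mult2[OF geometric_sums[of "1/2 :: real"], of "r ^ DIM('a)"] by simp
  qed (use r in simp)
  finally show ?thesis .
qed

text \<open>On \<open>ball a r\<close> the lower bound is at least C r^(-\<gamma>). Integrating and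
  dividing by r^N gives C V r^(-\<gamma>) \<le> L V + 2, where L comes from the bounded head and 2
  from the tail, both independent of r. This fails for small r.\<close>

lemma not_singular:
  assumes a: "a \<notin> exceptional" and C: "0 < C" "0 < \<gamma>" "0 < R"
    and ae: "AE x in lebesgue. x \<in> ball a R \<longrightarrow> C * norm (x - a) powr (- \<gamma>) \<le> sol x"
  shows False
proof -
  let ?h = "\<lambda>k x. \<Sum>J. ennreal (coeff k * f k J x)" and ?N = "DIM('a)"
  have meas[measurable]: "f k J \<in> borel_measurable borel" for k J
    by (rule smooth_borel[OF test_function_smooth[OF test_f]])
  have aZ: "a \<notin> Z k" for k using a by (auto simp: exceptional_def)
  obtain m where m: "\<And>k. a \<notin> enlarged (k + m)" using a by (auto simp: exceptional_def)
  obtain \<rho> L where \<rho>: "0 < \<rho>" "0 \<le> L" "\<And>x. x \<in> ball a \<rho> \<Longrightarrow> (\<Sum>k<m. ?h k x) \<le> ennreal L"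
    using head_bounded[OF aZ, of m] by blast
  define V where "V = unit_ball_vol (real ?N)"
  have V: "0 < V" by (simp add: V_def)
  have bound: "C * r powr (- \<gamma>) * V \<le> L * V + 2" if r: "0 < r" "r \<le> \<rho>" "r \<le> R" for r
  proof -
    have [measurable]: "ball a r \<in> sets borel" by simp
    have vol: "emeasure lborel (ball a r) = ennreal (V * r ^ ?N)"
      using r by (simp add: emeasure_ball V_def)
    have "ennreal (C * r powr (- \<gamma>)) * emeasure lborel (ball a r)
        = (\<integral>\<^sup>+x. ennreal (C * r powr (- \<gamma>)) * indicator (ball a r) x \<partial>lebesgue)"
      unfolding nn_integral_completion by (rule nn_integral_cmult_indicator[symmetric]) simp
    also have "\<dots> \<le> (\<integral>\<^sup>+x. (\<Sum>n. ennreal (term_fun n x)) * indicator (ball a r) x \<partial>lebesgue)"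
    proof (rule nn_integral_mono_AE)
      \<comment> \<open>The centre has to be left out because \<open>0 powr (- \<gamma>)\<close> is
        0 in HOL.\<close>
      have "AE x in lborel. x \<noteq> a" by (rule AE_lborel_singleton)
      then have "AE x in lebesgue. x \<noteq> a" by (rule AE_completion)
      then show "AE x in lebesgue. ennreal (C * r powr (- \<gamma>)) * indicator (ball a r) x
          \<le> (\<Sum>n. ennreal (term_fun n x)) * indicator (ball a r) x"
        using ae
      proof eventually_elim
        case (elim x)
        show ?case
        proof (cases "x \<in> ball a r")
          case True
          then have n: "0 < norm (x - a)" "norm (x - a) \<le> r" using elim
            by (auto simp: dist_norm norm_minus_commute)
          have "C * r powr (- \<gamma>) \<le> C * norm (x - a) powr (- \<gamma>)"
            using C n by (intro mult_left_mono powr_mono2') auto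
          also have "\<dots> \<le> sol x" using elim True r by auto
          finally have "ennreal (C * r powr (- \<gamma>)) \<le> ennreal (sol x)" by (rule ennreal_leI)
          also have "\<dots> \<le> (\<Sum>n. ennreal (term_fun n x))" by (rule sol_le_suminf)
          finally show ?thesis using True by simp
        qed simp
      qed
    qed
    also have "\<dots> = (\<integral>\<^sup>+x. (\<Sum>k. ?h k x) * indicator (ball a r) x \<partial>lborel)"
      by (simp add: nn_integral_completion suminf_terms)
    also have "\<dots> \<le> (\<integral>\<^sup>+x. ennreal L * indicator (ball a r) x
        + (\<Sum>k. ?h (k + m) x) * indicator (ball a r) x \<partial>lborel)"
    proof (rule nn_integral_mono)
      fix x
      have "(\<Sum>k. ?h k x) = (\<Sum>k. ?h (k + m) x) + (\<Sum>k<m. ?h k x)"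
        by (rule suminf_offset) auto
      then show "(\<Sum>k. ?h k x) * indicator (ball a r) x \<le> ennreal L * indicator (ball a r) x
          + (\<Sum>k. ?h (k + m) x) * indicator (ball a r) x"
        using \<rho>(3)[of x] r(2) by (cases "x \<in> ball a r") (auto simp: add.commute intro: add_left_mono)
    qed
    also have "\<dots> = (\<integral>\<^sup>+x. ennreal L * indicator (ball a r) x \<partial>lborel)
        + (\<integral>\<^sup>+x. (\<Sum>k. ?h (k + m) x) * indicator (ball a r) x \<partial>lborel)"
      by (intro nn_integral_add) measurable
    also have "\<dots> \<le> ennreal L * emeasure lborel (ball a r) + ennreal (2 * r ^ ?N)"
      by (intro add_mono tail_mass m r) (simp add: nn_integral_cmult_indicator)
    finally have "ennreal (C * r powr (- \<gamma>) * (V * r ^ ?N)) \<le> ennreal (L * (V * r ^ ?N) + 2 * r ^ ?N)"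
      using C r \<rho>(2) V unfolding vol by (simp add: ennreal_mult)
    then have "C * r powr (- \<gamma>) * (V * r ^ ?N) \<le> L * (V * r ^ ?N) + 2 * r ^ ?N"
      using r \<rho>(2) V by (subst (asm) ennreal_le_iff) auto
    then have "(C * r powr (- \<gamma>) * V) * r ^ ?N \<le> (L * V + 2) * r ^ ?N" by (simp add: algebra_simps)
    then show ?thesis using r by simp
  qed
  \<comment> \<open>Chosen so that C V / q = L V + 3 exceeds the bound L V + 2; \<open>r\<close> is
    then taken so small that r^(-\<gamma>) \<ge> 1 / q.\<close>
  define q where "q = C * V / (L * V + 3)"
  have LV: "0 \<le> L * V" using \<rho>(2) V by simp
  have q: "0 < q" unfolding q_def using C V LV by simp
  define r where "r = min (min \<rho> R) (q powr (1 / \<gamma>))"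
  have r: "0 < r" "r \<le> \<rho>" "r \<le> R" "r \<le> q powr (1 / \<gamma>)" using \<rho>(1) C q by (auto simp: r_def)
  have "(q powr (1 / \<gamma>)) powr (- \<gamma>) \<le> r powr (- \<gamma>)"
    using r C by (intro powr_mono2') auto
  moreover have "(q powr (1 / \<gamma>)) powr (- \<gamma>) = 1 / q"
    using C q by (simp add: powr_powr powr_minus_divide)
  ultimately have "C * V * (1 / q) \<le> C * V * r powr (- \<gamma>)" using C V by (intro mult_left_mono) auto
  moreover have "C * V * (1 / q) = L * V + 3" using C V LV by (simp add: q_def)
  ultimately show False using bound[OF r(1,2,3)] by (simp add: mult.assoc mult.left_commute mult.commute)
qed

text \<open>The condition at a singular point only concerns u up to null sets, so \<open>sol\<close>
  may replace u and \<open>not_singular\<close> applies.\<close>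

lemma sing_set_subset:
  assumes W: "W \<subseteq> \<Omega>" and u: "AE x in M. u x = sol x"
  shows "sing_set W (\<lambda>x. ereal (u x)) \<subseteq> exceptional"
proof
  fix a assume "a \<in> sing_set W (\<lambda>x. ereal (u x))"
  then obtain C \<gamma> r where C: "0 < C" "0 < \<gamma>" "0 < r" "ball a r \<subseteq> W"
    "AE x in lebesgue. x \<in> ball a r \<longrightarrow> ereal (C * norm (x - a) powr (- \<gamma>)) \<le> ereal (u x)"
    unfolding sing_set_def by blast
  have "AE x in lebesgue. x \<in> \<Omega> \<longrightarrow> u x = sol x"
    using u \<Omega>_sets by (subst (asm) AE_restrict_space_iff) auto
  with C(5) have "AE x in lebesgue. x \<in> ball a r \<longrightarrow> C * norm (x - a) powr (- \<gamma>) \<le> sol x"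
    by eventually_elim (use C(4) W in auto)
  then show "a \<in> exceptional" using not_singular[OF _ C(1,2,3)] by blast
qed

text \<open>One term of the series times its coefficient already supplies the singular lower bound,
  since the sum dominates each of its terms. The index of the term varies with x while the constants
  do not.\<close>

lemma subset_sing_set:
  assumes W: "B k \<subseteq> W" "W \<subseteq> \<Omega>" and u: "AE x in M. u x = sol x"
  shows "A k \<subseteq> sing_set W (\<lambda>x. ereal (u x))"
proof
  fix a assume a: "a \<in> A k"
  then have aB: "a \<in> B k" using singular_block.A_sub[OF block] by blast
  obtain r0 where r0: "0 < r0" "ball a r0 \<subseteq> B k" using B(1) aB openE by blast
  obtain C \<gamma> r1 where C: "0 < C" "0 < \<gamma>" "0 < r1"
    "\<And>x. x \<in> ball a r1 - {a} \<Longrightarrow> \<exists>J. C * norm (x - a) powr (- \<gamma>) \<le> f k J x"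
    using singular_block.blow_up[OF block a] by metis
  let ?r = "min r0 r1"
  have "AE x in lebesgue. x \<in> \<Omega> \<longrightarrow> u x = sol x"
    using u \<Omega>_sets by (subst (asm) AE_restrict_space_iff) auto
  moreover have "AE x in lebesgue. x \<noteq> a" by (rule AE_completion[OF AE_lborel_singleton])
  ultimately have "AE x in lebesgue. x \<in> ball a ?r \<longrightarrow> ereal (coeff k * C * norm (x - a) powr (- \<gamma>)) \<le> ereal (u x)"
    using sol_ge_term
  proof eventually_elim
    case (elim x)
    show ?case
    proof
      assume x: "x \<in> ball a ?r"
      then have "x \<in> ball a r1 - {a}" using elim by auto
      then obtain J where J: "C * norm (x - a) powr (- \<gamma>) \<le> f k J x" using C(4) by blast
      have "x \<in> \<Omega>" using x r0(2) B(2)[of k] by auto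
      have "coeff k * (C * norm (x - a) powr (- \<gamma>)) \<le> coeff k * f k J x"
        using J coeff_pos[of k] by (intro mult_left_mono) auto
      also have "\<dots> = term_fun (prod_encode (k, J)) x" by (simp add: term_fun_encode)
      also have "\<dots> \<le> u x" using elim \<open>x \<in> \<Omega>\<close> by simp
      finally show "ereal (coeff k * C * norm (x - a) powr (- \<gamma>)) \<le> ereal (u x)"
        by (simp add: mult.assoc)
    qed
  qed
  moreover have "ball a ?r \<subseteq> W" using r0 W(1) by auto
  moreover have "a \<in> W" using aB W(1) by blast
  moreover have "0 < coeff k * C" "0 < ?r" using coeff_pos[of k] C r0 by auto
  ultimately show "a \<in> sing_set W (\<lambda>x. ereal (u x))"
    unfolding sing_set_def using C(2) by blast
qed

text \<open>The dimension equals N - 4 for every radius, so the limit is that of a constant. Every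
  ball around a point of the closure meets \<Omega> in an open set containing a smaller ball, which
  is how boundary points are reached.\<close>

lemma sing_dim_eq:
  assumes a: "a \<in> closure \<Omega>" and u: "AE x in M. u x = sol x"
  shows "sing_dim \<Omega> (\<lambda>x. ereal (u x)) a = ereal (real DIM('a) - 4)"
proof -
  let ?d = "\<lambda>r. hausdorff_dim (sing_set (ball a r \<inter> \<Omega>) (\<lambda>x. ereal (u x)))"
  have eq: "?d r = ereal (real DIM('a) - 4)" if r: "0 < r" for r
  proof (rule antisym)
    have "?d r \<le> hausdorff_dim exceptional"
      by (intro hausdorff_dim_mono sing_set_subset u) auto
    also have "\<dots> \<le> ereal (real DIM('a) - 4)"
      using DIM by (intro hausdorff_dim_le exceptional_null) auto
    finally show "?d r \<le> ereal (real DIM('a) - 4)" .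
    obtain x where x: "x \<in> \<Omega>" "dist x a < r" using a r unfolding closure_approachable by blast
    have "open (ball a r \<inter> \<Omega>)" using open_\<Omega> by auto
    moreover have "x \<in> ball a r \<inter> \<Omega>" using x by (simp add: dist_commute)
    ultimately obtain r' where r': "0 < r'" "ball x r' \<subseteq> ball a r \<inter> \<Omega>" by (rule openE)
    show "ereal (real DIM('a) - 4) \<le> ?d r"
    \<comment> \<open>Blocks are only guaranteed with dimension above each t < N - 4, so the bound
      is obtained as a supremum.\<close>
    proof (rule dense_le)
      fix y assume y: "y < ereal (real DIM('a) - 4)"
      show "y \<le> ?d r"
      proof (cases y)
        case (real t)
        then obtain k where k: "B k \<subseteq> ball x r'" "t < s k"
          using dense[OF r'(1), of x t] r'(2) y by auto
        have "y \<le> ereal (s k)" using k real by simp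
        also have "\<dots> \<le> hausdorff_dim (A k)" by (rule singular_block.dim[OF block])
        also have "\<dots> \<le> ?d r" using k r' by (intro hausdorff_dim_mono subset_sing_set u) auto
        finally show ?thesis .
      qed (use y in auto)
    qed
  qed
  have "\<forall>\<^sub>F r in at_right 0. ?d r = ereal (real DIM('a) - 4)"
    unfolding eventually_at_right_field using eq by (intro exI[of _ 1]) auto
  then have "(?d \<longlongrightarrow> ereal (real DIM('a) - 4)) (at_right 0)" by (rule tendsto_eventually)
  then show ?thesis
    using tendsto_unique[OF trivial_limit_at_right_real tendsto_sing_dim] by blast
qed

lemma maximally_singular_solution:
  "\<exists>F :: 'a \<Rightarrow> real. L2_on \<Omega> F \<and> (\<exists>u. weak_solution \<Omega> F u) \<and>
    (\<forall>u. weak_solution \<Omega> F u \<longrightarrow>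
       (\<forall>a \<in> closure \<Omega>. sing_dim \<Omega> (\<lambda>x. ereal (u x)) a = ereal (real DIM('a) - 4)))"
proof -
  let ?F = "\<lambda>x. \<Sum>n. - laplacian (term_fun n) x"
  note w = weak_solution_series[OF \<Omega>_sets test_term term_summable]
  have sol: "weak_solution \<Omega> ?F sol" using w(2) by (simp add: sol_def[abs_def])
  have "AE x in M. u x = sol x" if "weak_solution \<Omega> ?F u" for u
    by (rule weak_solution_unique[OF \<Omega>_sets bounded_\<Omega> that sol])
  then show ?thesis using w(1) sol sing_dim_eq by blast
qed

end

text \<open>Centres in a countable dense set, rational radii and rational dimensions approximate
  every ball and every t < N - 4, so countably many blocks are enough.\<close>

lemma block_family_exists:
  fixes \<Omega> :: "'a::euclidean_space set"
  assumes N: "5 \<le> DIM('a)" and \<Omega>: "open \<Omega>" "bounded \<Omega>" "\<Omega> \<noteq> {}"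
  shows "\<exists>B A K Z s \<delta> f. block_family \<Omega> B A K Z s \<delta> f"
proof -
  let ?m = "real DIM('a) - 4"
  obtain D :: "'a set" where D: "countable D" "\<And>X. open X \<Longrightarrow> X \<noteq> {} \<Longrightarrow> \<exists>d\<in>D. d \<in> X"
    using countable_dense_exists by blast
  define I where "I = {(x, r, s). x \<in> D \<and> r \<in> \<rat> \<and> s \<in> \<rat> \<and> (0::real) < r \<and> (0::real) < s \<and> s < ?m \<and> ball x r \<subseteq> \<Omega>}"
  have cI: "countable I"
    by (rule countable_subset[of _ "D \<times> (\<rat> \<times> \<rat>)"]) (auto simp: I_def D countable_rat)
  have dense: "\<exists>(y, q, t')\<in>I. ball y q \<subseteq> ball x r \<and> t < t'" if r: "0 < r" "ball x r \<subseteq> \<Omega>" "t < ?m" for x r t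
  proof -
    obtain y where y: "y \<in> D" "y \<in> ball x (r / 2)" using D(2)[of "ball x (r / 2)"] r by auto
    obtain q where q: "q \<in> \<rat>" "0 < q" "q < r / 2" using Rats_dense_in_real[of 0 "r / 2"] r by auto
    \<comment> \<open>The maximum with 0 keeps the dimension positive, as
      \<open>singular_block_exists\<close> demands; N \<ge> 5 leaves room for it.\<close>
    have "max 0 t < ?m" using r N by auto
    then obtain t' where t': "t' \<in> \<rat>" "max 0 t < t'" "t' < ?m" using Rats_dense_in_real by blast
    have "ball y q \<subseteq> ball x r"
    proof
      fix z assume "z \<in> ball y q"
      then show "z \<in> ball x r" using y q dist_triangle[of x z y] by simp
    qed
    then show ?thesis using y q t' r by (intro bexI[of _ "(y, q, t')"]) (auto simp: I_def)
  qed
  obtain x0 where "x0 \<in> \<Omega>" using \<Omega> by blast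
  then obtain r0 where "0 < r0" "ball x0 r0 \<subseteq> \<Omega>" using \<Omega>(1) openE by blast
  then have "I \<noteq> {}" using dense[of r0 x0 0] N by auto
  then have range: "range (from_nat_into I) = I" using cI by (rule range_from_nat_into)
  define x r s where "x k = fst (from_nat_into I k)" and "r k = fst (snd (from_nat_into I k))"
    and "s k = snd (snd (from_nat_into I k))" for k
  have "from_nat_into I k \<in> I" for k using range by blast
  then have mem: "(x k, r k, s k) \<in> I" for k unfolding x_def r_def s_def by (simp only: prod.collapse)
  have \<Omega>s: "\<Omega> \<in> sets lebesgue" by (rule fmeasurableD[OF lmeasurable_open[OF \<Omega>(2,1)]])
  have "\<exists>A K Z \<delta> f. singular_block \<Omega> (ball (x k) (r k)) (s k) ((1/2) ^ Suc k) A K Z \<delta> f" for k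
    using mem[of k] by (intro singular_block_exists N \<Omega>s) (auto simp: I_def)
  then obtain A K Z \<delta> f where blk:
    "\<And>k. singular_block \<Omega> (ball (x k) (r k)) (s k) ((1/2) ^ Suc k) (A k) (K k) (Z k) (\<delta> k) (f k)"
    by metis
  have "block_family \<Omega> (\<lambda>k. ball (x k) (r k)) A K Z s \<delta> f"
  proof (rule block_family.intro)
    show "5 \<le> DIM('a)" "open \<Omega>" "bounded \<Omega>" by fact+
    show "singular_block \<Omega> (ball (x k) (r k)) (s k) ((1/2) ^ Suc k) (A k) (K k) (Z k) (\<delta> k) (f k)" for k
      by (rule blk)
    show "open (ball (x k) (r k))" for k by simp
    show "ball (x k) (r k) \<subseteq> \<Omega>" for k using mem[of k] by (simp add: I_def)
    show "\<exists>k. ball (x k) (r k) \<subseteq> ball y q \<and> t < s k"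
      if h: "0 < q" "ball y q \<subseteq> \<Omega>" "t < real DIM('a) - 4" for y q t
    proof -
      obtain y' q' t' where I: "(y', q', t') \<in> I" "ball y' q' \<subseteq> ball y q" "t < t'"
        using dense[OF h] by auto
      then obtain k where "from_nat_into I k = (y', q', t')" using range by (metis imageE)
      then show ?thesis using I by (intro exI[of _ k]) (simp add: x_def r_def s_def)
    qed
  qed
  then show ?thesis by blast
qed

theorem corollary1:
  fixes \<Omega> :: "'a::euclidean_space set"
  assumes "DIM('a) \<ge> 5"
    and "open \<Omega>" and "bounded \<Omega>" and "class_C2 \<Omega>"
  shows "\<exists>F :: 'a \<Rightarrow> real. L2_on \<Omega> F \<and>
    (\<exists>u. weak_solution \<Omega> F u) \<and>
    (\<forall>u. weak_solution \<Omega> F u \<longrightarrow>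
       (\<forall>a \<in> closure \<Omega>. sing_dim \<Omega> (\<lambda>x. ereal (u x)) a = ereal (real DIM('a) - 4)))"
proof (cases "\<Omega> = {}")
  case True
  \<comment> \<open>An empty domain has no balls to enumerate. The zero series provides the solution
    there, and the condition on the closure is vacuous.\<close>
  let ?g = "\<lambda>(n :: nat) (x :: 'a). 0 :: real"
  have "(LINT x|lebesgue_on \<Omega>. h x) = 0" for h :: "'a \<Rightarrow> real"
    by (simp add: True integral_restrict_space)
  then have "summable (\<lambda>n :: nat. sqrt (LINT x|lebesgue_on \<Omega>. h n x))" for h :: "nat \<Rightarrow> 'a \<Rightarrow> real"
    by (simp only: real_sqrt_zero summable_zero)
  then have "L2_on \<Omega> (\<lambda>x. \<Sum>n. - laplacian (?g n) x)"
    "weak_solution \<Omega> (\<lambda>x. \<Sum>n. - laplacian (?g n) x) (\<lambda>x. \<Sum>n. ?g n x)"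
    by (intro weak_solution_series test_function_0; simp add: True)+
  then show ?thesis using True by auto
next
  case False
  then obtain B A K Z s \<delta> f where "block_family \<Omega> B A K Z s \<delta> f"
    using block_family_exists[OF assms(1,2,3)] by blast
  then show ?thesis by (rule block_family.maximally_singular_solution)
qed

end
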